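(* Let $(E,\mathcal{P})$ be a random locally convex module over $K$ with base $(\Omega,\mathcal{F},P)$ and let $M$ be an $L^{0}(\mathcal{F},K)$-submodule of $E$, endowed with the family of restrictions to $M$ of the members of $\mathcal{P}$ (and the topologies $\mathcal{T}_c$, $\mathcal{T}_{\varepsilon,\lambda}$ this family induces). Then: (1) Every continuous $L^{0}$-linear function $f$ from $(M,\mathcal{T}_{c})$ to $(L^{0}(\mathcal{F},K),\mathcal{T}_{c})$ admits a continuous $L^{0}$-linear extension $g$ from $(E,\mathcal{T}_{c})$ to $(L^{0}(\mathcal{F},K),\mathcal{T}_{c})$. (2) Every continuous $L^{0}$-linear function $f$ from $(M,\mathcal{T}_{\varepsilon,\lambda})$ to $(L^{0}(\mathcal{F},K),\mathcal{T}_{\varepsilon,\lambda})$ admits a continuous $L^{0}$-linear extension $g$ from $(E,\mathcal{T}_{\varepsilon,\lambda})$ to $(L^{0}(\mathcal{F},K),\mathcal{T}_{\varepsilon,\lambda})$. (3) If $(E,\mathcal{P})$ is a random normed module $(E,\|\cdot\|)$, then $g$ in both (1) and (2) can be required to satisfy $\|g\|^{*}=\|f\|^{*}$.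
   Context: $(\Omega,\mathcal{F},P)$ is a probability space, $K=\mathbb{R}$ or $\mathbb{C}$, and $L^{0}(\mathcal{F},K)$ is the algebra of equivalence classes (under a.s. equality) of $K$-valued $\mathcal{F}$-measurable functions. $L^0(\mathcal F,\mathbb R)$ is ordered by a.s. pointwise order, and $\vee,\wedge$ denote lattice supremum and infimum. $L^0_+=\{\xi\in L^0(\mathcal F,\mathbb R):\xi\ge 0\}$; $L^0_{++}$ is the set of $\xi\in L^0_+$ with $\xi>0$ a.s. on $\Omega$. For a left $L^{0}(\mathcal{F},K)$-module $E$, an $L^0$-seminorm is a map $\|\cdot\|:E\to L^0_+$ with $\|\xi x\|=|\xi|\,\|x\|$ and $\|x+y\|\le\|x\|+\|y\|$ for all $\xi\in L^0(\mathcal F,K)$, $x,y\in E$. A random locally convex module over $K$ with base $(\Omega,\mathcal F,P)$ is a pair $(E,\mathcal P)$ of a left $L^0(\mathcal F,K)$-module $E$ and a family $\mathcal P$ of $L^0$-seminorms on $E$ such that $\vee\{\|x\|:\|\cdot\|\in\mathcal P\}=0$ iff $x=\theta$ (null element). If $\mathcal P$ consists of a single $L^0$-seminorm $\|\cdot\|$ (then called an $L^0$-norm), $(E,\|\cdot\|)$ is a random normed module. For finite $Q\subset\mathcal P$ put $\|x\|_Q=\vee\{\|x\|:\|\cdot\|\in Q\}$. $\mathcal T_{\varepsilon,\lambda}$ is the linear topology on $E$ with local base at $\theta$ formed by the sets $\{x: P\{\omega:\|x\|_Q(\omega)<\varepsilon\}>1-\lambda\}$, $Q\subset\mathcal P$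 finite, $\varepsilon>0$, $0<\lambda<1$. $\mathcal T_c$ is the topology in which $G\subset E$ is open iff for every $x\in G$ there are a finite $Q\subset\mathcal P$ and $\varepsilon\in L^0_{++}$ with $x+\{y:\|y\|_Q\le\varepsilon\}\subset G$. $L^0(\mathcal F,K)$ carries the two topologies induced by the $L^0$-norm $|\cdot|$. An $L^0$-linear function on an $L^0(\mathcal F,K)$-module is a module homomorphism into $L^0(\mathcal F,K)$. For a random normed module $(E,\|\cdot\|)$ and a continuous $L^0$-linear function $f$ on $E$ (continuity for $\mathcal T_c$ and for $\mathcal T_{\varepsilon,\lambda}$ coincide and mean $|f(x)|\le\xi\|x\|$ for all $x\in E$, for some $\xi\in L^0_+$), $\|f\|^*=\wedge\{\xi\in L^0_+: |f(x)|\le\xi\|x\|\ \forall x\in E\}$; the same definition is used on $M$ with $\|\cdot\|$ restricted to $M$. *)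

theory Defs
  imports "HOL-Probability.Probability" "HOL-Algebra.Module"
begin

section \<open>The algebra of classes of measurable functions\<close>

definition L0_rel :: "'w measure \<Rightarrow> (('w \<Rightarrow> 'k::real_normed_field) \<times> ('w \<Rightarrow> 'k)) set" where
  "L0_rel P = {(f, g). f \<in> borel_measurable P \<and> g \<in> borel_measurable P \<and> (AE \<omega> in P. f \<omega> = g \<omega>)}"

definition L0_class :: "'w measure \<Rightarrow> ('w \<Rightarrow> 'k::real_normed_field) \<Rightarrow> ('w \<Rightarrow> 'k) set" where
  "L0_class P f = L0_rel P `` {f}"

definition L0_rep :: "('w \<Rightarrow> 'k) set \<Rightarrow> 'w \<Rightarrow> 'k" where
  "L0_rep \<xi> = (SOME f. f \<in> \<xi>)"

text \<open>
  The algebra is a module record, so the same object serves as the ring of scalars of a module and,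
  with \<open>smult = mult\<close>, as a module over itself.
\<close>

definition L0 :: "'w measure \<Rightarrow> (('w \<Rightarrow> 'k::real_normed_field) set, ('w \<Rightarrow> 'k) set) module" where
  "L0 P = \<lparr>carrier = borel_measurable P // L0_rel P,
           mult = (\<lambda>\<xi> \<eta>. L0_class P (\<lambda>\<omega>. L0_rep \<xi> \<omega> * L0_rep \<eta> \<omega>)),
           one = L0_class P (\<lambda>\<omega>. 1),
           zero = L0_class P (\<lambda>\<omega>. 0),
           add = (\<lambda>\<xi> \<eta>. L0_class P (\<lambda>\<omega>. L0_rep \<xi> \<omega> + L0_rep \<eta> \<omega>)),
           smult = (\<lambda>\<xi> \<eta>. L0_class P (\<lambda>\<omega>. L0_rep \<xi> \<omega> * L0_rep \<eta> \<omega>))\<rparr>"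

definition L0_abs :: "'w measure \<Rightarrow> ('w \<Rightarrow> 'k::real_normed_field) set \<Rightarrow> ('w \<Rightarrow> real) set" where
  "L0_abs P \<xi> = L0_class P (\<lambda>\<omega>. norm (L0_rep \<xi> \<omega>))"

definition L0_order :: "'w measure \<Rightarrow> ('w \<Rightarrow> real) set gorder" where
  "L0_order P = \<lparr>carrier = carrier (L0 P), eq = (=),
                 le = (\<lambda>\<xi> \<eta>. AE \<omega> in P. L0_rep \<xi> \<omega> \<le> L0_rep \<eta> \<omega>)\<rparr>"

definition L0_plus :: "'w measure \<Rightarrow> ('w \<Rightarrow> real) set set" where
  "L0_plus P = {\<xi> \<in> carrier (L0 P). \<zero>\<^bsub>L0 P\<^esub> \<sqsubseteq>\<^bsub>L0_order P\<^esub> \<xi>}"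

definition L0_plusplus :: "'w measure \<Rightarrow> ('w \<Rightarrow> real) set set" where
  "L0_plusplus P = {\<xi> \<in> L0_plus P. AE \<omega> in P. 0 < L0_rep \<xi> \<omega>}"


section \<open>Random locally convex modules\<close>

text \<open>
  Seminorms are total functions on the ambient type, but only their values on the carrier matter;
  hence the same functions also serve as the restricted seminorms on a submodule
  \<open>E\<lparr>carrier := M\<rparr>\<close>.
\<close>

definition L0_seminorm ::
  "'w measure \<Rightarrow> (('w \<Rightarrow> 'k::real_normed_field) set, 'a) module \<Rightarrow> ('a \<Rightarrow> ('w \<Rightarrow> real) set) \<Rightarrow> bool" where
  "L0_seminorm P E p \<longleftrightarrow>
     p \<in> carrier E \<rightarrow> L0_plus P \<and>
     (\<forall>\<xi>\<in>carrier (L0 P). \<forall>x\<in>carrier E. p (\<xi> \<odot>\<^bsub>E\<^esub> x) = L0_abs P \<xi> \<otimes>\<^bsub>L0 P\<^esub> p x) \<and>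
     (\<forall>x\<in>carrier E. \<forall>y\<in>carrier E. p (x \<oplus>\<^bsub>E\<^esub> y) \<sqsubseteq>\<^bsub>L0_order P\<^esub> p x \<oplus>\<^bsub>L0 P\<^esub> p y)"

text \<open>
  An infinite family need not have a supremum in \<open>L0\<close> (it may be infinite on a set of positive
  measure), so ``the supremum is zero'' is expressed by \<^const>\<open>least\<close> rather than by an equation
  with the choice-based \<open>\<Squnion>\<close>. As \<open>L0\<close> over a probability space has no least element, this also
  forces \<open>\<P>\<close> to be nonempty.
\<close>

definition random_locally_convex_module ::
  "'w measure \<Rightarrow> (('w \<Rightarrow> 'k::real_normed_field) set, 'a) module \<Rightarrow> ('a \<Rightarrow> ('w \<Rightarrow> real) set) set \<Rightarrow> bool" where
  "random_locally_convex_module P E \<P> \<longleftrightarrow>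
     prob_space P \<and> module (L0 P) E \<and> (\<forall>p\<in>\<P>. L0_seminorm P E p) \<and>
     (\<forall>x\<in>carrier E.
        least (L0_order P) \<zero>\<^bsub>L0 P\<^esub> (Upper (L0_order P) {p x |p. p \<in> \<P>}) \<longleftrightarrow> x = \<zero>\<^bsub>E\<^esub>)"

definition random_normed_module ::
  "'w measure \<Rightarrow> (('w \<Rightarrow> 'k::real_normed_field) set, 'a) module \<Rightarrow> ('a \<Rightarrow> ('w \<Rightarrow> real) set) \<Rightarrow> bool" where
  "random_normed_module P E p \<longleftrightarrow> random_locally_convex_module P E {p}"

definition Q_norm :: "'w measure \<Rightarrow> ('a \<Rightarrow> ('w \<Rightarrow> real) set) set \<Rightarrow> 'a \<Rightarrow> ('w \<Rightarrow> real) set" where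
  "Q_norm P Q x = \<Squnion>\<^bsub>L0_order P\<^esub> {p x |p. p \<in> Q}"

text \<open>
  Only nonempty finite \<open>Q\<close> are used: the empty supremum does not exist in \<open>L0\<close>, and the empty
  \<open>Q\<close> would contribute just the whole module as a neighbourhood of the null element.
\<close>

definition topology_c ::
  "'w measure \<Rightarrow> (('w \<Rightarrow> 'k::real_normed_field) set, 'a) module \<Rightarrow> ('a \<Rightarrow> ('w \<Rightarrow> real) set) set
     \<Rightarrow> 'a topology" where
  "topology_c P E \<P> = topology (\<lambda>G. G \<subseteq> carrier E \<and>
     (\<forall>x\<in>G. \<exists>Q \<epsilon>. finite Q \<and> Q \<noteq> {} \<and> Q \<subseteq> \<P> \<and> \<epsilon> \<in> L0_plusplus P \<and>
        {x \<oplus>\<^bsub>E\<^esub> y |y. y \<in> carrier E \<and> Q_norm P Q y \<sqsubseteq>\<^bsub>L0_order P\<^esub> \<epsilon>} \<subseteq> G))"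

definition nhd_el ::
  "'w measure \<Rightarrow> (('w \<Rightarrow> 'k::real_normed_field) set, 'a) module \<Rightarrow> ('a \<Rightarrow> ('w \<Rightarrow> real) set) set
     \<Rightarrow> real \<Rightarrow> real \<Rightarrow> 'a set" where
  "nhd_el P E Q \<epsilon> \<delta> =
     {x \<in> carrier E. measure P {\<omega> \<in> space P. L0_rep (Q_norm P Q x) \<omega> < \<epsilon>} > 1 - \<delta>}"

text \<open>
  The linear topology with the sets \<^const>\<open>nhd_el\<close> as local base at the null element: a set is open
  iff around each of its points it contains a translate of one of them.
\<close>

definition topology_el ::
  "'w measure \<Rightarrow> (('w \<Rightarrow> 'k::real_normed_field) set, 'a) module \<Rightarrow> ('a \<Rightarrow> ('w \<Rightarrow> real) set) set
     \<Rightarrow> 'a topology" where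
  "topology_el P E \<P> = topology (\<lambda>G. G \<subseteq> carrier E \<and>
     (\<forall>x\<in>G. \<exists>Q \<epsilon> \<delta>. finite Q \<and> Q \<noteq> {} \<and> Q \<subseteq> \<P> \<and> 0 < \<epsilon> \<and> 0 < \<delta> \<and> \<delta> < 1 \<and>
        {x \<oplus>\<^bsub>E\<^esub> y |y. y \<in> nhd_el P E Q \<epsilon> \<delta>} \<subseteq> G))"


section \<open>Continuous linear functions\<close>

definition L0_linear ::
  "'w measure \<Rightarrow> (('w \<Rightarrow> 'k::real_normed_field) set, 'a) module \<Rightarrow> ('a \<Rightarrow> ('w \<Rightarrow> 'k) set) \<Rightarrow> bool" where
  "L0_linear P E f \<longleftrightarrow>
     f \<in> carrier E \<rightarrow> carrier (L0 P) \<and>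
     (\<forall>x\<in>carrier E. \<forall>y\<in>carrier E. f (x \<oplus>\<^bsub>E\<^esub> y) = f x \<oplus>\<^bsub>L0 P\<^esub> f y) \<and>
     (\<forall>\<xi>\<in>carrier (L0 P). \<forall>x\<in>carrier E. f (\<xi> \<odot>\<^bsub>E\<^esub> x) = \<xi> \<otimes>\<^bsub>L0 P\<^esub> f x)"

definition cont_linear_c ::
  "'w measure \<Rightarrow> (('w \<Rightarrow> 'k::real_normed_field) set, 'a) module \<Rightarrow> ('a \<Rightarrow> ('w \<Rightarrow> real) set) set
     \<Rightarrow> ('a \<Rightarrow> ('w \<Rightarrow> 'k) set) \<Rightarrow> bool" where
  "cont_linear_c P E \<P> f \<longleftrightarrow>
     L0_linear P E f \<and> continuous_map (topology_c P E \<P>) (topology_c P (L0 P) {L0_abs P}) f"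

definition cont_linear_el ::
  "'w measure \<Rightarrow> (('w \<Rightarrow> 'k::real_normed_field) set, 'a) module \<Rightarrow> ('a \<Rightarrow> ('w \<Rightarrow> real) set) set
     \<Rightarrow> ('a \<Rightarrow> ('w \<Rightarrow> 'k) set) \<Rightarrow> bool" where
  "cont_linear_el P E \<P> f \<longleftrightarrow>
     L0_linear P E f \<and> continuous_map (topology_el P E \<P>) (topology_el P (L0 P) {L0_abs P}) f"

definition dual_norm ::
  "'w measure \<Rightarrow> (('w \<Rightarrow> 'k::real_normed_field) set, 'a) module \<Rightarrow> ('a \<Rightarrow> ('w \<Rightarrow> real) set)
     \<Rightarrow> ('a \<Rightarrow> ('w \<Rightarrow> 'k) set) \<Rightarrow> ('w \<Rightarrow> real) set" where
  "dual_norm P E p f = \<Sqinter>\<^bsub>L0_order P\<^esub>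
     {\<xi> \<in> L0_plus P. \<forall>x\<in>carrier E. L0_abs P (f x) \<sqsubseteq>\<^bsub>L0_order P\<^esub> \<xi> \<otimes>\<^bsub>L0 P\<^esub> p x}"


section \<open>Well-definedness\<close>

text \<open>
  The remaining lemmas justify the uses of \<open>SOME\<close> and of \<^const>\<open>topology\<close> above, and show that
  \<open>L0\<close> is a commutative ring and, with the absolute value, a random normed module over itself.
\<close>

lemma L0_rel_equiv: "equiv (borel_measurable P) (L0_rel P)"
  by (rule equivI) (auto simp: L0_rel_def refl_on_def sym_def trans_def)

lemma carrier_L0: "carrier (L0 P) = borel_measurable P // L0_rel P"
  by (simp add: L0_def)

lemma L0_class_in [simp]: "f \<in> borel_measurable P \<Longrightarrow> L0_class P f \<in> carrier (L0 P)"
  by (simp add: carrier_L0 L0_class_def quotientI)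

lemma L0_class_eq_iff:
  assumes "f \<in> borel_measurable P" "g \<in> borel_measurable P"
  shows "L0_class P f = L0_class P g \<longleftrightarrow> (AE \<omega> in P. f \<omega> = g \<omega>)"
  unfolding L0_class_def eq_equiv_class_iff[OF L0_rel_equiv assms]
  using assms by (simp add: L0_rel_def)

lemma L0_rep_class:
  assumes "f \<in> borel_measurable P"
  shows "L0_rep (L0_class P f) \<in> borel_measurable P" "AE \<omega> in P. L0_rep (L0_class P f) \<omega> = f \<omega>"
proof -
  have "f \<in> L0_class P f"
    using assms by (simp add: L0_class_def L0_rel_def)
  hence "L0_rep (L0_class P f) \<in> L0_class P f"
    unfolding L0_rep_def by (rule someI[where P="\<lambda>h. h \<in> L0_class P f"])
  hence *: "(f, L0_rep (L0_class P f)) \<in> L0_rel P"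
    by (simp add: L0_class_def)
  thus "L0_rep (L0_class P f) \<in> borel_measurable P" "AE \<omega> in P. L0_rep (L0_class P f) \<omega> = f \<omega>"
    by (auto simp: L0_rel_def elim: eventually_mono)
qed

lemma L0_cases:
  assumes "\<xi> \<in> carrier (L0 P)"
  obtains f where "f \<in> borel_measurable P" "\<xi> = L0_class P f"
  using assms by (auto simp: carrier_L0 L0_class_def elim: quotientE)

lemma L0_rep_measurable [measurable]: "\<xi> \<in> carrier (L0 P) \<Longrightarrow> L0_rep \<xi> \<in> borel_measurable P"
  by (metis L0_cases L0_rep_class(1))

lemma L0_class_rep: "\<xi> \<in> carrier (L0 P) \<Longrightarrow> L0_class P (L0_rep \<xi>) = \<xi>"
  by (metis L0_cases L0_rep_class L0_class_eq_iff)

lemma L0_eqI: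
  assumes "\<xi> \<in> carrier (L0 P)" "\<eta> \<in> carrier (L0 P)" "AE \<omega> in P. L0_rep \<xi> \<omega> = L0_rep \<eta> \<omega>"
  shows "\<xi> = \<eta>"
  using assms L0_class_eq_iff[of "L0_rep \<xi>" P "L0_rep \<eta>"]
  by (simp add: L0_class_rep L0_rep_measurable)

lemma L0_closed:
  fixes \<xi> \<eta> :: "('w \<Rightarrow> 'k::{real_normed_field, second_countable_topology}) set"
  shows "\<zero>\<^bsub>L0 P\<^esub> \<in> carrier (L0 P :: (('w \<Rightarrow> 'k) set, ('w \<Rightarrow> 'k) set) module)"
    "\<one>\<^bsub>L0 P\<^esub> \<in> carrier (L0 P :: (('w \<Rightarrow> 'k) set, ('w \<Rightarrow> 'k) set) module)"
    "\<xi> \<in> carrier (L0 P) \<Longrightarrow> L0_abs P \<xi> \<in> carrier (L0 P)"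
    "\<xi> \<in> carrier (L0 P) \<Longrightarrow> \<eta> \<in> carrier (L0 P) \<Longrightarrow> \<xi> \<oplus>\<^bsub>L0 P\<^esub> \<eta> \<in> carrier (L0 P)"
    "\<xi> \<in> carrier (L0 P) \<Longrightarrow> \<eta> \<in> carrier (L0 P) \<Longrightarrow> \<xi> \<otimes>\<^bsub>L0 P\<^esub> \<eta> \<in> carrier (L0 P)"
proof -
  have "L0_class P (\<lambda>_. 0::'k) \<in> carrier (L0 P)" by (rule L0_class_in) simp
  thus "\<zero>\<^bsub>L0 P\<^esub> \<in> carrier (L0 P :: (('w \<Rightarrow> 'k) set, ('w \<Rightarrow> 'k) set) module)" by (simp add: L0_def)
  have "L0_class P (\<lambda>_. 1::'k) \<in> carrier (L0 P)" by (rule L0_class_in) simp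
  thus "\<one>\<^bsub>L0 P\<^esub> \<in> carrier (L0 P :: (('w \<Rightarrow> 'k) set, ('w \<Rightarrow> 'k) set) module)" by (simp add: L0_def)
next
  assume "\<xi> \<in> carrier (L0 P)"
  note [measurable] = L0_rep_measurable[OF this]
  show "L0_abs P \<xi> \<in> carrier (L0 P)" unfolding L0_abs_def by (rule L0_class_in) measurable
next
  assume "\<xi> \<in> carrier (L0 P)" "\<eta> \<in> carrier (L0 P)"
  note [measurable] = this[THEN L0_rep_measurable]
  have "L0_class P (\<lambda>\<omega>. L0_rep \<xi> \<omega> + L0_rep \<eta> \<omega>) \<in> carrier (L0 P)"
    "L0_class P (\<lambda>\<omega>. L0_rep \<xi> \<omega> * L0_rep \<eta> \<omega>) \<in> carrier (L0 P)"
    by (rule L0_class_in; measurable)+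
  thus "\<xi> \<oplus>\<^bsub>L0 P\<^esub> \<eta> \<in> carrier (L0 P)" "\<xi> \<otimes>\<^bsub>L0 P\<^esub> \<eta> \<in> carrier (L0 P)"
    by (simp_all add: L0_def)
qed

lemma L0_rep_ops:
  fixes \<xi> \<eta> :: "('w \<Rightarrow> 'k::{real_normed_field, second_countable_topology}) set"
  assumes "\<xi> \<in> carrier (L0 P)" "\<eta> \<in> carrier (L0 P)"
  shows "AE \<omega> in P. L0_rep (\<xi> \<oplus>\<^bsub>L0 P\<^esub> \<eta>) \<omega> = L0_rep \<xi> \<omega> + L0_rep \<eta> \<omega>"
    "AE \<omega> in P. L0_rep (\<xi> \<otimes>\<^bsub>L0 P\<^esub> \<eta>) \<omega> = L0_rep \<xi> \<omega> * L0_rep \<eta> \<omega>"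
    "AE \<omega> in P. L0_rep (\<xi> \<odot>\<^bsub>L0 P\<^esub> \<eta>) \<omega> = L0_rep \<xi> \<omega> * L0_rep \<eta> \<omega>"
    "AE \<omega> in P. L0_rep (L0_abs P \<xi>) \<omega> = norm (L0_rep \<xi> \<omega>)"
proof -
  note [measurable] = assms[THEN L0_rep_measurable]
  show "AE \<omega> in P. L0_rep (\<xi> \<oplus>\<^bsub>L0 P\<^esub> \<eta>) \<omega> = L0_rep \<xi> \<omega> + L0_rep \<eta> \<omega>"
    "AE \<omega> in P. L0_rep (\<xi> \<otimes>\<^bsub>L0 P\<^esub> \<eta>) \<omega> = L0_rep \<xi> \<omega> * L0_rep \<eta> \<omega>"
    "AE \<omega> in P. L0_rep (\<xi> \<odot>\<^bsub>L0 P\<^esub> \<eta>) \<omega> = L0_rep \<xi> \<omega> * L0_rep \<eta> \<omega>"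
    "AE \<omega> in P. L0_rep (L0_abs P \<xi>) \<omega> = norm (L0_rep \<xi> \<omega>)"
    unfolding L0_def L0_abs_def module.simps ring.simps monoid.simps
    by (intro L0_rep_class(2); measurable)+
qed

lemma L0_rep_consts:
  "AE \<omega> in P. L0_rep \<zero>\<^bsub>L0 P\<^esub> \<omega> = (0::'k::{real_normed_field, second_countable_topology})"
  "AE \<omega> in P. L0_rep \<one>\<^bsub>L0 P\<^esub> \<omega> = (1::'k)"
  unfolding L0_def module.simps ring.simps monoid.simps
  by (intro L0_rep_class(2); simp)+

lemma L0_cring:
  "cring (L0 P :: (('w \<Rightarrow> 'k::{real_normed_field, second_countable_topology}) set, ('w \<Rightarrow> 'k) set) module)"
    (is "cring ?R")
proof (rule cringI)
  show "abelian_group ?R"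
  proof (rule abelian_groupI)
    fix x y z assume xyz: "x \<in> carrier ?R" "y \<in> carrier ?R" "z \<in> carrier ?R"
    show "x \<oplus>\<^bsub>?R\<^esub> y \<oplus>\<^bsub>?R\<^esub> z = x \<oplus>\<^bsub>?R\<^esub> (y \<oplus>\<^bsub>?R\<^esub> z)"
      using L0_rep_ops(1)[of "x \<oplus>\<^bsub>?R\<^esub> y" P z] L0_rep_ops(1)[of x P "y \<oplus>\<^bsub>?R\<^esub> z"]
        L0_rep_ops(1)[of x P y] L0_rep_ops(1)[of y P z]
      by (intro L0_eqI[of _ P]) (auto simp: L0_closed xyz)
    show "x \<oplus>\<^bsub>?R\<^esub> y = y \<oplus>\<^bsub>?R\<^esub> x"
      using L0_rep_ops(1)[of x P y] L0_rep_ops(1)[of y P x]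
      by (intro L0_eqI[of _ P]) (auto simp: L0_closed xyz)
    show "\<zero>\<^bsub>?R\<^esub> \<oplus>\<^bsub>?R\<^esub> x = x"
      using L0_rep_ops(1)[of "\<zero>\<^bsub>?R\<^esub>" P x] L0_rep_consts(1)[where 'k='k and P=P]
      by (intro L0_eqI[of _ P]) (auto simp: L0_closed xyz)
    show "\<exists>y\<in>carrier ?R. y \<oplus>\<^bsub>?R\<^esub> x = \<zero>\<^bsub>?R\<^esub>"
    proof
      have m: "(\<lambda>\<omega>. - L0_rep x \<omega>) \<in> borel_measurable P"
        using L0_rep_measurable[OF xyz(1)] by measurable
      show c: "L0_class P (\<lambda>\<omega>. - L0_rep x \<omega>) \<in> carrier ?R" using m by simp
      show "L0_class P (\<lambda>\<omega>. - L0_rep x \<omega>) \<oplus>\<^bsub>?R\<^esub> x = \<zero>\<^bsub>?R\<^esub>"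
        using L0_rep_ops(1)[OF c xyz(1)] L0_rep_consts(1)[where 'k='k and P=P] L0_rep_class(2)[OF m]
        by (intro L0_eqI[of _ P]) (auto simp: L0_closed c xyz)
    qed
  qed (auto simp: L0_closed)
  show "comm_monoid ?R"
  proof (rule comm_monoidI)
    fix x y z assume xyz: "x \<in> carrier ?R" "y \<in> carrier ?R" "z \<in> carrier ?R"
    show "x \<otimes>\<^bsub>?R\<^esub> y \<otimes>\<^bsub>?R\<^esub> z = x \<otimes>\<^bsub>?R\<^esub> (y \<otimes>\<^bsub>?R\<^esub> z)"
      using L0_rep_ops(2)[of "x \<otimes>\<^bsub>?R\<^esub> y" P z] L0_rep_ops(2)[of x P "y \<otimes>\<^bsub>?R\<^esub> z"]
        L0_rep_ops(2)[of x P y] L0_rep_ops(2)[of y P z]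
      by (intro L0_eqI[of _ P]) (auto simp: L0_closed xyz)
    show "x \<otimes>\<^bsub>?R\<^esub> y = y \<otimes>\<^bsub>?R\<^esub> x"
      using L0_rep_ops(2)[of x P y] L0_rep_ops(2)[of y P x]
      by (intro L0_eqI[of _ P]) (auto simp: L0_closed xyz)
    show "\<one>\<^bsub>?R\<^esub> \<otimes>\<^bsub>?R\<^esub> x = x"
      using L0_rep_ops(2)[of "\<one>\<^bsub>?R\<^esub>" P x] L0_rep_consts(2)[where 'k='k and P=P]
      by (intro L0_eqI[of _ P]) (auto simp: L0_closed xyz)
  qed (auto simp: L0_closed)
  fix x y z assume xyz: "x \<in> carrier ?R" "y \<in> carrier ?R" "z \<in> carrier ?R"
  show "(x \<oplus>\<^bsub>?R\<^esub> y) \<otimes>\<^bsub>?R\<^esub> z = x \<otimes>\<^bsub>?R\<^esub> z \<oplus>\<^bsub>?R\<^esub> y \<otimes>\<^bsub>?R\<^esub> z"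
    using L0_rep_ops(2)[of "x \<oplus>\<^bsub>?R\<^esub> y" P z] L0_rep_ops(1)[of "x \<otimes>\<^bsub>?R\<^esub> z" P "y \<otimes>\<^bsub>?R\<^esub> z"]
      L0_rep_ops(1)[of x P y] L0_rep_ops(2)[of x P z] L0_rep_ops(2)[of y P z]
    by (intro L0_eqI[of _ P]) (auto simp: L0_closed xyz algebra_simps)
qed

lemma L0_self_module:
  "module (L0 P) (L0 P :: (('w \<Rightarrow> 'k::{real_normed_field, second_countable_topology}) set, ('w \<Rightarrow> 'k) set) module)"
    (is "module ?R _")
proof -
  interpret cring ?R by (rule L0_cring)
  have [simp]: "x \<odot>\<^bsub>?R\<^esub> y = x \<otimes>\<^bsub>?R\<^esub> y" for x y by (simp add: L0_def)
  show ?thesis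
    by (rule moduleI) (auto simp: L0_cring abelian_group_axioms l_distr r_distr m_assoc)
qed

lemma L0_partial_order: "partial_order (L0_order P)"
proof
  fix x y z
  assume "x \<sqsubseteq>\<^bsub>L0_order P\<^esub> y" "y \<sqsubseteq>\<^bsub>L0_order P\<^esub> z"
  thus "x \<sqsubseteq>\<^bsub>L0_order P\<^esub> z" by (auto simp: L0_order_def)
next
  fix x y
  assume "x \<sqsubseteq>\<^bsub>L0_order P\<^esub> y" "y \<sqsubseteq>\<^bsub>L0_order P\<^esub> x" "x \<in> carrier (L0_order P)" "y \<in> carrier (L0_order P)"
  hence le: "AE \<omega> in P. L0_rep x \<omega> \<le> L0_rep y \<omega>" "AE \<omega> in P. L0_rep y \<omega> \<le> L0_rep x \<omega>"
    and c: "x \<in> carrier (L0 P)" "y \<in> carrier (L0 P)"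
    by (simp_all add: L0_order_def)
  from le have "AE \<omega> in P. L0_rep x \<omega> = L0_rep y \<omega>" by eventually_elim simp
  hence "x = y" using c by (intro L0_eqI[of _ P])
  thus "x .=\<^bsub>L0_order P\<^esub> y" by (simp add: L0_order_def)
qed (auto simp: L0_order_def)

lemma L0_upper_semilattice: "upper_semilattice (L0_order P)"
proof -
  interpret partial_order "L0_order P" by (rule L0_partial_order)
  show ?thesis
  proof
    fix x y assume xy: "x \<in> carrier (L0_order P)" "y \<in> carrier (L0_order P)"
    hence xy': "x \<in> carrier (L0 P)" "y \<in> carrier (L0 P)" by (auto simp: L0_order_def)
    note [measurable] = xy'[THEN L0_rep_measurable]
    define s where "s = L0_class P (\<lambda>\<omega>. max (L0_rep x \<omega>) (L0_rep y \<omega>))"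
    have m: "(\<lambda>\<omega>. max (L0_rep x \<omega>) (L0_rep y \<omega>)) \<in> borel_measurable P" by measurable
    have "s \<in> carrier (L0_order P)" using m by (simp add: s_def L0_order_def)
    have r: "AE \<omega> in P. L0_rep s \<omega> = max (L0_rep x \<omega>) (L0_rep y \<omega>)"
      unfolding s_def by (rule L0_rep_class(2)[OF m])
    have "least (L0_order P) s (Upper (L0_order P) {x, y})"
    proof (rule least_UpperI)
      fix z assume "z \<in> {x, y}"
      thus "z \<sqsubseteq>\<^bsub>L0_order P\<^esub> s" using r by (auto simp: L0_order_def elim!: eventually_mono)
    next
      fix z assume "z \<in> Upper (L0_order P) {x, y}"
      hence "AE \<omega> in P. L0_rep x \<omega> \<le> L0_rep z \<omega>" "AE \<omega> in P. L0_rep y \<omega> \<le> L0_rep z \<omega>"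
        using xy by (auto simp: Upper_def L0_order_def)
      with r have "AE \<omega> in P. L0_rep s \<omega> \<le> L0_rep z \<omega>" by eventually_elim simp
      thus "s \<sqsubseteq>\<^bsub>L0_order P\<^esub> z" by (simp add: L0_order_def)
    qed (use xy \<open>s \<in> carrier (L0_order P)\<close> in auto)
    thus "\<exists>s. least (L0_order P) s (Upper (L0_order P) {x, y})" by blast
  qed
qed

lemma L0_Q_norm_least:
  assumes "finite Q" "Q \<noteq> {}" "\<And>p. p \<in> Q \<Longrightarrow> p x \<in> L0_plus P"
  shows "least (L0_order P) (Q_norm P Q x) (Upper (L0_order P) {p x |p. p \<in> Q})"
proof -
  interpret upper_semilattice "L0_order P" by (rule L0_upper_semilattice)
  have eq: "{p x |p. p \<in> Q} = (\<lambda>p. p x) ` Q" by auto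
  have "least (L0_order P) (\<Squnion>\<^bsub>L0_order P\<^esub> {p x |p. p \<in> Q}) (Upper (L0_order P) {p x |p. p \<in> Q})"
    unfolding eq
    by (rule finite_sup_least) (use assms in \<open>auto simp: L0_plus_def L0_order_def\<close>)
  thus ?thesis by (simp add: Q_norm_def)
qed

lemma L0_Q_norm_mono:
  assumes "finite Q'" "Q \<noteq> {}" "Q \<subseteq> Q'" "\<And>p. p \<in> Q' \<Longrightarrow> p x \<in> L0_plus P"
  shows "AE \<omega> in P. L0_rep (Q_norm P Q x) \<omega> \<le> L0_rep (Q_norm P Q' x) \<omega>"
proof -
  have l: "least (L0_order P) (Q_norm P Q x) (Upper (L0_order P) {p x |p. p \<in> Q})"
    by (rule L0_Q_norm_least) (use assms finite_subset in auto)
  have l': "least (L0_order P) (Q_norm P Q' x) (Upper (L0_order P) {p x |p. p \<in> Q'})"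
    by (rule L0_Q_norm_least) (use assms in auto)
  have "Q_norm P Q' x \<in> Upper (L0_order P) {p x |p. p \<in> Q}"
    using l' \<open>Q \<subseteq> Q'\<close> by (auto simp: least_def Upper_def)
  with l have "Q_norm P Q x \<sqsubseteq>\<^bsub>L0_order P\<^esub> Q_norm P Q' x"
    by (auto simp: least_def)
  thus ?thesis by (simp add: L0_order_def)
qed

lemma L0_Q_norm_carrier:
  assumes "finite Q" "Q \<noteq> {}" "\<And>p. p \<in> Q \<Longrightarrow> p x \<in> L0_plus P"
  shows "Q_norm P Q x \<in> carrier (L0 P)"
  using L0_Q_norm_least[of Q x P] assms by (simp add: least_def Upper_def L0_order_def)

lemma openin_topology_c:
  assumes \<P>: "\<And>p. p \<in> \<P> \<Longrightarrow> p \<in> carrier E \<rightarrow> L0_plus P"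
  shows "openin (topology_c P E \<P>) G \<longleftrightarrow> G \<subseteq> carrier E \<and>
     (\<forall>x\<in>G. \<exists>Q \<epsilon>. finite Q \<and> Q \<noteq> {} \<and> Q \<subseteq> \<P> \<and> \<epsilon> \<in> L0_plusplus P \<and>
        {x \<oplus>\<^bsub>E\<^esub> y |y. y \<in> carrier E \<and> Q_norm P Q y \<sqsubseteq>\<^bsub>L0_order P\<^esub> \<epsilon>} \<subseteq> G)"
proof -
  define B where "B x Q \<epsilon> = {x \<oplus>\<^bsub>E\<^esub> y |y. y \<in> carrier E \<and> Q_norm P Q y \<sqsubseteq>\<^bsub>L0_order P\<^esub> \<epsilon>}" for x Q \<epsilon>
  define ok where "ok Q \<epsilon> \<longleftrightarrow> finite Q \<and> Q \<noteq> {} \<and> Q \<subseteq> \<P> \<and> \<epsilon> \<in> L0_plusplus P" for Q \<epsilon>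
  have inter: "\<exists>Q \<epsilon>. ok Q \<epsilon> \<and> (\<forall>x. B x Q \<epsilon> \<subseteq> B x Q1 e1 \<inter> B x Q2 e2)"
    if "ok Q1 e1" "ok Q2 e2" for Q1 Q2 e1 e2
  proof (intro exI conjI allI)
    let ?m = "\<lambda>\<omega>. min (L0_rep e1 \<omega>) (L0_rep e2 \<omega>)"
    let ?e = "L0_class P ?m"
    have e: "e1 \<in> carrier (L0 P)" "e2 \<in> carrier (L0 P)" "AE \<omega> in P. 0 < L0_rep e1 \<omega>" "AE \<omega> in P. 0 < L0_rep e2 \<omega>"
      using that by (auto simp: ok_def L0_plusplus_def L0_plus_def)
    note [measurable] = e(1,2)[THEN L0_rep_measurable]
    have m: "?m \<in> borel_measurable P" by measurable
    have r: "AE \<omega> in P. L0_rep ?e \<omega> = ?m \<omega>" by (rule L0_rep_class(2)[OF m])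
    have "AE \<omega> in P. L0_rep \<zero>\<^bsub>L0 P\<^esub> \<omega> \<le> L0_rep ?e \<omega>"
      using r e(3,4) L0_rep_consts(1)[where 'k=real and P=P] by (elim AE_mp) auto
    moreover have "AE \<omega> in P. 0 < L0_rep ?e \<omega>" using r e(3,4) by (elim AE_mp) auto
    ultimately show "ok (Q1 \<union> Q2) ?e"
      using that m by (auto simp: ok_def L0_plusplus_def L0_plus_def L0_order_def)
    fix x
    have "Q_norm P Q1 y \<sqsubseteq>\<^bsub>L0_order P\<^esub> e1 \<and> Q_norm P Q2 y \<sqsubseteq>\<^bsub>L0_order P\<^esub> e2"
      if y: "y \<in> carrier E" "Q_norm P (Q1 \<union> Q2) y \<sqsubseteq>\<^bsub>L0_order P\<^esub> ?e" for y
    proof -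
      have "AE \<omega> in P. L0_rep (Q_norm P Q1 y) \<omega> \<le> L0_rep (Q_norm P (Q1 \<union> Q2) y) \<omega>"
        "AE \<omega> in P. L0_rep (Q_norm P Q2 y) \<omega> \<le> L0_rep (Q_norm P (Q1 \<union> Q2) y) \<omega>"
        using \<open>ok Q1 e1\<close> \<open>ok Q2 e2\<close> \<P> y(1)
        by (intro L0_Q_norm_mono; auto simp: ok_def Pi_iff)+
      with y(2) r show ?thesis by (auto simp: L0_order_def elim!: AE_mp)
    qed
    thus "B x (Q1 \<union> Q2) ?e \<subseteq> B x Q1 e1 \<inter> B x Q2 e2" by (auto simp: B_def)
  qed
  have "istopology (\<lambda>G. G \<subseteq> carrier E \<and> (\<forall>x\<in>G. \<exists>Q \<epsilon>. ok Q \<epsilon> \<and> B x Q \<epsilon> \<subseteq> G))"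
    unfolding istopology_def
  proof (intro conjI allI impI)
    fix S T assume S: "S \<subseteq> carrier E \<and> (\<forall>x\<in>S. \<exists>Q \<epsilon>. ok Q \<epsilon> \<and> B x Q \<epsilon> \<subseteq> S)"
      and T: "T \<subseteq> carrier E \<and> (\<forall>x\<in>T. \<exists>Q \<epsilon>. ok Q \<epsilon> \<and> B x Q \<epsilon> \<subseteq> T)"
    show "S \<inter> T \<subseteq> carrier E" using S by blast
    show "\<forall>x\<in>S \<inter> T. \<exists>Q \<epsilon>. ok Q \<epsilon> \<and> B x Q \<epsilon> \<subseteq> S \<inter> T"
    proof
      fix x assume "x \<in> S \<inter> T"
      with S T obtain Q1 e1 Q2 e2 where "ok Q1 e1" "B x Q1 e1 \<subseteq> S" "ok Q2 e2" "B x Q2 e2 \<subseteq> T" by blast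
      moreover from inter[OF this(1,3)] obtain Q \<epsilon>
        where "ok Q \<epsilon>" "\<forall>x. B x Q \<epsilon> \<subseteq> B x Q1 e1 \<inter> B x Q2 e2" by blast
      ultimately show "\<exists>Q \<epsilon>. ok Q \<epsilon> \<and> B x Q \<epsilon> \<subseteq> S \<inter> T" by blast
    qed
  next
    fix K assume K: "\<forall>S\<in>K. S \<subseteq> carrier E \<and> (\<forall>x\<in>S. \<exists>Q \<epsilon>. ok Q \<epsilon> \<and> B x Q \<epsilon> \<subseteq> S)"
    show "\<Union>K \<subseteq> carrier E" using K by blast
    show "\<forall>x\<in>\<Union>K. \<exists>Q \<epsilon>. ok Q \<epsilon> \<and> B x Q \<epsilon> \<subseteq> \<Union>K"
    proof
      fix x assume "x \<in> \<Union>K"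
      then obtain S where S: "S \<in> K" "x \<in> S" by blast
      with K have "\<exists>Q \<epsilon>. ok Q \<epsilon> \<and> B x Q \<epsilon> \<subseteq> S" by blast
      with S(1) show "\<exists>Q \<epsilon>. ok Q \<epsilon> \<and> B x Q \<epsilon> \<subseteq> \<Union>K" by (meson Union_upper subset_trans)
    qed
  qed
  from topology_inverse'[OF this] show ?thesis
    unfolding topology_c_def by (simp only: ok_def B_def conj_assoc)
qed

lemma openin_topology_el:
  assumes "prob_space P" and \<P>: "\<And>p. p \<in> \<P> \<Longrightarrow> p \<in> carrier E \<rightarrow> L0_plus P"
  shows "openin (topology_el P E \<P>) G \<longleftrightarrow> G \<subseteq> carrier E \<and>
     (\<forall>x\<in>G. \<exists>Q \<epsilon> \<delta>. finite Q \<and> Q \<noteq> {} \<and> Q \<subseteq> \<P> \<and> 0 < \<epsilon> \<and> 0 < \<delta> \<and> \<delta> < 1 \<and>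
        {x \<oplus>\<^bsub>E\<^esub> y |y. y \<in> nhd_el P E Q \<epsilon> \<delta>} \<subseteq> G)"
proof -
  interpret prob_space P by fact
  define B where "B x Q \<epsilon> l = {x \<oplus>\<^bsub>E\<^esub> y |y. y \<in> nhd_el P E Q \<epsilon> l}" for x Q \<epsilon> l
  define ok where "ok Q \<epsilon> l \<longleftrightarrow> finite Q \<and> Q \<noteq> {} \<and> Q \<subseteq> \<P> \<and> 0 < \<epsilon> \<and> 0 < l \<and> l < 1" for Q and \<epsilon> l :: real
  have mono: "nhd_el P E Q' \<epsilon>' l' \<subseteq> nhd_el P E Q \<epsilon> l"
    if "finite Q'" "Q' \<subseteq> \<P>" "Q \<noteq> {}" "Q \<subseteq> Q'" "\<epsilon>' \<le> \<epsilon>" "l' \<le> l" for Q Q' \<epsilon> \<epsilon>' l l'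
  proof
    fix x assume x: "x \<in> nhd_el P E Q' \<epsilon>' l'"
    have xp: "p x \<in> L0_plus P" if "p \<in> Q'" for p
      using that x \<P> \<open>Q' \<subseteq> \<P>\<close> by (auto simp: nhd_el_def Pi_iff)
    have "Q_norm P Q x \<in> carrier (L0 P)"
      by (rule L0_Q_norm_carrier) (use that xp in \<open>auto intro: finite_subset\<close>)
    note [measurable] = L0_rep_measurable[OF this]
    have "AE \<omega> in P. L0_rep (Q_norm P Q x) \<omega> \<le> L0_rep (Q_norm P Q' x) \<omega>"
      by (rule L0_Q_norm_mono) (use that xp in auto)
    hence "measure P {\<omega> \<in> space P. L0_rep (Q_norm P Q' x) \<omega> < \<epsilon>'}
             \<le> measure P {\<omega> \<in> space P. L0_rep (Q_norm P Q x) \<omega> < \<epsilon>}"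
      using \<open>\<epsilon>' \<le> \<epsilon>\<close> by (intro finite_measure_mono_AE) (auto elim!: AE_mp)
    with x \<open>l' \<le> l\<close> show "x \<in> nhd_el P E Q \<epsilon> l" by (auto simp: nhd_el_def)
  qed
  have inter: "\<exists>Q \<epsilon> l. ok Q \<epsilon> l \<and> (\<forall>x. B x Q \<epsilon> l \<subseteq> B x Q1 e1 l1 \<inter> B x Q2 e2 l2)"
    if "ok Q1 e1 l1" "ok Q2 e2 l2" for Q1 Q2 e1 e2 l1 l2
  proof (intro exI conjI allI)
    show "ok (Q1 \<union> Q2) (min e1 e2) (min l1 l2)" using that by (auto simp: ok_def)
    have "nhd_el P E (Q1 \<union> Q2) (min e1 e2) (min l1 l2) \<subseteq> nhd_el P E Q1 e1 l1"
      "nhd_el P E (Q1 \<union> Q2) (min e1 e2) (min l1 l2) \<subseteq> nhd_el P E Q2 e2 l2"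
      by (rule mono; use that in \<open>auto simp: ok_def\<close>)+
    thus "B x (Q1 \<union> Q2) (min e1 e2) (min l1 l2) \<subseteq> B x Q1 e1 l1 \<inter> B x Q2 e2 l2" for x
      by (auto simp: B_def)
  qed
  have "istopology (\<lambda>G. G \<subseteq> carrier E \<and> (\<forall>x\<in>G. \<exists>Q \<epsilon> l. ok Q \<epsilon> l \<and> B x Q \<epsilon> l \<subseteq> G))"
    unfolding istopology_def
  proof (intro conjI allI impI)
    fix S T assume S: "S \<subseteq> carrier E \<and> (\<forall>x\<in>S. \<exists>Q \<epsilon> l. ok Q \<epsilon> l \<and> B x Q \<epsilon> l \<subseteq> S)"
      and T: "T \<subseteq> carrier E \<and> (\<forall>x\<in>T. \<exists>Q \<epsilon> l. ok Q \<epsilon> l \<and> B x Q \<epsilon> l \<subseteq> T)"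
    show "S \<inter> T \<subseteq> carrier E" using S by blast
    show "\<forall>x\<in>S \<inter> T. \<exists>Q \<epsilon> l. ok Q \<epsilon> l \<and> B x Q \<epsilon> l \<subseteq> S \<inter> T"
    proof
      fix x assume "x \<in> S \<inter> T"
      with S T obtain Q1 e1 l1 Q2 e2 l2
        where "ok Q1 e1 l1" "B x Q1 e1 l1 \<subseteq> S" "ok Q2 e2 l2" "B x Q2 e2 l2 \<subseteq> T" by blast
      moreover from inter[OF this(1,3)] obtain Q \<epsilon> l
        where "ok Q \<epsilon> l" "\<forall>x. B x Q \<epsilon> l \<subseteq> B x Q1 e1 l1 \<inter> B x Q2 e2 l2" by blast
      ultimately show "\<exists>Q \<epsilon> l. ok Q \<epsilon> l \<and> B x Q \<epsilon> l \<subseteq> S \<inter> T" by blast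
    qed
  next
    fix K assume K: "\<forall>S\<in>K. S \<subseteq> carrier E \<and> (\<forall>x\<in>S. \<exists>Q \<epsilon> l. ok Q \<epsilon> l \<and> B x Q \<epsilon> l \<subseteq> S)"
    show "\<Union>K \<subseteq> carrier E" using K by blast
    show "\<forall>x\<in>\<Union>K. \<exists>Q \<epsilon> l. ok Q \<epsilon> l \<and> B x Q \<epsilon> l \<subseteq> \<Union>K"
    proof
      fix x assume "x \<in> \<Union>K"
      then obtain S where S: "S \<in> K" "x \<in> S" by blast
      with K have "\<exists>Q \<epsilon> l. ok Q \<epsilon> l \<and> B x Q \<epsilon> l \<subseteq> S" by blast
      with S(1) show "\<exists>Q \<epsilon> l. ok Q \<epsilon> l \<and> B x Q \<epsilon> l \<subseteq> \<Union>K" by (meson Union_upper subset_trans)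
    qed
  qed
  from topology_inverse'[OF this] show ?thesis
    unfolding topology_el_def by (simp only: ok_def B_def conj_assoc)
qed

lemma L0_random_normed_module:
  assumes "prob_space P"
  shows "random_normed_module P
    (L0 P :: (('w \<Rightarrow> 'k::{real_normed_field, second_countable_topology}) set, ('w \<Rightarrow> 'k) set) module)
    (L0_abs P)"
proof -
  let ?R = "L0 P :: (('w \<Rightarrow> 'k) set, ('w \<Rightarrow> 'k) set) module"
  interpret po: partial_order "L0_order P" by (rule L0_partial_order)
  have sm: "x \<odot>\<^bsub>?R\<^esub> y = x \<otimes>\<^bsub>?R\<^esub> y" for x y by (simp add: L0_def)
  have z: "\<zero>\<^bsub>L0 P\<^esub> \<in> carrier (L0_order P)"
    unfolding L0_order_def by (simp add: L0_closed)
  have abs_eq: "L0_abs P x = \<zero>\<^bsub>L0 P\<^esub> \<longleftrightarrow> x = \<zero>\<^bsub>?R\<^esub>" if x: "x \<in> carrier ?R" for x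
  proof -
    note [measurable] = L0_rep_measurable[OF x]
    have "L0_abs P x = \<zero>\<^bsub>L0 P\<^esub> \<longleftrightarrow> L0_class P (\<lambda>\<omega>. norm (L0_rep x \<omega>)) = L0_class P (\<lambda>\<omega>. 0)"
      by (simp add: L0_abs_def L0_def)
    also have "\<dots> \<longleftrightarrow> (AE \<omega> in P. L0_rep x \<omega> = 0)"
      by (subst L0_class_eq_iff) auto
    also have "\<dots> \<longleftrightarrow> L0_class P (L0_rep x) = L0_class P (\<lambda>\<omega>. 0)"
      by (subst L0_class_eq_iff) auto
    also have "\<dots> \<longleftrightarrow> x = \<zero>\<^bsub>?R\<^esub>"
      by (simp add: L0_class_rep[OF x]) (simp add: L0_def)
    finally show ?thesis .
  qed
  have "L0_seminorm P ?R (L0_abs P)"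
    unfolding L0_seminorm_def
  proof (intro conjI ballI Pi_I)
    fix x y assume xy: "x \<in> carrier ?R" "y \<in> carrier ?R"
    have c: "L0_abs P x \<in> carrier (L0 P)" "L0_abs P y \<in> carrier (L0 P)" using xy by (auto simp: L0_closed)
    show "L0_abs P x \<in> L0_plus P"
      using L0_rep_ops(4)[OF xy] L0_rep_consts(1)[where 'k=real and P=P] c
      by (auto simp: L0_plus_def L0_order_def elim!: AE_mp)
    show "L0_abs P (x \<odot>\<^bsub>?R\<^esub> y) = L0_abs P x \<otimes>\<^bsub>L0 P\<^esub> L0_abs P y"
      unfolding sm
      using L0_rep_ops(4)[OF xy] L0_rep_ops(4)[OF xy(2,1)] L0_rep_ops(2)[OF xy] L0_rep_ops(2)[OF c]
        L0_rep_ops(4)[OF L0_closed(5)[OF xy] xy(1)]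
      by (intro L0_eqI[of _ P]) (auto simp: L0_closed xy c norm_mult elim!: AE_mp)
    show "L0_abs P (x \<oplus>\<^bsub>?R\<^esub> y) \<sqsubseteq>\<^bsub>L0_order P\<^esub> L0_abs P x \<oplus>\<^bsub>L0 P\<^esub> L0_abs P y"
      using L0_rep_ops(4)[OF xy] L0_rep_ops(4)[OF xy(2,1)] L0_rep_ops(1)[OF xy] L0_rep_ops(1)[OF c]
        L0_rep_ops(4)[OF L0_closed(4)[OF xy] xy(1)]
      by (auto simp: L0_order_def norm_triangle_ineq elim!: AE_mp)
  qed
  moreover have "least (L0_order P) \<zero>\<^bsub>L0 P\<^esub> (Upper (L0_order P) {p x |p. p \<in> {L0_abs P}}) \<longleftrightarrow> x = \<zero>\<^bsub>?R\<^esub>"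
    if x: "x \<in> carrier ?R" for x
  proof -
    have a: "L0_abs P x \<in> carrier (L0_order P)" using L0_closed(3)[OF x] by (simp add: L0_order_def)
    have "least (L0_order P) (L0_abs P x) (Upper (L0_order P) {L0_abs P x})"
      using a by (auto simp: least_def Upper_def)
    hence "least (L0_order P) \<zero>\<^bsub>L0 P\<^esub> (Upper (L0_order P) {L0_abs P x}) \<longleftrightarrow> L0_abs P x = \<zero>\<^bsub>L0 P\<^esub>"
      using po.least_unique by metis
    thus ?thesis using abs_eq[OF x] by simp
  qed
  ultimately show ?thesis
    using assms L0_self_module[where P=P and 'k='k]
    by (auto simp: random_normed_module_def random_locally_convex_module_def)
qed

end

theory Submission
  imports Defs
begin

text \<open>
  A linear function on a submodule is handled through its graph, a set of pairs of a vector and a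
  measurable function that is closed under the module operations and dominated by a seminorm.
  Domination forces such a graph to be single-valued almost everywhere, so by Zorn's lemma it
  suffices to adjoin one vector \<open>x\<^sub>0\<close>; its value is the essential supremum of
  \<open>f x - \<parallel>x - x\<^sub>0\<parallel>\<close>, and the resulting inequality passes from \<open>x\<^sub>0\<close> to \<open>c x\<^sub>0\<close> by treating
  \<open>c > 0\<close>, \<open>c < 0\<close> and \<open>c = 0\<close> on the respective sets. Complex scalars reduce to real ones as usual.

  Continuity for \<open>\<T>\<^sub>c\<close> means domination by a multiple of one \<open>\<parallel>\<cdot>\<parallel>\<^sub>Q\<close>, whereas continuity for
  \<open>\<T>\<^sub>\<epsilon>\<^sub>,\<^sub>\<lambda>\<close> means domination by a countable concatenation of such multiples along a measurable
  partition; both dominating functions are again seminorms.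
\<close>

section \<open>Essential suprema\<close>

text \<open>Two features of \<open>L0\<close> shape the argument. Every relation between values
  holds only off a null set that depends on the vectors and scalars involved, so uncountably many
  inequalities cannot be combined pointwise; suprema must be essential ones, each carried by a
  countable subfamily. Moreover \<open>L0\<close> has zero divisors: a nonzero multiple of
  \<open>x0\<close> may lie in the submodule although \<open>x0\<close> does not, so decompositions
  \<open>x + c x0\<close> are not unique. Graphs avoid any separate proof that an extension is well
  defined; only the estimate by the seminorm has to be checked.

  For \<open>topology_el\<close> a neighbourhood of zero controls a vector only up to an event of
  small probability. One neighbourhood therefore yields a bound off a small event only, and the
  bounds for the tolerances \<open>1 / (n + 1)\<close> are pasted together along the first index
  that applies.

  Norms are preserved because the extension is dominated by the least bound of \<open>f\<close>
  times the norm, while every bound of \<open>g\<close> is also a bound of \<open>f\<close>: both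
  functions have the same least bound.\<close>

text \<open>Among the countable subfamilies one has a union of maximal probability; adding a further
  set cannot increase it, so that set is covered up to a null set.\<close>

lemma (in prob_space) exhaustion:
  assumes "\<And>s. s \<in> S \<Longrightarrow> A s \<in> events"
  shows "\<exists>C. countable C \<and> C \<subseteq> S \<and> (\<forall>s\<in>S. AE \<omega> in M. \<omega> \<in> A s \<longrightarrow> (\<exists>t\<in>C. \<omega> \<in> A t))"
proof -
  define v where "v C = prob (\<Union>t\<in>C. A t)" for C
  define I where "I = (SUP C\<in>{C. countable C \<and> C \<subseteq> S}. v C)"
  have bdd: "bdd_above (v ` {C. countable C \<and> C \<subseteq> S})"
    by (auto simp: v_def intro!: bdd_aboveI[of _ 1])
  have vI: "v C \<le> I" if "countable C" "C \<subseteq> S" for C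
    unfolding I_def using that bdd by (intro cSUP_upper) auto
  have ev: "(\<Union>t\<in>C. A t) \<in> events" if "countable C" "C \<subseteq> S" for C
    using that assms by (intro sets.countable_UN') auto
  have "\<exists>C. countable C \<and> C \<subseteq> S \<and> I - 1 / Suc n < v C" for n
  proof -
    have "I - 1 / Suc n < (SUP C\<in>{C. countable C \<and> C \<subseteq> S}. v C)" by (simp add: I_def)
    then show ?thesis
      by (subst (asm) less_cSUP_iff) (auto simp: bdd intro: exI[of _ "{}"])
  qed
  then obtain D where D: "\<And>n. countable (D n)" "\<And>n. D n \<subseteq> S" "\<And>n. I - 1 / Suc n < v (D n)" by metis
  \<comment> \<open>The supremum \<open>I\<close> is attained: the union of countably many nearly
    optimal families is again countable.\<close>
  define C where "C = (\<Union>n. D n)"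
  have C: "countable C" "C \<subseteq> S" using D by (auto simp: C_def)
  have "I - 1 / Suc n \<le> v C" for n
  proof -
    have "v (D n) \<le> v C"
      unfolding v_def by (rule finite_measure_mono) (use ev[OF C] in \<open>auto simp: C_def\<close>)
    with D(3)[of n] show ?thesis by simp
  qed
  moreover have "(\<lambda>n. I - 1 / Suc n) \<longlonglongrightarrow> I - 0"
    by (intro tendsto_intros LIMSEQ_Suc lim_1_over_n)
  ultimately have "I \<le> v C" by (intro LIMSEQ_le_const2[of "\<lambda>n. I - 1 / Suc n" I]) auto
  have "AE \<omega> in M. \<omega> \<in> A s \<longrightarrow> (\<exists>t\<in>C. \<omega> \<in> A t)" if s: "s \<in> S" for s
  proof -
    \<comment> \<open>Maximality of \<open>v C\<close> leaves no room for \<open>A s\<close> outside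
      the union.\<close>
    have "v (insert s C) \<le> v C" using vI[of "insert s C"] C s \<open>I \<le> v C\<close> by simp
    moreover have "v (insert s C) = prob (A s - (\<Union>t\<in>C. A t)) + v C"
      using ev[OF C] assms[OF s] unfolding v_def
      by (subst finite_measure_Union[symmetric]) (auto intro!: arg_cong[where f=prob])
    ultimately have "prob (A s - (\<Union>t\<in>C. A t)) = 0"
      using measure_nonneg[of M "A s - (\<Union>t\<in>C. A t)"] by linarith
    then have "A s - (\<Union>t\<in>C. A t) \<in> null_sets M"
      using ev[OF C] assms[OF s] by (auto simp: null_sets_def emeasure_eq_measure)
    from AE_not_in[OF this] show ?thesis by eventually_elim auto
  qed
  with C show ?thesis by blast
qed

text \<open>For each rational \<open>q\<close> the superlevel sets \<open>{s > q}\<close> are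
  exhausted by countably many members of \<open>S\<close>. The pointwise supremum over all members
  so selected dominates every \<open>s\<close>, since a violation would be witnessed by a rational
  strictly in between.\<close>

lemma (in prob_space) ess_sup:
  fixes S :: "('a \<Rightarrow> real) set"
  assumes meas: "\<And>s. s \<in> S \<Longrightarrow> s \<in> borel_measurable M" and b: "b \<in> borel_measurable M"
    and "S \<noteq> {}" and le: "\<And>s. s \<in> S \<Longrightarrow> AE \<omega> in M. s \<omega> \<le> b \<omega>"
  shows "\<exists>z\<in>borel_measurable M. (\<forall>s\<in>S. AE \<omega> in M. s \<omega> \<le> z \<omega>) \<and>
    (\<forall>u :: 'a \<Rightarrow> real. (\<forall>s\<in>S. AE \<omega> in M. s \<omega> \<le> u \<omega>) \<longrightarrow> (AE \<omega> in M. z \<omega> \<le> u \<omega>))"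
proof -
  define above where "above q s = {\<omega>\<in>space M. s \<omega> > real_of_rat q}" for q :: rat and s :: "'a \<Rightarrow> real"
  define covers where "covers q C \<longleftrightarrow> countable C \<and> C \<subseteq> S \<and>
      (\<forall>s\<in>S. AE \<omega> in M. \<omega> \<in> above q s \<longrightarrow> (\<exists>t\<in>C. \<omega> \<in> above q t))" for q C
  have "\<exists>C. covers q C" for q
    unfolding covers_def
  proof (rule exhaustion)
    fix s assume "s \<in> S"
    note [measurable] = meas[OF this]
    show "above q s \<in> events" unfolding above_def by measurable
  qed
  then obtain D where cov: "\<And>q. covers q (D q)" by metis
  then have D: "\<And>q. countable (D q)" "\<And>q. D q \<subseteq> S"
    "\<And>q s. s \<in> S \<Longrightarrow> AE \<omega> in M. \<omega> \<in> above q s \<longrightarrow> (\<exists>t\<in>D q. \<omega> \<in> above q t)"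
    by (auto simp: covers_def)
  obtain s0 where s0: "s0 \<in> S" using \<open>S \<noteq> {}\<close> by blast
  \<comment> \<open>\<open>s0\<close> keeps the family nonempty even if every \<open>D q\<close> is
    empty, as the conditional supremum requires.\<close>
  define C where "C = insert s0 (\<Union>q. D q)"
  have C: "countable C" "C \<subseteq> S" "C \<noteq> {}" using D s0 by (auto simp: C_def)
  \<comment> \<open>Truncation at \<open>b\<close> makes the supremum finite at every point, hence
    real-valued and measurable; it changes members of \<open>C\<close> only on a null set.\<close>
  define z where "z \<omega> = (SUP t\<in>C. min (t \<omega>) (b \<omega>))" for \<omega>
  have bdd: "bdd_above ((\<lambda>t. min (t \<omega>) (b \<omega>)) ` C)" for \<omega> by (auto intro!: bdd_aboveI[of _ "b \<omega>"])
  have zm: "z \<in> borel_measurable M"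
    unfolding z_def using C(1) bdd b meas C(2) by (intro borel_measurable_cSUP borel_measurable_min) auto
  have Cb: "AE \<omega> in M. \<forall>t\<in>C. t \<omega> \<le> b \<omega>"
    using C le by (intro AE_ball_countable[THEN iffD2]) auto
  have "AE \<omega> in M. s \<omega> \<le> z \<omega>" if s: "s \<in> S" for s
  proof -
    have "AE \<omega> in M. \<forall>q. \<omega> \<in> above q s \<longrightarrow> (\<exists>t\<in>D q. \<omega> \<in> above q t)"
      using D(3)[OF s] by (intro AE_all_countable[THEN iffD2]) auto
    with Cb AE_space show ?thesis
    proof eventually_elim
      case (elim \<omega>)
      show ?case
      proof (rule ccontr)
        assume "\<not> s \<omega> \<le> z \<omega>"
        then obtain q where q: "z \<omega> < real_of_rat q" "real_of_rat q < s \<omega>"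
          using of_rat_dense[of "z \<omega>" "s \<omega>"] by auto
        then obtain t where t: "t \<in> D q" "t \<omega> > real_of_rat q"
          using elim by (auto simp: above_def)
        then have "t \<in> C" by (auto simp: C_def)
        then have "min (t \<omega>) (b \<omega>) \<le> z \<omega>" unfolding z_def by (intro cSUP_upper bdd)
        with elim \<open>t \<in> C\<close> have "t \<omega> \<le> z \<omega>" by (simp add: min_def)
        with t q show False by simp
      qed
    qed
  qed
  moreover have "AE \<omega> in M. z \<omega> \<le> u \<omega>" if u: "\<forall>s\<in>S. AE \<omega> in M. s \<omega> \<le> u \<omega>" for u
  proof -
    have "AE \<omega> in M. \<forall>t\<in>C. t \<omega> \<le> u \<omega>"
      using C u by (intro AE_ball_countable[THEN iffD2]) auto
    then show ?thesis
      by eventually_elim (auto simp: z_def C intro!: cSUP_least min.coboundedI1)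
  qed
  ultimately show ?thesis using zm by blast
qed

section \<open>The Hahn-Banach theorem for dominated graphs\<close>

lemma L0_class_ops:
  fixes f g :: "'w \<Rightarrow> 'k::{real_normed_field, second_countable_topology}"
  assumes [measurable]: "f \<in> borel_measurable P" "g \<in> borel_measurable P"
  shows "L0_class P f \<oplus>\<^bsub>L0 P\<^esub> L0_class P g = L0_class P (\<lambda>\<omega>. f \<omega> + g \<omega>)"
    and "L0_class P f \<otimes>\<^bsub>L0 P\<^esub> L0_class P g = L0_class P (\<lambda>\<omega>. f \<omega> * g \<omega>)"
proof -
  note [measurable] = L0_rep_class(1)[OF assms(1)] L0_rep_class(1)[OF assms(2)]
  show "L0_class P f \<oplus>\<^bsub>L0 P\<^esub> L0_class P g = L0_class P (\<lambda>\<omega>. f \<omega> + g \<omega>)"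
    unfolding L0_def ring.simps
    by (subst L0_class_eq_iff) (use assms[THEN L0_rep_class(2)] in auto)
  show "L0_class P f \<otimes>\<^bsub>L0 P\<^esub> L0_class P g = L0_class P (\<lambda>\<omega>. f \<omega> * g \<omega>)"
    unfolding L0_def monoid.simps
    by (subst L0_class_eq_iff) (use assms[THEN L0_rep_class(2)] in auto)
qed

lemma L0_one_class: "\<one>\<^bsub>L0 P\<^esub> = L0_class P (\<lambda>_. 1)"
  and L0_zero_class: "\<zero>\<^bsub>L0 P\<^esub> = L0_class P (\<lambda>_. 0)"
  by (simp_all add: L0_def)

locale L0_module = prob_space P + module "L0 P" E
  for P :: "'w measure"
    and E :: "(('w \<Rightarrow> 'k::{real_normed_field, second_countable_topology}) set, 'a) module" (structure)
begin

text \<open>With functions in place of classes as scalars, scalar identities become equalities of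
  functions, and scalars defined by cases on an event can be written directly.\<close>

definition sc :: "('w \<Rightarrow> 'k) \<Rightarrow> 'a \<Rightarrow> 'a" where
  "sc c x = L0_class P c \<odot> x"

abbreviation rsc :: "('w \<Rightarrow> real) \<Rightarrow> 'a \<Rightarrow> 'a" where
  "rsc c \<equiv> sc (\<lambda>\<omega>. of_real (c \<omega>))"

lemma sc_closed [simp, intro]: "c \<in> borel_measurable P \<Longrightarrow> x \<in> carrier E \<Longrightarrow> sc c x \<in> carrier E"
  by (simp add: sc_def)

lemma sc_sc:
  assumes "c \<in> borel_measurable P" "d \<in> borel_measurable P" "x \<in> carrier E"
  shows "sc c (sc d x) = sc (\<lambda>\<omega>. c \<omega> * d \<omega>) x"
  using assms by (simp add: sc_def smult_assoc1[symmetric] L0_class_ops)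

lemma sc_add_left:
  assumes "c \<in> borel_measurable P" "d \<in> borel_measurable P" "x \<in> carrier E"
  shows "sc (\<lambda>\<omega>. c \<omega> + d \<omega>) x = sc c x \<oplus> sc d x"
  using assms by (simp add: sc_def smult_l_distr[symmetric] L0_class_ops)

lemma sc_add_right:
  assumes "c \<in> borel_measurable P" "x \<in> carrier E" "y \<in> carrier E"
  shows "sc c (x \<oplus> y) = sc c x \<oplus> sc c y"
  using assms by (simp add: sc_def smult_r_distr)

lemma sc_one [simp]: "x \<in> carrier E \<Longrightarrow> sc (\<lambda>_. 1) x = x"
  by (simp add: sc_def L0_one_class[symmetric])

lemma sc_zero [simp]: "x \<in> carrier E \<Longrightarrow> sc (\<lambda>_. 0) x = \<zero>"
  by (simp add: sc_def L0_zero_class[symmetric])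

lemma sc_minus:
  assumes "c \<in> borel_measurable P" "x \<in> carrier E"
  shows "sc c x \<oplus> sc (\<lambda>\<omega>. - c \<omega>) x = \<zero>"
  using sc_add_left[of c "\<lambda>\<omega>. - c \<omega>" x] assms by simp

text \<open>Function-valued counterpart of an \<open>L0\<close>-seminorm, with exceptional null sets
  that may depend on vectors and scalars. Values that are functions allow pointwise constructions
  such as choosing a different seminorm at each \<omega>.\<close>

definition ae_seminorm :: "('a \<Rightarrow> 'w \<Rightarrow> real) \<Rightarrow> bool" where
  "ae_seminorm N \<longleftrightarrow>
     (\<forall>x\<in>carrier E. N x \<in> borel_measurable P \<and> (AE \<omega> in P. 0 \<le> N x \<omega>)) \<and>
     (\<forall>c\<in>borel_measurable P. \<forall>x\<in>carrier E. AE \<omega> in P. N (sc c x) \<omega> = norm (c \<omega>) * N x \<omega>) \<and>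
     (\<forall>x\<in>carrier E. \<forall>y\<in>carrier E. AE \<omega> in P. N (x \<oplus> y) \<omega> \<le> N x \<omega> + N y \<omega>)"

lemma ae_seminormD:
  assumes "ae_seminorm N" "x \<in> carrier E"
  shows "N x \<in> borel_measurable P" "AE \<omega> in P. 0 \<le> N x \<omega>"
    "c \<in> borel_measurable P \<Longrightarrow> AE \<omega> in P. N (sc c x) \<omega> = norm (c \<omega>) * N x \<omega>"
    "y \<in> carrier E \<Longrightarrow> AE \<omega> in P. N (x \<oplus> y) \<omega> \<le> N x \<omega> + N y \<omega>"
  using assms by (auto simp: ae_seminorm_def)

section \<open>Dominated graphs and their extension by one vector\<close>

lemma ae_seminorm_zero:
  assumes "ae_seminorm N"
  shows "AE \<omega> in P. N \<zero> \<omega> = 0"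
  using ae_seminormD(3)[OF assms, of \<zero> "\<lambda>_. 0"] by simp

text \<open>Values and scalars are real also over the complex field, where the graph is that of a
  real part.\<close>

definition dominated :: "('a \<Rightarrow> 'w \<Rightarrow> real) \<Rightarrow> ('a \<times> ('w \<Rightarrow> real)) set \<Rightarrow> bool" where
  "dominated N G \<longleftrightarrow>
     (\<forall>x h. (x, h) \<in> G \<longrightarrow> x \<in> carrier E \<and> h \<in> borel_measurable P \<and> (AE \<omega> in P. h \<omega> \<le> N x \<omega>)) \<and>
     (\<forall>x h y k. (x, h) \<in> G \<longrightarrow> (y, k) \<in> G \<longrightarrow> (x \<oplus> y, \<lambda>\<omega>. h \<omega> + k \<omega>) \<in> G) \<and>
     (\<forall>c x h. c \<in> borel_measurable P \<longrightarrow> (x, h) \<in> G \<longrightarrow> (rsc c x, \<lambda>\<omega>. c \<omega> * h \<omega>) \<in> G)"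

lemma dominatedD:
  assumes "dominated N G" "(x, h) \<in> G"
  shows "x \<in> carrier E" "h \<in> borel_measurable P" "AE \<omega> in P. h \<omega> \<le> N x \<omega>"
    "(y, k) \<in> G \<Longrightarrow> (x \<oplus> y, \<lambda>\<omega>. h \<omega> + k \<omega>) \<in> G"
    "c \<in> borel_measurable P \<Longrightarrow> (rsc c x, \<lambda>\<omega>. c \<omega> * h \<omega>) \<in> G"
  using assms unfolding dominated_def by blast+

text \<open>Subtracting two pairs over one vector puts \<open>h - k\<close> over the null vector,
  where the seminorm vanishes; exchanging the pairs gives the reverse inequality.\<close>

lemma dominated_unique:
  assumes N: "ae_seminorm N" and G: "dominated N G" and h: "(x, h) \<in> G" and k: "(x, k) \<in> G"
  shows "AE \<omega> in P. h \<omega> = k \<omega>"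
proof -
  have *: "AE \<omega> in P. h \<omega> \<le> k \<omega>" if "(x, h) \<in> G" "(x, k) \<in> G" for h k
  proof -
    note x = dominatedD(1)[OF G that(1)]
    have "(rsc (\<lambda>_. - 1) x, \<lambda>\<omega>. - 1 * k \<omega>) \<in> G" by (rule dominatedD(5)[OF G that(2)]) simp
    from dominatedD(4)[OF G that(1) this]
    have "(x \<oplus> sc (\<lambda>_. - 1) x, \<lambda>\<omega>. h \<omega> - k \<omega>) \<in> G" by simp
    also have "x \<oplus> sc (\<lambda>_. - 1) x = \<zero>" using sc_minus[of "\<lambda>_. 1" x] x by simp
    finally have "AE \<omega> in P. h \<omega> - k \<omega> \<le> N \<zero> \<omega>" by (rule dominatedD(3)[OF G])
    with ae_seminorm_zero[OF N] show ?thesis by eventually_elim simp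
  qed
  from *[OF h k] *[OF k h] show ?thesis by eventually_elim simp
qed

lemma rsc_indicator_absorb:
  assumes [measurable]: "c \<in> borel_measurable P" and x: "x \<in> carrier E"
  shows "rsc (\<lambda>\<omega>. if c \<omega> > 0 then c \<omega> else 0) x = rsc (\<lambda>\<omega>. if c \<omega> > 0 then 1 else 0) (rsc c x)"
proof -
  have "(\<lambda>\<omega>. of_real (if c \<omega> > 0 then 1 else 0) * of_real (c \<omega>) :: 'k) =
     (\<lambda>\<omega>. of_real (if c \<omega> > 0 then c \<omega> else 0))" by auto
  then show ?thesis using x by (subst sc_sc) auto
qed

text \<open>
  The inequality at \<open>rsc c x0\<close> on the set where \<open>c > 0\<close> is the one at \<open>x0\<close>, rescaled: the graph
  is closed under division by \<open>c\<close> on that set.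
\<close>

lemma dominated_step_pos:
  assumes N: "ae_seminorm N" and G: "dominated N G" and x0: "x0 \<in> carrier E"
    and le: "\<And>x h. (x, h) \<in> G \<Longrightarrow> AE \<omega> in P. h \<omega> + z \<omega> \<le> N (x \<oplus> x0) \<omega>"
    and xh: "(x, h) \<in> G" and c[measurable]: "c \<in> borel_measurable P"
  shows "AE \<omega> in P. c \<omega> > 0 \<longrightarrow> h \<omega> + c \<omega> * z \<omega> \<le> N (x \<oplus> rsc c x0) \<omega>"
proof -
  let ?A = "\<lambda>\<omega>. if c \<omega> > 0 then 1 else 0 :: real"
  let ?c = "\<lambda>\<omega>. if c \<omega> > 0 then c \<omega> else 0 :: real"
  \<comment> \<open>A scalar of \<open>L0\<close> need not be invertible; this is its inverse
    localised to the event \<open>c > 0\<close>.\<close>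
  let ?d = "\<lambda>\<omega>. if c \<omega> > 0 then 1 / c \<omega> else 0 :: real"
  note x = dominatedD(1)[OF G xh]
  have "(rsc ?d x, \<lambda>\<omega>. ?d \<omega> * h \<omega>) \<in> G" by (rule dominatedD(5)[OF G xh]) measurable
  from le[OF this] have 1: "AE \<omega> in P. ?d \<omega> * h \<omega> + z \<omega> \<le> N (rsc ?d x \<oplus> x0) \<omega>" .
  have [measurable]: "(\<lambda>\<omega>. of_real (?c \<omega>) :: 'k) \<in> borel_measurable P"
    "(\<lambda>\<omega>. of_real (?d \<omega>) :: 'k) \<in> borel_measurable P" "(\<lambda>\<omega>. of_real (?A \<omega>) :: 'k) \<in> borel_measurable P"
    by measurable
  have "(\<lambda>\<omega>. of_real (?c \<omega>) * of_real (?d \<omega>) :: 'k) = (\<lambda>\<omega>. of_real (?A \<omega>))" by auto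
  then have "rsc ?c (rsc ?d x) = rsc ?A x" using x by (subst sc_sc) auto
  \<comment> \<open>Since \<open>?c * ?d\<close> is the indicator \<open>?A\<close>, scaling the
    vector at which \<open>1\<close> bounds the value yields the desired vector on the event.
    Homogeneity of \<open>N\<close> then transfers the estimate.\<close>
  then have eq: "rsc ?c (rsc ?d x \<oplus> x0) = rsc ?A (x \<oplus> rsc c x0)"
    using x x0 rsc_indicator_absorb[OF c x0] by (simp add: sc_add_right)
  have "AE \<omega> in P. N (rsc ?c (rsc ?d x \<oplus> x0)) \<omega> = norm (of_real (?c \<omega>) :: 'k) * N (rsc ?d x \<oplus> x0) \<omega>"
    by (rule ae_seminormD(3)[OF N]) (use x x0 in auto)
  moreover have "AE \<omega> in P. N (rsc ?A (x \<oplus> rsc c x0)) \<omega> = norm (of_real (?A \<omega>) :: 'k) * N (x \<oplus> rsc c x0) \<omega>"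
    by (rule ae_seminormD(3)[OF N]) (use x x0 in auto)
  ultimately show ?thesis using 1
  proof eventually_elim
    case (elim \<omega>)
    show ?case
    proof
      assume c0: "c \<omega> > 0"
      with elim eq have "c \<omega> * N (rsc ?d x \<oplus> x0) \<omega> = N (x \<oplus> rsc c x0) \<omega>" by simp
      moreover have "c \<omega> * (?d \<omega> * h \<omega> + z \<omega>) \<le> c \<omega> * N (rsc ?d x \<oplus> x0) \<omega>"
        using elim c0 by (intro mult_left_mono) auto
      ultimately show "h \<omega> + c \<omega> * z \<omega> \<le> N (x \<oplus> rsc c x0) \<omega>"
        using c0 by (simp add: distrib_left)
    qed
  qed
qed

text \<open>The indicator of the event \<open>c = 0\<close> annihilates \<open>rsc c x0\<close>, so
  there the seminorms of \<open>x + c x0\<close> and of \<open>x\<close> agree. This event may have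
  any probability, so it cannot be dismissed as the trivial scalar.\<close>

lemma dominated_step_zero:
  assumes N: "ae_seminorm N" and G: "dominated N G" and x0: "x0 \<in> carrier E"
    and xh: "(x, h) \<in> G" and c[measurable]: "c \<in> borel_measurable P"
  shows "AE \<omega> in P. c \<omega> = 0 \<longrightarrow> h \<omega> \<le> N (x \<oplus> rsc c x0) \<omega>"
proof -
  let ?A = "\<lambda>\<omega>. if c \<omega> = 0 then 1 else 0 :: real"
  note x = dominatedD(1)[OF G xh]
  have [measurable]: "(\<lambda>\<omega>. of_real (?A \<omega>) :: 'k) \<in> borel_measurable P" by measurable
  have "(rsc ?A x, \<lambda>\<omega>. ?A \<omega> * h \<omega>) \<in> G" by (rule dominatedD(5)[OF G xh]) measurable
  from dominatedD(3)[OF G this] have 1: "AE \<omega> in P. ?A \<omega> * h \<omega> \<le> N (rsc ?A x) \<omega>" .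
  have "(\<lambda>\<omega>. of_real (?A \<omega>) * of_real (c \<omega>) :: 'k) = (\<lambda>\<omega>. 0)" by auto
  then have "rsc ?A (rsc c x0) = \<zero>" using x0 by (subst sc_sc) auto
  then have eq: "rsc ?A (x \<oplus> rsc c x0) = rsc ?A x" using x x0 by (simp add: sc_add_right)
  have "AE \<omega> in P. N (rsc ?A (x \<oplus> rsc c x0)) \<omega> = norm (of_real (?A \<omega>) :: 'k) * N (x \<oplus> rsc c x0) \<omega>"
    by (rule ae_seminormD(3)[OF N]) (use x x0 in auto)
  with 1 show ?thesis unfolding eq by eventually_elim auto
qed

lemma dominated_step:
  assumes N: "ae_seminorm N" and G: "dominated N G" and "G \<noteq> {}" and x0: "x0 \<in> carrier E"
  shows "\<exists>G'. G \<subseteq> G' \<and> dominated N G' \<and> x0 \<in> fst ` G'"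
proof -
  obtain x1 h1 where xh1: "(x1, h1) \<in> G" using \<open>G \<noteq> {}\<close> by auto
  note x1 = dominatedD(1)[OF G xh1]
  define y0 where "y0 = sc (\<lambda>_. - 1) x0"
  have y0: "y0 \<in> carrier E" using x0 by (simp add: y0_def)
  have xy0: "x0 \<oplus> y0 = \<zero>" using sc_minus[of "\<lambda>_. 1" x0] x0 by (simp add: y0_def)
  note meas = ae_seminormD(1)[OF N]
  let ?S = "(\<lambda>(x, h) \<omega>. h \<omega> - N (x \<oplus> y0) \<omega>) ` G"
  \<comment> \<open>As in the classical proof, \<open>x + x'\<close> is split as
    \<open>(x - x0) + (x' + x0)\<close>, so that every lower candidate for the value at
    \<open>x0\<close> lies below every upper candidate.\<close>
  have cross: "AE \<omega> in P. h \<omega> - N (x \<oplus> y0) \<omega> \<le> N (x' \<oplus> x0) \<omega> - h' \<omega>"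
    if "(x, h) \<in> G" "(x', h') \<in> G" for x h x' h'
  proof -
    note x = dominatedD(1)[OF G that(1)] and x' = dominatedD(1)[OF G that(2)]
    have "(x \<oplus> y0) \<oplus> (x' \<oplus> x0) = (x \<oplus> x') \<oplus> (x0 \<oplus> y0)"
      using x x' x0 y0 by (simp add: M.a_ac)
    then have eq: "(x \<oplus> y0) \<oplus> (x' \<oplus> x0) = x \<oplus> x'" using x x' xy0 by simp
    have "AE \<omega> in P. h \<omega> + h' \<omega> \<le> N (x \<oplus> x') \<omega>"
      by (rule dominatedD(3)[OF G dominatedD(4)[OF G that]])
    moreover have "AE \<omega> in P. N ((x \<oplus> y0) \<oplus> (x' \<oplus> x0)) \<omega> \<le> N (x \<oplus> y0) \<omega> + N (x' \<oplus> x0) \<omega>"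
      using x x' x0 y0 by (intro ae_seminormD(4)[OF N]) auto
    ultimately show ?thesis unfolding eq by eventually_elim simp
  qed
  have "\<exists>z\<in>borel_measurable P. (\<forall>s\<in>?S. AE \<omega> in P. s \<omega> \<le> z \<omega>) \<and>
    (\<forall>u :: 'w \<Rightarrow> real. (\<forall>s\<in>?S. AE \<omega> in P. s \<omega> \<le> u \<omega>) \<longrightarrow> (AE \<omega> in P. z \<omega> \<le> u \<omega>))"
  proof (rule ess_sup)
    \<comment> \<open>The upper candidate of any single pair serves as the common bound
      \<open>b\<close> of \<open>ess_sup\<close>.\<close>
    show "(\<lambda>\<omega>. N (x1 \<oplus> x0) \<omega> - h1 \<omega>) \<in> borel_measurable P"
      using meas[of "x1 \<oplus> x0"] dominatedD(1,2)[OF G xh1] x0 by auto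
    show "s \<in> borel_measurable P" if s: "s \<in> ?S" for s
      using s meas dominatedD(1,2)[OF G] y0 by (auto intro!: borel_measurable_diff)
  qed (use \<open>G \<noteq> {}\<close> cross xh1 in auto)
  then obtain z where z[measurable]: "z \<in> borel_measurable P"
    and zS: "\<forall>s\<in>?S. AE \<omega> in P. s \<omega> \<le> z \<omega>"
    and zg: "\<forall>u :: 'w \<Rightarrow> real. (\<forall>s\<in>?S. AE \<omega> in P. s \<omega> \<le> u \<omega>) \<longrightarrow> (AE \<omega> in P. z \<omega> \<le> u \<omega>)"
    by (elim bexE conjE)
  have zl: "AE \<omega> in P. h \<omega> - N (x \<oplus> y0) \<omega> \<le> z \<omega>" if "(x, h) \<in> G" for x h
    using bspec[OF zS imageI[OF that]] by simp
  have zu: "AE \<omega> in P. h \<omega> + z \<omega> \<le> N (x \<oplus> x0) \<omega>" if "(x, h) \<in> G" for x h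
  proof -
    \<comment> \<open>By \<open>cross\<close> each upper candidate bounds all of \<open>?S\<close>,
      and \<open>z\<close> is the least such bound.\<close>
    have "AE \<omega> in P. z \<omega> \<le> N (x \<oplus> x0) \<omega> - h \<omega>"
      by (rule zg[rule_format]) (use cross that in auto)
    then show ?thesis by eventually_elim simp
  qed
  have zl': "AE \<omega> in P. h \<omega> + (- z \<omega>) \<le> N (x \<oplus> y0) \<omega>" if "(x, h) \<in> G" for x h
    using zl[OF that] by eventually_elim simp
  define G' where "G' = {(x \<oplus> rsc c x0, \<lambda>\<omega>. h \<omega> + c \<omega> * z \<omega>) |x h c. (x, h) \<in> G \<and> c \<in> borel_measurable P}"
  have G'I: "(x, h) \<in> G \<Longrightarrow> c \<in> borel_measurable P \<Longrightarrow> y = x \<oplus> rsc c x0 \<Longrightarrow>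
      k = (\<lambda>\<omega>. h \<omega> + c \<omega> * z \<omega>) \<Longrightarrow> (y, k) \<in> G'" for x h c y k
    unfolding G'_def by blast
  have sub: "G \<subseteq> G'"
  proof (rule subrelI)
    fix x h assume "(x, h) \<in> G"
    then show "(x, h) \<in> G'"
      using dominatedD(1)[OF G, of x h] x0 by (intro G'I[of x h "\<lambda>_. 0"]) auto
  qed
  have "(\<zero>, \<lambda>_. 0) \<in> G"
    using dominatedD(5)[OF G xh1, of "\<lambda>_. 0"] x1 by simp
  then have "x0 \<in> fst ` G'"
    using x0 by (intro image_eqI[of _ _ "(x0, \<lambda>\<omega>. z \<omega>)"] G'I[of \<zero> "\<lambda>_. 0" "\<lambda>_. 1"]) auto
  moreover have "dominated N G'"
    unfolding dominated_def
  proof (intro conjI allI impI)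
    fix y k assume "(y, k) \<in> G'"
    then obtain x h c where y: "y = x \<oplus> rsc c x0" "k = (\<lambda>\<omega>. h \<omega> + c \<omega> * z \<omega>)" "(x, h) \<in> G"
      and c[measurable]: "c \<in> borel_measurable P" by (auto simp: G'_def)
    note [measurable] = dominatedD(2)[OF G y(3)]
    show "k \<in> borel_measurable P" unfolding y by measurable
    show "y \<in> carrier E" using y x0 dominatedD(1)[OF G y(3)] by simp
    \<comment> \<open>The event \<open>c < 0\<close> is the positive case for \<open>y0\<close>,
      \<open>- c\<close> and \<open>- z\<close> in place of \<open>x0\<close>, \<open>c\<close> and
      \<open>z\<close>.\<close>
    have "(\<lambda>\<omega>. of_real (- c \<omega>) * - 1 :: 'k) = (\<lambda>\<omega>. of_real (c \<omega>))" by auto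
    then have eq: "rsc (\<lambda>\<omega>. - c \<omega>) y0 = rsc c x0" unfolding y0_def using x0 by (subst sc_sc) auto
    have mc: "(\<lambda>\<omega>. - c \<omega>) \<in> borel_measurable P" by measurable
    have "AE \<omega> in P. c \<omega> > 0 \<longrightarrow> h \<omega> + c \<omega> * z \<omega> \<le> N (x \<oplus> rsc c x0) \<omega>"
      by (rule dominated_step_pos[OF N G x0 _ y(3) c]) (rule zu)
    moreover have "AE \<omega> in P. - c \<omega> > 0 \<longrightarrow> h \<omega> + - c \<omega> * - z \<omega> \<le> N (x \<oplus> rsc (\<lambda>\<omega>. - c \<omega>) y0) \<omega>"
      by (rule dominated_step_pos[OF N G y0 _ y(3) mc]) (rule zl')
    moreover note dominated_step_zero[OF N G x0 y(3) c]
    ultimately show "AE \<omega> in P. k \<omega> \<le> N y \<omega>"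
      unfolding y eq
    proof eventually_elim
      case (elim \<omega>)
      then show ?case by (cases "c \<omega>" "0::real" rule: linorder_cases) auto
    qed
  next
    fix y k y' k' assume "(y, k) \<in> G'" "(y', k') \<in> G'"
    then obtain x h c x' h' c' where y: "y = x \<oplus> rsc c x0" "k = (\<lambda>\<omega>. h \<omega> + c \<omega> * z \<omega>)" "(x, h) \<in> G"
      "y' = x' \<oplus> rsc c' x0" "k' = (\<lambda>\<omega>. h' \<omega> + c' \<omega> * z \<omega>)" "(x', h') \<in> G"
      and c[measurable]: "c \<in> borel_measurable P" "c' \<in> borel_measurable P" by (auto simp: G'_def)
    have "rsc (\<lambda>\<omega>. c \<omega> + c' \<omega>) x0 = rsc c x0 \<oplus> rsc c' x0"
      using x0 by (simp add: sc_add_left)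
    then show "(y \<oplus> y', \<lambda>\<omega>. k \<omega> + k' \<omega>) \<in> G'"
      using dominatedD(1)[OF G y(3)] dominatedD(1)[OF G y(6)] x0 y
      by (intro G'I[OF dominatedD(4)[OF G y(3,6)], of "\<lambda>\<omega>. c \<omega> + c' \<omega>"])
        (auto simp: M.a_ac algebra_simps)
  next
    fix d :: "'w \<Rightarrow> real" and y k assume d[measurable]: "d \<in> borel_measurable P" and "(y, k) \<in> G'"
    then obtain x h c where y: "y = x \<oplus> rsc c x0" "k = (\<lambda>\<omega>. h \<omega> + c \<omega> * z \<omega>)" "(x, h) \<in> G"
      and c[measurable]: "c \<in> borel_measurable P" by (auto simp: G'_def)
    show "(rsc d y, \<lambda>\<omega>. d \<omega> * k \<omega>) \<in> G'"
      using dominatedD(1)[OF G y(3)] x0 y(1,2)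
      by (intro G'I[OF dominatedD(5)[OF G y(3) d], of "\<lambda>\<omega>. d \<omega> * c \<omega>"])
        (auto simp: sc_add_right sc_sc algebra_simps)
  qed
  ultimately show ?thesis using sub by blast
qed

lemma dominated_extension:
  assumes N: "ae_seminorm N" and G: "dominated N G" and ne: "G \<noteq> {}"
  shows "\<exists>G'. G \<subseteq> G' \<and> dominated N G' \<and> fst ` G' = carrier E"
proof -
  let ?A = "{G'. G \<subseteq> G' \<and> dominated N G'}"
  have "\<exists>H\<in>?A. \<forall>X\<in>?A. H \<subseteq> X \<longrightarrow> X = H"
  proof (rule subset_Zorn_nonempty)
    show "?A \<noteq> {}" using G by blast
    fix \<C> assume \<C>: "\<C> \<noteq> {}" "subset.chain ?A \<C>"
    have dom: "dominated N H" if "H \<in> \<C>" for H using \<C> that by (auto simp: subset.chain_def)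
    \<comment> \<open>Each condition involves at most two pairs, and these lie in a common member of
      the chain.\<close>
    have "dominated N (\<Union>\<C>)"
      unfolding dominated_def
    proof (intro conjI allI impI)
      fix x h y k assume "(x, h) \<in> \<Union>\<C>" "(y, k) \<in> \<Union>\<C>"
      then obtain H where "H \<in> \<C>" "(x, h) \<in> H" "(y, k) \<in> H"
        using \<C>(2) by (fastforce simp: subset_chain_def)
      then show "(x \<oplus> y, \<lambda>\<omega>. h \<omega> + k \<omega>) \<in> \<Union>\<C>" using dominatedD(4)[OF dom] by blast
    qed (use dominatedD[OF dom] in blast)+
    moreover have "G \<subseteq> \<Union>\<C>" using \<C> by (fastforce simp: subset.chain_def)
    ultimately show "\<Union>\<C> \<in> ?A" by blast
  qed
  then obtain H where H: "H \<in> ?A" and max: "\<forall>X\<in>?A. H \<subseteq> X \<longrightarrow> X = H" by (elim bexE)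
  then have H: "G \<subseteq> H" "dominated N H" by simp_all
  have "x \<in> fst ` H" if x: "x \<in> carrier E" for x
  proof -
    have "H \<noteq> {}" using ne H(1) by blast
    from dominated_step[OF N H(2) this x]
    obtain X where X: "H \<subseteq> X" "dominated N X" "x \<in> fst ` X" by blast
    from X H(1) have "X \<in> ?A" by simp
    with max X(1) have "X = H" by blast
    with X show ?thesis by simp
  qed
  moreover have "fst ` H \<subseteq> carrier E" using dominatedD(1)[OF H(2)] by auto
  ultimately show ?thesis using H by blast
qed

end

section \<open>From real graphs to linear functions into \<open>L0\<close>\<close>

lemma L0_eq_classI:
  assumes "\<xi> \<in> carrier (L0 P)" "f \<in> borel_measurable P" "AE \<omega> in P. f \<omega> = L0_rep \<xi> \<omega>"
  shows "L0_class P f = \<xi>"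
  using assms L0_class_eq_iff[OF assms(2) L0_rep_measurable[OF assms(1)]] L0_class_rep[OF assms(1)] by simp

context L0_module
begin

lemma L0_linear_rep:
  assumes f: "L0_linear P E f" and x: "x \<in> carrier E"
  shows "f x \<in> carrier (L0 P)" "L0_rep (f x) \<in> borel_measurable P"
    "y \<in> carrier E \<Longrightarrow> AE \<omega> in P. L0_rep (f (x \<oplus> y)) \<omega> = L0_rep (f x) \<omega> + L0_rep (f y) \<omega>"
    "c \<in> borel_measurable P \<Longrightarrow> AE \<omega> in P. L0_rep (f (sc c x)) \<omega> = c \<omega> * L0_rep (f x) \<omega>"
proof -
  have fc: "f z \<in> carrier (L0 P)" if "z \<in> carrier E" for z
    using f that by (auto simp: L0_linear_def)
  show "f x \<in> carrier (L0 P)" by (rule fc[OF x])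
  then show "L0_rep (f x) \<in> borel_measurable P" by (rule L0_rep_measurable)
  show "AE \<omega> in P. L0_rep (f (x \<oplus> y)) \<omega> = L0_rep (f x) \<omega> + L0_rep (f y) \<omega>" if y: "y \<in> carrier E"
    using L0_rep_ops(1)[OF fc[OF x] fc[OF y]] f x y by (simp add: L0_linear_def)
  show "AE \<omega> in P. L0_rep (f (sc c x)) \<omega> = c \<omega> * L0_rep (f x) \<omega>" if c: "c \<in> borel_measurable P"
  proof -
    have "f (sc c x) = L0_class P c \<otimes>\<^bsub>L0 P\<^esub> f x"
      using f x c by (simp add: L0_linear_def sc_def)
    with L0_rep_ops(2)[OF L0_class_in[OF c] fc[OF x]] L0_rep_class(2)[OF c] show ?thesis
      by (auto elim!: AE_mp)
  qed
qed

lemma L0_linear_zero: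
  assumes "L0_linear P E f"
  shows "f \<zero> = \<zero>\<^bsub>L0 P\<^esub>"
proof -
  have "AE \<omega> in P. L0_rep (f (sc (\<lambda>_. 0) \<zero>)) \<omega> = 0 * L0_rep (f \<zero>) \<omega>"
    by (rule L0_linear_rep(4)[OF assms]) auto
  then have "AE \<omega> in P. 0 = L0_rep (f \<zero>) \<omega>" by (auto elim!: AE_mp)
  with L0_linear_rep(1)[OF assms M.zero_closed] show ?thesis
    by (subst L0_zero_class, intro L0_eq_classI[symmetric]) auto
qed

text \<open>Converse of \<open>L0_linear_rep\<close>: linearity up to null sets depending on the
  arguments becomes exact after passing to classes.\<close>

lemma L0_linear_classI:
  assumes meas: "\<And>x. x \<in> carrier E \<Longrightarrow> U x \<in> borel_measurable P"
    and add: "\<And>x y. x \<in> carrier E \<Longrightarrow> y \<in> carrier E \<Longrightarrow> AE \<omega> in P. U (x \<oplus> y) \<omega> = U x \<omega> + U y \<omega>"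
    and smult: "\<And>c x. c \<in> borel_measurable P \<Longrightarrow> x \<in> carrier E \<Longrightarrow> AE \<omega> in P. U (sc c x) \<omega> = c \<omega> * U x \<omega>"
  shows "L0_linear P E (\<lambda>x. L0_class P (U x))"
  unfolding L0_linear_def
proof (intro conjI ballI Pi_I)
  fix x assume x: "x \<in> carrier E"
  note [measurable] = meas[OF x]
  show "L0_class P (U x) \<in> carrier (L0 P)" by simp
  {
    fix y assume y: "y \<in> carrier E"
    note [measurable] = meas[OF y] meas[OF M.a_closed[OF x y]]
    show "L0_class P (U (x \<oplus> y)) = L0_class P (U x) \<oplus>\<^bsub>L0 P\<^esub> L0_class P (U y)"
      using add[OF x y] by (simp add: L0_class_ops L0_class_eq_iff)
  }
  fix \<xi> :: "('w \<Rightarrow> 'k) set" assume "\<xi> \<in> carrier (L0 P)"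
  then obtain c where c[measurable]: "c \<in> borel_measurable P" and \<xi>: "\<xi> = L0_class P c" by (rule L0_cases)
  note [measurable] = meas[OF sc_closed[OF c x]]
  have "L0_class P (U (sc c x)) = L0_class P c \<otimes>\<^bsub>L0 P\<^esub> L0_class P (U x)"
    using smult[OF c x] by (simp add: L0_class_ops L0_class_eq_iff)
  then show "L0_class P (U (\<xi> \<odot> x)) = \<xi> \<otimes>\<^bsub>L0 P\<^esub> L0_class P (U x)"
    by (simp add: \<xi> sc_def)
qed

lemma submodule_L0_module:
  assumes "submodule H (L0 P) E"
  shows "L0_module P (E\<lparr>carrier := H\<rparr>)"
  by (intro L0_module.intro submodule.submodule_is_module[OF assms] module_axioms prob_space_axioms)

lemma sc_submodule: "L0_module.sc P (E\<lparr>carrier := H\<rparr>) = sc"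
  if "submodule H (L0 P) E"
  by (simp add: L0_module.sc_def[OF submodule_L0_module[OF that]] sc_def fun_eq_iff)

text \<open>\<open>R\<close> will be the identity for real scalars and \<open>Re\<close> for complex
  ones, so one graph argument serves both. Any selection \<open>U\<close> from the total dominated
  graph is linear up to null sets, because values of the graph are unique up to null sets.\<close>

lemma real_part_extension:
  fixes R :: "'k \<Rightarrow> real"
  assumes R: "bounded_linear R" "\<And>z. R z \<le> norm z" and N: "ae_seminorm N"
    and H: "submodule H (L0 P) E" and f: "L0_linear P (E\<lparr>carrier := H\<rparr>) f"
    and le: "\<And>x. x \<in> H \<Longrightarrow> AE \<omega> in P. norm (L0_rep (f x) \<omega>) \<le> N x \<omega>"
  obtains U where "\<And>x. x \<in> carrier E \<Longrightarrow> U x \<in> borel_measurable P"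
    "\<And>x y. x \<in> carrier E \<Longrightarrow> y \<in> carrier E \<Longrightarrow> AE \<omega> in P. U (x \<oplus> y) \<omega> = U x \<omega> + U y \<omega>"
    "\<And>c x. c \<in> borel_measurable P \<Longrightarrow> x \<in> carrier E \<Longrightarrow> AE \<omega> in P. U (rsc c x) \<omega> = c \<omega> * U x \<omega>"
    "\<And>x. x \<in> carrier E \<Longrightarrow> AE \<omega> in P. U x \<omega> \<le> N x \<omega>"
    "\<And>x. x \<in> H \<Longrightarrow> AE \<omega> in P. U x \<omega> = R (L0_rep (f x) \<omega>)"
proof -
  interpret sub: L0_module P "E\<lparr>carrier := H\<rparr>" by (rule submodule_L0_module[OF H])
  note sub_sc = sc_submodule[OF H]
  interpret R: bounded_linear R by fact
  have Rmeas[measurable]: "R \<in> borel_measurable borel"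
    by (intro borel_measurable_continuous_onI linear_continuous_on R)
  have Rreal: "R (of_real a * z) = a * R z" for a z
    using R.scaleR[of a z] by (simp add: scaleR_conv_of_real)
  have HE: "H \<subseteq> carrier E" by (rule submoduleE(1)[OF H])
  have z: "\<zero> \<in> H" using sub.M.zero_closed by simp
  have fm: "L0_rep (f x) \<in> borel_measurable P" if "x \<in> H" for x
    using sub.L0_linear_rep(2)[OF f] that by simp
  \<comment> \<open>All representatives are included: the chosen representative of a sum is only
    almost everywhere the sum of the chosen ones, whereas closure of a graph is literal.\<close>
  define G where "G = {(x, h). x \<in> H \<and> h \<in> borel_measurable P \<and> (AE \<omega> in P. h \<omega> = R (L0_rep (f x) \<omega>))}"
  have "dominated N G"
    unfolding dominated_def
  proof (intro conjI allI impI)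
    fix x h assume xh: "(x, h) \<in> G"
    then show "x \<in> carrier E" "h \<in> borel_measurable P" using HE by (auto simp: G_def)
    have "AE \<omega> in P. h \<omega> = R (L0_rep (f x) \<omega>)" "AE \<omega> in P. norm (L0_rep (f x) \<omega>) \<le> N x \<omega>"
      using xh le[of x] by (auto simp: G_def)
    then show "AE \<omega> in P. h \<omega> \<le> N x \<omega>"
    proof eventually_elim
      case (elim \<omega>)
      with R(2)[of "L0_rep (f x) \<omega>"] show ?case by linarith
    qed
  next
    fix x h y k assume xy: "(x, h) \<in> G" "(y, k) \<in> G"
    then have "x \<in> H" "y \<in> H" by (auto simp: G_def)
    with sub.L0_linear_rep(3)[OF f, of x y]
    have "AE \<omega> in P. L0_rep (f (x \<oplus> y)) \<omega> = L0_rep (f x) \<omega> + L0_rep (f y) \<omega>" by simp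
    moreover have "x \<oplus> y \<in> H" using submoduleE(5)[OF H] \<open>x \<in> H\<close> \<open>y \<in> H\<close> by simp
    ultimately show "(x \<oplus> y, \<lambda>\<omega>. h \<omega> + k \<omega>) \<in> G"
      using xy unfolding G_def by (auto simp: R.add elim!: AE_mp)
  next
    fix c :: "'w \<Rightarrow> real" and x h assume c: "c \<in> borel_measurable P" and xh: "(x, h) \<in> G"
    then have "x \<in> H" by (auto simp: G_def)
    with sub.L0_linear_rep(4)[OF f, of x "\<lambda>\<omega>. of_real (c \<omega>)"] c
    have "AE \<omega> in P. L0_rep (f (rsc c x)) \<omega> = of_real (c \<omega>) * L0_rep (f x) \<omega>" by (simp add: sub_sc)
    moreover have "rsc c x \<in> H"
      unfolding sc_def using submoduleE(4)[OF H] \<open>x \<in> H\<close> c by simp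
    ultimately show "(rsc c x, \<lambda>\<omega>. c \<omega> * h \<omega>) \<in> G"
      using xh c unfolding G_def by (auto simp: Rreal elim!: AE_mp)
  qed
  moreover have GI: "(x, \<lambda>\<omega>. R (L0_rep (f x) \<omega>)) \<in> G" if "x \<in> H" for x
    using that fm[OF that] by (auto simp: G_def)
  then have "G \<noteq> {}" using z by blast
  ultimately obtain G' where G': "G \<subseteq> G'" "dominated N G'" "fst ` G' = carrier E"
    using dominated_extension[OF N] by blast
  have "\<exists>h. (x, h) \<in> G'" if "x \<in> carrier E" for x
    using that G'(3) by (metis imageE prod.collapse)
  then obtain U where U: "\<And>x. x \<in> carrier E \<Longrightarrow> (x, U x) \<in> G'" by metis
  note uniq = dominated_unique[OF N G'(2)]
  show thesis
  proof (rule that[of U])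
    fix x assume x: "x \<in> carrier E"
    show "U x \<in> borel_measurable P" "AE \<omega> in P. U x \<omega> \<le> N x \<omega>"
      by (rule dominatedD(2)[OF G'(2) U[OF x]] dominatedD(3)[OF G'(2) U[OF x]])+
    show "AE \<omega> in P. U (x \<oplus> y) \<omega> = U x \<omega> + U y \<omega>" if y: "y \<in> carrier E" for y
      by (rule uniq[OF U dominatedD(4)[OF G'(2) U[OF x] U[OF y]]]) (use x y in simp)
    show "AE \<omega> in P. U (rsc c x) \<omega> = c \<omega> * U x \<omega>" if c: "c \<in> borel_measurable P" for c
      by (rule uniq[OF U dominatedD(5)[OF G'(2) U[OF x] c]]) (use x c in simp)
  next
    fix x assume x: "x \<in> H"
    show "AE \<omega> in P. U x \<omega> = R (L0_rep (f x) \<omega>)"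
      by (rule uniq[OF U subsetD[OF G'(1) GI[OF x]]]) (use x HE in blast)
  qed
qed

text \<open>Isolates the only step that depends on the scalar field, so that everything about
  topologies and norms can be proved once for a general \<open>'k\<close>.\<close>

definition extension_property :: bool where
  "extension_property \<longleftrightarrow> (\<forall>N H f. ae_seminorm N \<longrightarrow> submodule H (L0 P) E \<longrightarrow>
     L0_linear P (E\<lparr>carrier := H\<rparr>) f \<longrightarrow> (\<forall>x\<in>H. AE \<omega> in P. norm (L0_rep (f x) \<omega>) \<le> N x \<omega>) \<longrightarrow>
     (\<exists>g. L0_linear P E g \<and> (\<forall>x\<in>H. g x = f x) \<and>
       (\<forall>x\<in>carrier E. AE \<omega> in P. norm (L0_rep (g x) \<omega>) \<le> N x \<omega>)))"

end

text \<open>The one-sided bound \<open>U \<le> N\<close>, applied at \<open>x\<close> and at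
  \<open>- x\<close>, bounds the absolute value.\<close>

lemma real_extension_property:
  fixes E :: "(('w \<Rightarrow> real) set, 'a) module" (structure)
  assumes "L0_module P E"
  shows "L0_module.extension_property P E"
proof -
  interpret L0_module P E by fact
  show ?thesis
    unfolding extension_property_def
  proof (intro allI impI)
    fix N H f
    assume N: "ae_seminorm N" and H: "submodule H (L0 P) E" and f: "L0_linear P (E\<lparr>carrier := H\<rparr>) f"
      and le: "\<forall>x\<in>H. AE \<omega> in P. norm (L0_rep (f x) \<omega>) \<le> N x \<omega>"
    interpret sub: L0_module P "E\<lparr>carrier := H\<rparr>" by (rule submodule_L0_module[OF H])
    have HE: "H \<subseteq> carrier E" by (rule submoduleE(1)[OF H])
    obtain U where U: "\<And>x. x \<in> carrier E \<Longrightarrow> U x \<in> borel_measurable P"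
      "\<And>x y. x \<in> carrier E \<Longrightarrow> y \<in> carrier E \<Longrightarrow> AE \<omega> in P. U (x \<oplus> y) \<omega> = U x \<omega> + U y \<omega>"
      "\<And>c x. c \<in> borel_measurable P \<Longrightarrow> x \<in> carrier E \<Longrightarrow> AE \<omega> in P. U (rsc c x) \<omega> = c \<omega> * U x \<omega>"
      "\<And>x. x \<in> carrier E \<Longrightarrow> AE \<omega> in P. U x \<omega> \<le> N x \<omega>"
      "\<And>x. x \<in> H \<Longrightarrow> AE \<omega> in P. U x \<omega> = L0_rep (f x) \<omega>"
      by (rule real_part_extension[OF bounded_linear_ident _ N H f]) (use le in auto)
    have "AE \<omega> in P. norm (L0_rep (L0_class P (U x)) \<omega>) \<le> N x \<omega>" if x: "x \<in> carrier E" for x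
    proof -
      have "AE \<omega> in P. U (sc (\<lambda>_. - 1) x) \<omega> = - U x \<omega>" using U(3)[of "\<lambda>_. - 1" x] x by simp
      moreover have "AE \<omega> in P. U (sc (\<lambda>_. - 1) x) \<omega> \<le> N (sc (\<lambda>_. - 1) x) \<omega>" using x by (intro U(4)) auto
      moreover have "AE \<omega> in P. N (sc (\<lambda>_. - 1) x) \<omega> = N x \<omega>"
        using ae_seminormD(3)[OF N x, of "\<lambda>_. - 1"] by simp
      ultimately show ?thesis using U(4)[OF x] L0_rep_class(2)[OF U(1)[OF x]]
        by eventually_elim auto
    qed
    moreover have "L0_class P (U x) = f x" if "x \<in> H" for x
      using U(1)[of x] U(5)[OF that] HE that sub.L0_linear_rep(1)[OF f, of x] by (intro L0_eq_classI) auto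
    moreover have "L0_linear P E (\<lambda>x. L0_class P (U x))"
      by (rule L0_linear_classI) (use U(1,2,3) in auto)
    ultimately show "\<exists>g. L0_linear P E g \<and> (\<forall>x\<in>H. g x = f x) \<and>
       (\<forall>x\<in>carrier E. AE \<omega> in P. norm (L0_rep (g x) \<omega>) \<le> N x \<omega>)" by blast
  qed
qed

lemma cnj_sgn_mult: "cnj (sgn z) * z = of_real (norm z)"
proof (cases "z = 0")
  case False
  have "cnj (sgn z) * z = (z * cnj z) / of_real (norm z)"
    by (simp add: sgn_div_norm scaleR_conv_of_real divide_inverse mult_ac)
  also have "\<dots> = of_real (norm z)"
    using False by (simp add: complex_norm_square[symmetric] power2_eq_square)
  finally show ?thesis .
qed simp

text \<open>The Bohnenblust-Sobczyk argument: a complex-linear function is recovered from its real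
  part by \<open>U x - \<i> U (\<i> x)\<close>, and a rotation of \<open>x\<close> reduces its
  modulus to its real part.\<close>

lemma complex_extension_property:
  fixes E :: "(('w \<Rightarrow> complex) set, 'a) module" (structure)
  assumes "L0_module P E"
  shows "L0_module.extension_property P E"
proof -
  interpret L0_module P E by fact
  show ?thesis
    unfolding extension_property_def
  proof (intro allI impI)
    fix N H f
    assume N: "ae_seminorm N" and H: "submodule H (L0 P) E" and f: "L0_linear P (E\<lparr>carrier := H\<rparr>) f"
      and le: "\<forall>x\<in>H. AE \<omega> in P. norm (L0_rep (f x) \<omega>) \<le> N x \<omega>"
    interpret sub: L0_module P "E\<lparr>carrier := H\<rparr>" by (rule submodule_L0_module[OF H])
    note sub_sc = sc_submodule[OF H]
    have HE: "H \<subseteq> carrier E" by (rule submoduleE(1)[OF H])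
    obtain U where U: "\<And>x. x \<in> carrier E \<Longrightarrow> U x \<in> borel_measurable P"
      "\<And>x y. x \<in> carrier E \<Longrightarrow> y \<in> carrier E \<Longrightarrow> AE \<omega> in P. U (x \<oplus> y) \<omega> = U x \<omega> + U y \<omega>"
      "\<And>c x. c \<in> borel_measurable P \<Longrightarrow> x \<in> carrier E \<Longrightarrow> AE \<omega> in P. U (rsc c x) \<omega> = c \<omega> * U x \<omega>"
      "\<And>x. x \<in> carrier E \<Longrightarrow> AE \<omega> in P. U x \<omega> \<le> N x \<omega>"
      "\<And>x. x \<in> H \<Longrightarrow> AE \<omega> in P. U x \<omega> = Re (L0_rep (f x) \<omega>)"
      by (rule real_part_extension[OF bounded_linear_Re _ N H f]) (use le complex_Re_le_cmod in auto)
    let ?i = "sc (\<lambda>_. \<i>)"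
    define V where "V x \<omega> = Complex (U x \<omega>) (- U (?i x) \<omega>)" for x \<omega>
    have Veq: "V x = (\<lambda>\<omega>. of_real (U x \<omega>) - \<i> * of_real (U (?i x) \<omega>))" for x
      by (auto simp: V_def complex_eq_iff)
    have Vm: "V x \<in> borel_measurable P" if "x \<in> carrier E" for x
    proof -
      note [measurable] = U(1)[OF that] U(1)[OF sc_closed[of "\<lambda>_. \<i>", OF _ that]]
      show ?thesis unfolding Veq by measurable
    qed
    have Vadd: "AE \<omega> in P. V (x \<oplus> y) \<omega> = V x \<omega> + V y \<omega>" if "x \<in> carrier E" "y \<in> carrier E" for x y
      using U(2)[OF that] U(2)[of "?i x" "?i y"] that
      by (auto simp: V_def sc_add_right complex_eq_iff elim!: AE_mp)
    have Usmult: "AE \<omega> in P. U (sc c x) \<omega> = Re (c \<omega>) * U x \<omega> + Im (c \<omega>) * U (?i x) \<omega>"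
      if c[measurable]: "c \<in> borel_measurable P" and x: "x \<in> carrier E" for c x
    proof -
      have [measurable]: "(\<lambda>\<omega>. Re (c \<omega>)) \<in> borel_measurable P" "(\<lambda>\<omega>. Im (c \<omega>)) \<in> borel_measurable P"
        by measurable
      have "c = (\<lambda>\<omega>. of_real (Re (c \<omega>)) + of_real (Im (c \<omega>)) * \<i>)" by (auto simp: complex_eq_iff)
      then have "sc c x = rsc (\<lambda>\<omega>. Re (c \<omega>)) x \<oplus> rsc (\<lambda>\<omega>. Im (c \<omega>)) (?i x)"
        using x by (subst \<open>c = _\<close>, subst sc_add_left) (auto simp: sc_sc)
      moreover have "AE \<omega> in P. U (rsc (\<lambda>\<omega>. Re (c \<omega>)) x \<oplus> rsc (\<lambda>\<omega>. Im (c \<omega>)) (?i x)) \<omega>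
          = U (rsc (\<lambda>\<omega>. Re (c \<omega>)) x) \<omega> + U (rsc (\<lambda>\<omega>. Im (c \<omega>)) (?i x)) \<omega>"
        using x by (intro U(2)) auto
      moreover have "AE \<omega> in P. U (rsc (\<lambda>\<omega>. Re (c \<omega>)) x) \<omega> = Re (c \<omega>) * U x \<omega>"
        using x by (intro U(3)) auto
      moreover have "AE \<omega> in P. U (rsc (\<lambda>\<omega>. Im (c \<omega>)) (?i x)) \<omega> = Im (c \<omega>) * U (?i x) \<omega>"
        using x by (intro U(3)) auto
      ultimately show ?thesis by (auto elim!: AE_mp)
    qed
    have Vsmult: "AE \<omega> in P. V (sc c x) \<omega> = c \<omega> * V x \<omega>"
      if c[measurable]: "c \<in> borel_measurable P" and x: "x \<in> carrier E" for c x
    proof -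
      \<comment> \<open>\<open>Usmult\<close> is applied to \<open>\<i> * c\<close>, with real part
        \<open>- Im c\<close> and imaginary part \<open>Re c\<close>, to obtain the imaginary part
        of \<open>V\<close>.\<close>
      have "?i (sc c x) = sc (\<lambda>\<omega>. \<i> * c \<omega>) x" using x by (simp add: sc_sc)
      moreover have "AE \<omega> in P. U (sc (\<lambda>\<omega>. \<i> * c \<omega>) x) \<omega> = - Im (c \<omega>) * U x \<omega> + Re (c \<omega>) * U (?i x) \<omega>"
        using Usmult[of "\<lambda>\<omega>. \<i> * c \<omega>" x] x by simp
      ultimately show ?thesis
        using Usmult[OF c x] by (auto simp: V_def complex_eq_iff elim!: AE_mp)
    qed
    have "AE \<omega> in P. norm (L0_rep (L0_class P (V x)) \<omega>) \<le> N x \<omega>" if x: "x \<in> carrier E" for x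
    proof -
      note [measurable] = Vm[OF x]
      \<comment> \<open>The rotation may depend on \<omega> because scalars are random, so one
        scalar aligns \<open>V x\<close> with the positive axis at all points. Its modulus is
        \<open>1\<close>, or \<open>0\<close> where \<open>V x\<close> vanishes.\<close>
      define t where "t \<omega> = cnj (sgn (V x \<omega>))" for \<omega>
      have [measurable]: "cnj \<in> borel_measurable borel"
        by (intro borel_measurable_continuous_onI continuous_intros)
      have t[measurable]: "t \<in> borel_measurable P" unfolding t_def sgn_div_norm by measurable
      have "AE \<omega> in P. V (sc t x) \<omega> = t \<omega> * V x \<omega>" by (rule Vsmult[OF t x])
      moreover have "AE \<omega> in P. U (sc t x) \<omega> \<le> N (sc t x) \<omega>" using x by (intro U(4)) auto
      moreover have "AE \<omega> in P. N (sc t x) \<omega> = norm (t \<omega>) * N x \<omega>" by (rule ae_seminormD(3)[OF N x t])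
      ultimately show ?thesis using L0_rep_class(2)[OF Vm[OF x]] ae_seminormD(2)[OF N x]
      proof eventually_elim
        case (elim \<omega>)
        have "t \<omega> * V x \<omega> = of_real (norm (V x \<omega>))"
          unfolding t_def by (rule cnj_sgn_mult)
        with elim have "U (sc t x) \<omega> = norm (V x \<omega>)" by (simp add: V_def complex_eq_iff)
        moreover have "norm (t \<omega>) * N x \<omega> \<le> N x \<omega>"
          using elim by (intro mult_left_le_one_le) (auto simp: t_def norm_sgn)
        ultimately show ?case using elim by simp
      qed
    qed
    \<comment> \<open>On \<open>H\<close>, \<open>U (\<i> x)\<close> is the real part of
      \<open>\<i> f x\<close>, that is, minus the imaginary part of \<open>f x\<close>.\<close>
    moreover have "L0_class P (V x) = f x" if x: "x \<in> H" for x
    proof -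
      have "?i x \<in> H" unfolding sc_def using submoduleE(4)[OF H] x by simp
      moreover have "AE \<omega> in P. L0_rep (f (?i x)) \<omega> = \<i> * L0_rep (f x) \<omega>"
        using sub.L0_linear_rep(4)[OF f, of x "\<lambda>_. \<i>"] x by (simp add: sub_sc)
      ultimately have "AE \<omega> in P. V x \<omega> = L0_rep (f x) \<omega>"
        using U(5)[OF x] U(5)[of "?i x"] by (auto simp: V_def complex_eq_iff elim!: AE_mp)
      then show ?thesis
        using Vm[of x] HE x sub.L0_linear_rep(1)[OF f, of x] by (intro L0_eq_classI) auto
    qed
    moreover have "L0_linear P E (\<lambda>x. L0_class P (V x))"
      by (rule L0_linear_classI) (use Vm Vadd Vsmult in auto)
    ultimately show "\<exists>g. L0_linear P E g \<and> (\<forall>x\<in>H. g x = f x) \<and>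
       (\<forall>x\<in>carrier E. AE \<omega> in P. norm (L0_rep (g x) \<omega>) \<le> N x \<omega>)" by blast
  qed
qed

section \<open>Topologies and bounds\<close>

lemma L0_plus_iff: "\<xi> \<in> L0_plus P \<longleftrightarrow> \<xi> \<in> carrier (L0 P) \<and> (AE \<omega> in P. 0 \<le> L0_rep \<xi> \<omega>)"
  using L0_rep_consts(1)[where 'k=real and P=P]
  by (auto simp: L0_plus_def L0_order_def elim!: AE_mp)

text \<open>The class of the pointwise maximum is an upper bound, and finitely many null sets
  suffice to place the maximum below the lattice supremum.\<close>

lemma Q_norm_rep:
  assumes Q: "finite Q" "Q \<noteq> {}" "\<And>p. p \<in> Q \<Longrightarrow> p x \<in> L0_plus P"
  shows "AE \<omega> in P. L0_rep (Q_norm P Q x) \<omega> = Max ((\<lambda>p. L0_rep (p x) \<omega>) ` Q)"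
proof -
  have l: "least (L0_order P) (Q_norm P Q x) (Upper (L0_order P) {p x |p. p \<in> Q})"
    using Q by (rule L0_Q_norm_least)
  have pc: "p x \<in> carrier (L0 P)" if "p \<in> Q" for p
    using Q(3)[OF that] by (simp add: L0_plus_def)
  define m where "m \<omega> = Max ((\<lambda>p. L0_rep (p x) \<omega>) ` Q)" for \<omega>
  have m: "m \<in> borel_measurable P"
    unfolding m_def using Q(1) pc by (intro borel_measurable_Max) (auto intro: L0_rep_measurable)
  note mr = L0_rep_class(2)[OF m]
  have "L0_class P m \<in> Upper (L0_order P) {p x |p. p \<in> Q}"
  proof (rule Upper_memI)
    fix z assume "z \<in> {p x |p. p \<in> Q}"
    then obtain p where p: "p \<in> Q" "z = p x" by blast
    with Q(1) have "L0_rep z \<omega> \<le> m \<omega>" for \<omega> by (simp add: m_def)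
    with mr show "z \<sqsubseteq>\<^bsub>L0_order P\<^esub> L0_class P m"
      by (auto simp: L0_order_def elim!: AE_mp)
  qed (use m in \<open>simp add: L0_order_def\<close>)
  from least_le[OF l this] have "AE \<omega> in P. L0_rep (Q_norm P Q x) \<omega> \<le> L0_rep (L0_class P m) \<omega>"
    by (simp add: L0_order_def)
  moreover have "AE \<omega> in P. \<forall>p\<in>Q. L0_rep (p x) \<omega> \<le> L0_rep (Q_norm P Q x) \<omega>"
  proof (rule AE_finite_allI[OF Q(1)])
    fix p assume p: "p \<in> Q"
    have "p x \<sqsubseteq>\<^bsub>L0_order P\<^esub> Q_norm P Q x"
      by (rule least_Upper_above[OF l]) (use p pc in \<open>auto simp: L0_order_def\<close>)
    then show "AE \<omega> in P. L0_rep (p x) \<omega> \<le> L0_rep (Q_norm P Q x) \<omega>"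
      by (simp add: L0_order_def)
  qed
  ultimately show ?thesis using mr
  proof eventually_elim
    case (elim \<omega>)
    from elim(2) have "m \<omega> \<le> L0_rep (Q_norm P Q x) \<omega>"
      using Q(1,2) by (auto simp: m_def)
    with elim show ?case by (simp add: m_def)
  qed
qed

text \<open>Up to a null set, \<open>A\<close> is contained in \<open>C\<close> together with the
  complement of \<open>B\<close>.\<close>

lemma (in prob_space) prob_combine:
  assumes ev: "A \<in> events" "B \<in> events" "C \<in> events"
    and pr: "1 - a \<le> prob A" "1 - b < prob B" and sub: "AE \<omega> in M. \<omega> \<in> A \<longrightarrow> \<omega> \<in> B \<longrightarrow> \<omega> \<in> C"
  shows "1 - (a + b) < prob C"
proof -
  have "prob A \<le> prob (C \<union> (space M - B))"
    by (rule finite_measure_mono_AE) (use ev sub AE_space in \<open>auto elim!: AE_mp\<close>)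
  also have "\<dots> \<le> prob C + prob (space M - B)"
    using ev by (intro measure_Un_le) auto
  finally show ?thesis using pr prob_compl[OF ev(2)] by linarith
qed

lemma le_all_inverse_Suc:
  fixes a b c :: real
  assumes "\<And>n. a \<le> b + c * (1 / real (Suc n))"
  shows "a \<le> b"
proof -
  have "(\<lambda>n. b + c * (1 / real (Suc n))) \<longlonglongrightarrow> b + c * 0"
    by (intro tendsto_intros LIMSEQ_Suc[OF lim_1_over_n])
  with assms show ?thesis by (intro LIMSEQ_le_const[of "\<lambda>n. b + c * (1 / real (Suc n))" b]) auto
qed

section \<open>New seminorms from old, and bounds from the unit ball\<close>

context L0_module
begin

lemma ae_seminorm_scale:
  assumes N: "ae_seminorm N" and [measurable]: "k \<in> borel_measurable P" and k: "AE \<omega> in P. 0 \<le> k \<omega>"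
  shows "ae_seminorm (\<lambda>x \<omega>. k \<omega> * N x \<omega>)"
  unfolding ae_seminorm_def
proof (intro conjI ballI)
  fix x assume x: "x \<in> carrier E"
  note [measurable] = ae_seminormD(1)[OF N x]
  show "(\<lambda>\<omega>. k \<omega> * N x \<omega>) \<in> borel_measurable P" by measurable
  from k ae_seminormD(2)[OF N x] show "AE \<omega> in P. 0 \<le> k \<omega> * N x \<omega>" by eventually_elim simp
  show "AE \<omega> in P. k \<omega> * N (sc c x) \<omega> = norm (c \<omega>) * (k \<omega> * N x \<omega>)" if "c \<in> borel_measurable P" for c
    using ae_seminormD(3)[OF N x that] by eventually_elim simp
  show "AE \<omega> in P. k \<omega> * N (x \<oplus> y) \<omega> \<le> k \<omega> * N x \<omega> + k \<omega> * N y \<omega>" if y: "y \<in> carrier E" for y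
    using ae_seminormD(4)[OF N x y] k
    by eventually_elim (simp add: mult_left_mono flip: distrib_left)
qed

text \<open>\<open>K\<close> labels the pieces of a countable partition, and on \<open>K = n\<close>
  the seminorm \<open>N n\<close> is used. The seminorm laws compare values at one \<omega> and so
  never mix pieces; the null sets are countably many.\<close>

lemma ae_seminorm_select:
  assumes N: "\<And>n::nat. ae_seminorm (N n)" and K: "K \<in> measurable P (count_space UNIV)"
  shows "ae_seminorm (\<lambda>x \<omega>. N (K \<omega>) x \<omega>)"
  unfolding ae_seminorm_def
proof (intro conjI ballI)
  fix x assume x: "x \<in> carrier E"
  show "(\<lambda>\<omega>. N (K \<omega>) x \<omega>) \<in> borel_measurable P"
    using ae_seminormD(1)[OF N x] by (rule measurable_compose_countable[OF _ K])
  have "AE \<omega> in P. \<forall>n. 0 \<le> N n x \<omega>"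
    using ae_seminormD(2)[OF N x] by (simp add: AE_all_countable)
  then show "AE \<omega> in P. 0 \<le> N (K \<omega>) x \<omega>" by eventually_elim simp
  show "AE \<omega> in P. N (K \<omega>) (sc c x) \<omega> = norm (c \<omega>) * N (K \<omega>) x \<omega>" if "c \<in> borel_measurable P" for c
  proof -
    have "AE \<omega> in P. \<forall>n. N n (sc c x) \<omega> = norm (c \<omega>) * N n x \<omega>"
      using ae_seminormD(3)[OF N x that] by (simp add: AE_all_countable)
    then show ?thesis by eventually_elim simp
  qed
  show "AE \<omega> in P. N (K \<omega>) (x \<oplus> y) \<omega> \<le> N (K \<omega>) x \<omega> + N (K \<omega>) y \<omega>" if y: "y \<in> carrier E" for y
  proof -
    have "AE \<omega> in P. \<forall>n. N n (x \<oplus> y) \<omega> \<le> N n x \<omega> + N n y \<omega>"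
      using ae_seminormD(4)[OF N x y] by (simp add: AE_all_countable)
    then show ?thesis by eventually_elim simp
  qed
qed

text \<open>Each vector is scaled into the unit ball by a random factor. As \<open>N x\<close> may
  vanish on an event of positive probability, \<open>N x + 1 / (n + 1)\<close> is divided out, and
  \<open>n\<close> tends to infinity at the end.\<close>

lemma bound_from_unit_ball:
  assumes f: "L0_linear P E f" and N: "ae_seminorm N"
    and unit: "\<And>y. y \<in> carrier E \<Longrightarrow> AE \<omega> in P. N y \<omega> \<le> 1 \<Longrightarrow>
      AE \<omega> in P. \<omega> \<in> A \<longrightarrow> norm (L0_rep (f y) \<omega>) \<le> k \<omega>"
    and x: "x \<in> carrier E"
  shows "AE \<omega> in P. \<omega> \<in> A \<longrightarrow> norm (L0_rep (f x) \<omega>) \<le> k \<omega> * N x \<omega>"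
proof -
  note [measurable] = ae_seminormD(1)[OF N x]
  note nonneg = ae_seminormD(2)[OF N x]
  have "AE \<omega> in P. \<omega> \<in> A \<longrightarrow> norm (L0_rep (f x) \<omega>) \<le> k \<omega> * (N x \<omega> + 1 / real (Suc n))" for n
  proof -
    \<comment> \<open>The absolute value keeps the denominator positive at every point, whereas
      \<open>N x\<close> is nonnegative only almost everywhere.\<close>
    let ?c = "\<lambda>\<omega>. of_real (1 / (\<bar>N x \<omega>\<bar> + 1 / real (Suc n))) :: 'k"
    have c[measurable]: "?c \<in> borel_measurable P" by measurable
    have nc: "norm (?c \<omega>) = 1 / (\<bar>N x \<omega>\<bar> + 1 / real (Suc n))" for \<omega>
      unfolding norm_of_real by (rule abs_of_nonneg) auto
    have pos: "0 < \<bar>N x \<omega>\<bar> + 1 / real (Suc n)" for \<omega> by (rule add_nonneg_pos) auto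
    have "AE \<omega> in P. N (sc ?c x) \<omega> \<le> 1"
      using ae_seminormD(3)[OF N x c] nonneg
    proof eventually_elim
      case (elim \<omega>)
      with pos[of \<omega>] show ?case unfolding elim(1) nc by (simp add: divide_simps)
    qed
    from unit[OF sc_closed[OF c x] this] L0_linear_rep(4)[OF f x c] nonneg
    show ?thesis
    proof eventually_elim
      case (elim \<omega>)
      show ?case
      proof
        assume "\<omega> \<in> A"
        with elim(1) have "norm (L0_rep (f (sc ?c x)) \<omega>) \<le> k \<omega>" by (rule mp)
        then have "norm (?c \<omega>) * norm (L0_rep (f x) \<omega>) \<le> k \<omega>"
          unfolding elim(2) norm_mult .
        with pos[of \<omega>] elim(3) show "norm (L0_rep (f x) \<omega>) \<le> k \<omega> * (N x \<omega> + 1 / real (Suc n))"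
          unfolding nc by (simp add: pos_divide_le_eq)
      qed
    qed
  qed
  then have "AE \<omega> in P. \<forall>n. \<omega> \<in> A \<longrightarrow> norm (L0_rep (f x) \<omega>) \<le> k \<omega> * (N x \<omega> + 1 / real (Suc n))"
    by (rule AE_all_countable[THEN iffD2, OF allI])
  then show ?thesis
  proof (rule eventually_mono, intro impI)
    fix \<omega> assume "\<forall>n. \<omega> \<in> A \<longrightarrow> norm (L0_rep (f x) \<omega>) \<le> k \<omega> * (N x \<omega> + 1 / real (Suc n))" "\<omega> \<in> A"
    then have "norm (L0_rep (f x) \<omega>) \<le> k \<omega> * N x \<omega> + k \<omega> * (1 / real (Suc n))" for n
      by (simp add: distrib_left)
    then show "norm (L0_rep (f x) \<omega>) \<le> k \<omega> * N x \<omega>" by (rule le_all_inverse_Suc)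
  qed
qed

end

section \<open>Finite subfamilies and the two topologies in terms of representatives\<close>

locale L0_seminormed_module = L0_module P E
  for P :: "'w measure"
    and E :: "(('w \<Rightarrow> 'k::{real_normed_field, second_countable_topology}) set, 'a) module" (structure) +
  fixes \<P> :: "('a \<Rightarrow> ('w \<Rightarrow> real) set) set"
  assumes seminorms: "p \<in> \<P> \<Longrightarrow> L0_seminorm P E p" and nonempty: "\<P> \<noteq> {}"
begin

definition admissible :: "('a \<Rightarrow> ('w \<Rightarrow> real) set) set \<Rightarrow> bool" where
  "admissible Q \<longleftrightarrow> finite Q \<and> Q \<noteq> {} \<and> Q \<subseteq> \<P>"

abbreviation qn :: "('a \<Rightarrow> ('w \<Rightarrow> real) set) set \<Rightarrow> 'a \<Rightarrow> 'w \<Rightarrow> real" where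
  "qn Q x \<equiv> L0_rep (Q_norm P Q x)"

lemma admissible_ex: "\<exists>Q. admissible Q"
  using nonempty by (auto simp: admissible_def intro!: exI[of _ "{SOME p. p \<in> \<P>}"] some_in_eq[THEN iffD2])

lemma seminorm_plus: "p \<in> \<P> \<Longrightarrow> x \<in> carrier E \<Longrightarrow> p x \<in> L0_plus P"
  using seminorms[of p] by (simp add: L0_seminorm_def Pi_iff)

lemma seminorm_ae:
  assumes p: "p \<in> \<P>"
  shows "ae_seminorm (\<lambda>x. L0_rep (p x))"
proof -
  have pc: "p x \<in> carrier (L0 P)" if "x \<in> carrier E" for x
    using seminorm_plus[OF p that] by (simp add: L0_plus_def)
  show ?thesis
    unfolding ae_seminorm_def
  proof (intro conjI ballI)
    fix x assume x: "x \<in> carrier E"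
    show "L0_rep (p x) \<in> borel_measurable P" by (rule L0_rep_measurable[OF pc[OF x]])
    show "AE \<omega> in P. 0 \<le> L0_rep (p x) \<omega>" using seminorm_plus[OF p x] by (simp add: L0_plus_iff)
    show "AE \<omega> in P. L0_rep (p (sc c x)) \<omega> = norm (c \<omega>) * L0_rep (p x) \<omega>" if c: "c \<in> borel_measurable P" for c
    proof -
      have cc: "L0_class P c \<in> carrier (L0 P)" using c by simp
      have "p (sc c x) = L0_abs P (L0_class P c) \<otimes>\<^bsub>L0 P\<^esub> p x"
        using seminorms[OF p] x c by (simp add: L0_seminorm_def sc_def)
      with L0_rep_ops(2)[OF L0_closed(3)[OF cc] pc[OF x]] L0_rep_ops(4)[OF cc cc] L0_rep_class(2)[OF c]
      show ?thesis by (auto elim!: AE_mp)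
    qed
    show "AE \<omega> in P. L0_rep (p (x \<oplus> y)) \<omega> \<le> L0_rep (p x) \<omega> + L0_rep (p y) \<omega>" if y: "y \<in> carrier E" for y
    proof -
      have "AE \<omega> in P. L0_rep (p (x \<oplus> y)) \<omega> \<le> L0_rep (p x \<oplus>\<^bsub>L0 P\<^esub> p y) \<omega>"
        using seminorms[OF p] x y by (simp add: L0_seminorm_def L0_order_def)
      with L0_rep_ops(1)[OF pc[OF x] pc[OF y]] show ?thesis by eventually_elim simp
    qed
  qed
qed

lemma qn_Max:
  assumes "admissible Q" "x \<in> carrier E"
  shows "AE \<omega> in P. qn Q x \<omega> = Max ((\<lambda>p. L0_rep (p x) \<omega>) ` Q)"
  using assms seminorm_plus by (intro Q_norm_rep) (auto simp: admissible_def)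

lemma qn_ae_seminorm:
  assumes Q: "admissible Q"
  shows "ae_seminorm (qn Q)"
proof -
  have fin: "finite Q" "Q \<noteq> {}" and sub: "\<And>p. p \<in> Q \<Longrightarrow> p \<in> \<P>" using Q by (auto simp: admissible_def)
  note s = seminorm_ae[OF sub]
  show ?thesis
    unfolding ae_seminorm_def
  proof (intro conjI ballI)
    fix x assume x: "x \<in> carrier E"
    show "qn Q x \<in> borel_measurable P"
      by (intro L0_rep_measurable L0_Q_norm_carrier) (use fin sub seminorm_plus x in auto)
    have "AE \<omega> in P. \<forall>p\<in>Q. 0 \<le> L0_rep (p x) \<omega>"
      by (rule AE_finite_allI[OF fin(1)]) (rule ae_seminormD(2)[OF s x])
    with qn_Max[OF Q x] show "AE \<omega> in P. 0 \<le> qn Q x \<omega>"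
    proof eventually_elim
      case (elim \<omega>)
      with fin show ?case by (auto simp: Max_ge_iff)
    qed
    show "AE \<omega> in P. qn Q (sc c x) \<omega> = norm (c \<omega>) * qn Q x \<omega>" if c: "c \<in> borel_measurable P" for c
    proof -
      have "AE \<omega> in P. \<forall>p\<in>Q. L0_rep (p (sc c x)) \<omega> = norm (c \<omega>) * L0_rep (p x) \<omega>"
        by (rule AE_finite_allI[OF fin(1)]) (rule ae_seminormD(3)[OF s x c])
      with qn_Max[OF Q x] qn_Max[OF Q sc_closed[OF c x]] show ?thesis
      proof eventually_elim
        case (elim \<omega>)
        \<comment> \<open>Multiplication by a nonnegative number is monotone and so commutes with
          finite maxima.\<close>
        have "norm (c \<omega>) * Max ((\<lambda>p. L0_rep (p x) \<omega>) ` Q) = Max ((\<lambda>r. norm (c \<omega>) * r) ` (\<lambda>p. L0_rep (p x) \<omega>) ` Q)"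
          using fin by (intro mono_Max_commute) (auto intro!: monoI mult_left_mono)
        also have "(\<lambda>r. norm (c \<omega>) * r) ` (\<lambda>p. L0_rep (p x) \<omega>) ` Q = (\<lambda>p. L0_rep (p (sc c x)) \<omega>) ` Q"
          using elim(3) by (auto simp: image_image)
        finally show ?case using elim by simp
      qed
    qed
    show "AE \<omega> in P. qn Q (x \<oplus> y) \<omega> \<le> qn Q x \<omega> + qn Q y \<omega>" if y: "y \<in> carrier E" for y
    proof -
      have "AE \<omega> in P. \<forall>p\<in>Q. L0_rep (p (x \<oplus> y)) \<omega> \<le> L0_rep (p x) \<omega> + L0_rep (p y) \<omega>"
        by (rule AE_finite_allI[OF fin(1)]) (rule ae_seminormD(4)[OF s x y])
      with qn_Max[OF Q x] qn_Max[OF Q y] qn_Max[OF Q M.a_closed[OF x y]] show ?thesis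
      proof eventually_elim
        case (elim \<omega>)
        have "L0_rep (p (x \<oplus> y)) \<omega> \<le> qn Q x \<omega> + qn Q y \<omega>" if p: "p \<in> Q" for p
        proof -
          have "L0_rep (p x) \<omega> \<le> qn Q x \<omega>" "L0_rep (p y) \<omega> \<le> qn Q y \<omega>"
            using p fin elim by auto
          with elim(4) p show ?thesis by fastforce
        qed
        then show ?case using elim(3) fin by simp
      qed
    qed
  qed
qed

lemma qn_mono:
  assumes "admissible Q'" "Q \<noteq> {}" "Q \<subseteq> Q'" "x \<in> carrier E"
  shows "AE \<omega> in P. qn Q x \<omega> \<le> qn Q' x \<omega>"
  using assms seminorm_plus by (intro L0_Q_norm_mono) (auto simp: admissible_def)

lemma open_c_iff:
  "openin (topology_c P E \<P>) G \<longleftrightarrow> G \<subseteq> carrier E \<and>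
    (\<forall>x\<in>G. \<exists>Q e. admissible Q \<and> e \<in> borel_measurable P \<and> (AE \<omega> in P. 0 < e \<omega>) \<and>
       (\<forall>y\<in>carrier E. (AE \<omega> in P. qn Q y \<omega> \<le> e \<omega>) \<longrightarrow> x \<oplus> y \<in> G))"
proof -
  have "(\<exists>Q \<epsilon>. finite Q \<and> Q \<noteq> {} \<and> Q \<subseteq> \<P> \<and> \<epsilon> \<in> L0_plusplus P \<and>
        {x \<oplus> y |y. y \<in> carrier E \<and> Q_norm P Q y \<sqsubseteq>\<^bsub>L0_order P\<^esub> \<epsilon>} \<subseteq> G) \<longleftrightarrow>
      (\<exists>Q e. admissible Q \<and> e \<in> borel_measurable P \<and> (AE \<omega> in P. 0 < e \<omega>) \<and>
       (\<forall>y\<in>carrier E. (AE \<omega> in P. qn Q y \<omega> \<le> e \<omega>) \<longrightarrow> x \<oplus> y \<in> G))" (is "?A \<longleftrightarrow> ?B") for x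
  proof
    assume ?A
    then obtain Q \<epsilon> where *: "finite Q" "Q \<noteq> {}" "Q \<subseteq> \<P>" "\<epsilon> \<in> L0_plusplus P"
        "{x \<oplus> y |y. y \<in> carrier E \<and> Q_norm P Q y \<sqsubseteq>\<^bsub>L0_order P\<^esub> \<epsilon>} \<subseteq> G" by blast
    show ?B
    proof (intro exI[of _ Q] exI[of _ "L0_rep \<epsilon>"] conjI ballI impI)
      show "admissible Q" using * by (simp add: admissible_def)
      show "L0_rep \<epsilon> \<in> borel_measurable P" "AE \<omega> in P. 0 < L0_rep \<epsilon> \<omega>"
        using *(4) by (auto simp: L0_plusplus_def L0_plus_def intro!: L0_rep_measurable)
      fix y assume "y \<in> carrier E" "AE \<omega> in P. qn Q y \<omega> \<le> L0_rep \<epsilon> \<omega>"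
      then show "x \<oplus> y \<in> G" using *(5) by (auto simp: L0_order_def)
    qed
  next
    assume ?B
    then obtain Q e where *: "admissible Q" "e \<in> borel_measurable P" "AE \<omega> in P. 0 < e \<omega>"
       "\<forall>y\<in>carrier E. (AE \<omega> in P. qn Q y \<omega> \<le> e \<omega>) \<longrightarrow> x \<oplus> y \<in> G" by blast
    note r = L0_rep_class(2)[OF *(2)]
    have "L0_class P e \<in> L0_plusplus P"
      using *(2,3) r by (auto simp: L0_plusplus_def L0_plus_iff elim!: AE_mp)
    moreover have "{x \<oplus> y |y. y \<in> carrier E \<and> Q_norm P Q y \<sqsubseteq>\<^bsub>L0_order P\<^esub> L0_class P e} \<subseteq> G"
    proof clarsimp
      fix y assume y: "y \<in> carrier E" "Q_norm P Q y \<sqsubseteq>\<^bsub>L0_order P\<^esub> L0_class P e"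
      then have "AE \<omega> in P. qn Q y \<omega> \<le> L0_rep (L0_class P e) \<omega>" by (simp add: L0_order_def)
      with r have "AE \<omega> in P. qn Q y \<omega> \<le> e \<omega>" by eventually_elim simp
      with * y show "x \<oplus> y \<in> G" by blast
    qed
    ultimately show ?A using *(1) unfolding admissible_def by blast
  qed
  then show ?thesis
    using openin_topology_c[of \<P> E P G] seminorms by (simp add: L0_seminorm_def)
qed

lemma open_el_iff:
  "openin (topology_el P E \<P>) G \<longleftrightarrow> G \<subseteq> carrier E \<and>
    (\<forall>x\<in>G. \<exists>Q e d. admissible Q \<and> 0 < e \<and> 0 < d \<and> d < 1 \<and>
       (\<forall>y\<in>carrier E. 1 - d < prob {\<omega>\<in>space P. qn Q y \<omega> < e} \<longrightarrow> x \<oplus> y \<in> G))"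
proof -
  have "(\<exists>Q \<epsilon> \<delta>. finite Q \<and> Q \<noteq> {} \<and> Q \<subseteq> \<P> \<and> 0 < \<epsilon> \<and> 0 < \<delta> \<and> \<delta> < 1 \<and>
        {x \<oplus> y |y. y \<in> nhd_el P E Q \<epsilon> \<delta>} \<subseteq> G) \<longleftrightarrow>
      (\<exists>Q e d. admissible Q \<and> 0 < e \<and> 0 < d \<and> d < 1 \<and>
       (\<forall>y\<in>carrier E. 1 - d < prob {\<omega>\<in>space P. qn Q y \<omega> < e} \<longrightarrow> x \<oplus> y \<in> G))" for x
    unfolding nhd_el_def admissible_def by (intro ex_cong1) blast
  then show ?thesis
    using openin_topology_el[OF prob_space_axioms, of \<P> E G] seminorms by (simp add: L0_seminorm_def)
qed

lemma topspace_c: "topspace (topology_c P E \<P>) = carrier E"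
proof (rule antisym)
  show "topspace (topology_c P E \<P>) \<subseteq> carrier E"
    using openin_topspace open_c_iff by blast
  obtain Q where "admissible Q" using admissible_ex by blast
  then have "openin (topology_c P E \<P>) (carrier E)"
    unfolding open_c_iff by (auto intro!: exI[of _ Q] exI[of _ "\<lambda>_. 1"])
  then show "carrier E \<subseteq> topspace (topology_c P E \<P>)" by (rule openin_subset)
qed

lemma topspace_el: "topspace (topology_el P E \<P>) = carrier E"
proof (rule antisym)
  show "topspace (topology_el P E \<P>) \<subseteq> carrier E"
    using openin_topspace open_el_iff by blast
  obtain Q where "admissible Q" using admissible_ex by blast
  then have "openin (topology_el P E \<P>) (carrier E)"
    unfolding open_el_iff by (auto intro!: exI[of _ Q] exI[of _ "1::real"] exI[of _ "1/2::real"])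
  then show "carrier E \<subseteq> topspace (topology_el P E \<P>)" by (rule openin_subset)
qed

end

section \<open>The target space \<open>L0\<close> and its open unit balls\<close>

lemma L0_self_seminormed:
  assumes "prob_space P"
  shows "L0_seminormed_module P
    (L0 P :: (('w \<Rightarrow> 'k::{real_normed_field, second_countable_topology}) set, ('w \<Rightarrow> 'k) set) module) {L0_abs P}"
proof -
  have "L0_module P (L0 P :: (('w \<Rightarrow> 'k) set, ('w \<Rightarrow> 'k) set) module)"
    by (intro L0_module.intro assms L0_self_module)
  then show ?thesis
    using L0_random_normed_module[OF assms, where 'k='k]
    by (intro L0_seminormed_module.intro L0_seminormed_module_axioms.intro)
      (auto simp: random_normed_module_def random_locally_convex_module_def)
qed

lemma Q_norm_abs:
  fixes z :: "('w \<Rightarrow> 'k::{real_normed_field, second_countable_topology}) set"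
  assumes "prob_space P" and z: "z \<in> carrier (L0 P)"
  shows "AE \<omega> in P. L0_rep (Q_norm P {L0_abs P} z) \<omega> = norm (L0_rep z \<omega>)"
proof -
  interpret L: L0_seminormed_module P "L0 P" "{L0_abs P} :: (('w \<Rightarrow> 'k) set \<Rightarrow> ('w \<Rightarrow> real) set) set"
    by (rule L0_self_seminormed[OF assms(1)])
  have "L.admissible {L0_abs P}" by (simp add: L.admissible_def)
  from L.qn_Max[OF this z] L0_rep_ops(4)[OF z z] show ?thesis by (auto elim!: AE_mp)
qed

lemma L0_open_c:
  fixes G :: "('w \<Rightarrow> 'k::{real_normed_field, second_countable_topology}) set set"
  assumes P: "prob_space P"
  shows "openin (topology_c P (L0 P) {L0_abs P}) G \<longleftrightarrow> G \<subseteq> carrier (L0 P) \<and>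
    (\<forall>x\<in>G. \<exists>e. e \<in> borel_measurable P \<and> (AE \<omega> in P. 0 < e \<omega>) \<and>
       (\<forall>y\<in>carrier (L0 P). (AE \<omega> in P. norm (L0_rep y \<omega>) \<le> e \<omega>) \<longrightarrow> x \<oplus>\<^bsub>L0 P\<^esub> y \<in> G))"
proof -
  interpret L: L0_seminormed_module P "L0 P" "{L0_abs P} :: (('w \<Rightarrow> 'k) set \<Rightarrow> ('w \<Rightarrow> real) set) set"
    by (rule L0_self_seminormed[OF P])
  have adm: "L.admissible Q \<longleftrightarrow> Q = {L0_abs P}" for Q
    by (auto simp: L.admissible_def intro: finite_subset)
  have eq: "(AE \<omega> in P. L0_rep (Q_norm P {L0_abs P} y) \<omega> \<le> e \<omega>) \<longleftrightarrow> (AE \<omega> in P. norm (L0_rep y \<omega>) \<le> e \<omega>)"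
    if "y \<in> carrier (L0 P)" for y :: "('w \<Rightarrow> 'k) set" and e
    using Q_norm_abs[OF P that] by (intro eventually_cong) auto
  show ?thesis unfolding L.open_c_iff adm by (simp add: eq cong: ball_cong)
qed

lemma L0_open_el:
  fixes G :: "('w \<Rightarrow> 'k::{real_normed_field, second_countable_topology}) set set"
  assumes P: "prob_space P"
  shows "openin (topology_el P (L0 P) {L0_abs P}) G \<longleftrightarrow> G \<subseteq> carrier (L0 P) \<and>
    (\<forall>x\<in>G. \<exists>e d. 0 < e \<and> 0 < d \<and> d < 1 \<and>
       (\<forall>y\<in>carrier (L0 P). 1 - d < measure P {\<omega>\<in>space P. norm (L0_rep y \<omega>) < e} \<longrightarrow> x \<oplus>\<^bsub>L0 P\<^esub> y \<in> G))"
proof -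
  interpret L: L0_seminormed_module P "L0 P" "{L0_abs P} :: (('w \<Rightarrow> 'k) set \<Rightarrow> ('w \<Rightarrow> real) set) set"
    by (rule L0_self_seminormed[OF P])
  have adm: "L.admissible Q \<longleftrightarrow> Q = {L0_abs P}" for Q
    by (auto simp: L.admissible_def intro: finite_subset)
  have eq: "measure P {\<omega>\<in>space P. L0_rep (Q_norm P {L0_abs P} y) \<omega> < e} =
      measure P {\<omega>\<in>space P. norm (L0_rep y \<omega>) < e}"
    if y: "y \<in> carrier (L0 P)" for y :: "('w \<Rightarrow> 'k) set" and e
  proof (rule L.finite_measure_eq_AE)
    have "Q_norm P {L0_abs P} y \<in> carrier (L0 P)"
      using L.seminorm_plus y by (intro L0_Q_norm_carrier) auto
    note [measurable] = L0_rep_measurable[OF this] L0_rep_measurable[OF y]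
    show "{\<omega>\<in>space P. L0_rep (Q_norm P {L0_abs P} y) \<omega> < e} \<in> sets P"
      "{\<omega>\<in>space P. norm (L0_rep y \<omega>) < e} \<in> sets P" by measurable
    from Q_norm_abs[OF P y]
    show "AE \<omega> in P. \<omega> \<in> {\<omega>\<in>space P. L0_rep (Q_norm P {L0_abs P} y) \<omega> < e} \<longleftrightarrow>
        \<omega> \<in> {\<omega>\<in>space P. norm (L0_rep y \<omega>) < e}" by eventually_elim simp
  qed
  show ?thesis unfolding L.open_el_iff adm by (simp add: eq cong: ball_cong)
qed

text \<open>The distance \<open>1 - |x|\<close> to the boundary may have no positive constant below
  it, but \<open>topology_c\<close> admits random radii, and half of this distance is one.\<close>

lemma L0_unit_ball_open_c:
  assumes P: "prob_space P"
  shows "openin (topology_c P (L0 P) {L0_abs P})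
    {z \<in> carrier (L0 P :: (('w \<Rightarrow> 'k::{real_normed_field, second_countable_topology}) set, ('w \<Rightarrow> 'k) set) module).
      AE \<omega> in P. norm (L0_rep z \<omega>) < 1}"
  unfolding L0_open_c[OF P]
proof (intro conjI ballI)
  fix x :: "('w \<Rightarrow> 'k) set"
  assume "x \<in> {z \<in> carrier (L0 P). AE \<omega> in P. norm (L0_rep z \<omega>) < 1}"
  then have x: "x \<in> carrier (L0 P)" "AE \<omega> in P. norm (L0_rep x \<omega>) < 1" by auto
  note [measurable] = L0_rep_measurable[OF x(1)]
  show "\<exists>e. e \<in> borel_measurable P \<and> (AE \<omega> in P. 0 < e \<omega>) \<and>
       (\<forall>y\<in>carrier (L0 P). (AE \<omega> in P. norm (L0_rep y \<omega>) \<le> e \<omega>) \<longrightarrow>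
          x \<oplus>\<^bsub>L0 P\<^esub> y \<in> {z \<in> carrier (L0 P). AE \<omega> in P. norm (L0_rep z \<omega>) < 1})"
  proof (intro exI[of _ "\<lambda>\<omega>. (1 - norm (L0_rep x \<omega>)) / 2"] conjI ballI impI CollectI)
    show "(\<lambda>\<omega>. (1 - norm (L0_rep x \<omega>)) / 2) \<in> borel_measurable P" by measurable
    from x(2) show "AE \<omega> in P. 0 < (1 - norm (L0_rep x \<omega>)) / 2" by eventually_elim simp
    fix y :: "('w \<Rightarrow> 'k) set" assume y: "y \<in> carrier (L0 P)" "AE \<omega> in P. norm (L0_rep y \<omega>) \<le> (1 - norm (L0_rep x \<omega>)) / 2"
    show "x \<oplus>\<^bsub>L0 P\<^esub> y \<in> carrier (L0 P)" by (rule L0_closed(4)[OF x(1) y(1)])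
    from L0_rep_ops(1)[OF x(1) y(1)] x(2) y(2)
    show "AE \<omega> in P. norm (L0_rep (x \<oplus>\<^bsub>L0 P\<^esub> y) \<omega>) < 1"
    proof eventually_elim
      case (elim \<omega>)
      then show ?case using norm_triangle_ineq[of "L0_rep x \<omega>" "L0_rep y \<omega>"] by simp
    qed
  qed
qed auto

text \<open>Here the radius must be constant. The event \<open>|x| < 1\<close> is the increasing
  union of the events \<open>|x| < 1 - 1 / (n + 1)\<close>; one of them still has probability above
  \<open>1 - d\<close>, and on it \<open>1 / (n + 1)\<close> is a safe radius.\<close>

lemma L0_unit_ball_open_el:
  assumes P: "prob_space P"
  shows "openin (topology_el P (L0 P) {L0_abs P})
    {z \<in> carrier (L0 P :: (('w \<Rightarrow> 'k::{real_normed_field, second_countable_topology}) set, ('w \<Rightarrow> 'k) set) module).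
      1 - d < measure P {\<omega>\<in>space P. norm (L0_rep z \<omega>) < 1}}" (is "openin _ ?V")
  unfolding L0_open_el[OF P]
proof (intro conjI ballI)
  interpret prob_space P by (rule P)
  fix x assume "x \<in> ?V"
  then have x: "x \<in> carrier (L0 P)" "1 - d < prob {\<omega>\<in>space P. norm (L0_rep x \<omega>) < 1}" by auto
  note [measurable] = L0_rep_measurable[OF x(1)]
  define B where "B n = {\<omega>\<in>space P. norm (L0_rep x \<omega>) < 1 - 1 / real (Suc n)}" for n
  have B: "B n \<in> events" for n unfolding B_def by measurable
  have "(\<lambda>n. prob (B n)) \<longlonglongrightarrow> prob (\<Union>n. B n)"
  proof (rule finite_Lim_measure_incseq)
    show "incseq B"
    proof (rule incseq_SucI)
      fix n
      have "1 / real (Suc (Suc n)) \<le> 1 / real (Suc n)" by (intro divide_left_mono) auto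
      then show "B n \<le> B (Suc n)" unfolding B_def by (auto simp del: of_nat_Suc)
    qed
  qed (use B in auto)
  also have "(\<Union>n. B n) = {\<omega>\<in>space P. norm (L0_rep x \<omega>) < 1}"
  proof (intro equalityI subsetI)
    fix \<omega> assume *: "\<omega> \<in> {\<omega>\<in>space P. norm (L0_rep x \<omega>) < 1}"
    then obtain n where "1 / real (Suc n) < 1 - norm (L0_rep x \<omega>)"
      using nat_approx_posE[of "1 - norm (L0_rep x \<omega>)"] by auto
    with * show "\<omega> \<in> (\<Union>n. B n)" by (auto simp: B_def intro!: exI[of _ n])
  next
    fix \<omega> assume "\<omega> \<in> (\<Union>n. B n)"
    then obtain n where n: "\<omega> \<in> space P" "norm (L0_rep x \<omega>) < 1 - 1 / real (Suc n)" by (auto simp: B_def)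
    have "1 - 1 / real (Suc n) < 1" by simp
    with n(2) have "norm (L0_rep x \<omega>) < 1" by (rule order.strict_trans)
    with n(1) show "\<omega> \<in> {\<omega>\<in>space P. norm (L0_rep x \<omega>) < 1}" by simp
  qed
  finally have "\<forall>\<^sub>F n in sequentially. 1 - d < prob (B n)"
    using x(2) by (rule order_tendstoD)
  then obtain n where n: "1 - d < prob (B n)" by (auto simp: eventually_sequentially)
  \<comment> \<open>The surplus probability of \<open>B n\<close> is what may be lost to
    \<open>y\<close>; the cap keeps \<open>l\<close> below \<open>1\<close>.\<close>
  define l where "l = min (1 / 2) (prob (B n) - (1 - d))"
  show "\<exists>e l. 0 < e \<and> 0 < l \<and> l < 1 \<and>
       (\<forall>y\<in>carrier (L0 P). 1 - l < prob {\<omega>\<in>space P. norm (L0_rep y \<omega>) < e} \<longrightarrow> x \<oplus>\<^bsub>L0 P\<^esub> y \<in> ?V)"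
  proof (rule exI[of _ "1 / real (Suc n)"], rule exI[of _ l], intro conjI ballI impI CollectI)
    show "0 < l" "l < 1" using n by (auto simp: l_def)
    fix y :: "('w \<Rightarrow> 'k) set" assume y: "y \<in> carrier (L0 P)" "1 - l < prob {\<omega>\<in>space P. norm (L0_rep y \<omega>) < 1 / real (Suc n)}"
    show xy: "x \<oplus>\<^bsub>L0 P\<^esub> y \<in> carrier (L0 P)" by (rule L0_closed(4)[OF x(1) y(1)])
    note [measurable] = L0_rep_measurable[OF y(1)] L0_rep_measurable[OF xy]
    have "1 - ((1 - prob (B n)) + l) < prob {\<omega>\<in>space P. norm (L0_rep (x \<oplus>\<^bsub>L0 P\<^esub> y) \<omega>) < 1}"
    proof (rule prob_combine[OF B _ _ _ y(2)])
      show "AE \<omega> in P. \<omega> \<in> B n \<longrightarrow> \<omega> \<in> {\<omega>\<in>space P. norm (L0_rep y \<omega>) < 1 / real (Suc n)} \<longrightarrow>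
          \<omega> \<in> {\<omega>\<in>space P. norm (L0_rep (x \<oplus>\<^bsub>L0 P\<^esub> y) \<omega>) < 1}"
        using L0_rep_ops(1)[OF x(1) y(1)]
      proof eventually_elim
        case (elim \<omega>)
        then show ?case using norm_triangle_ineq[of "L0_rep x \<omega>" "L0_rep y \<omega>"] by (auto simp: B_def)
      qed
    qed auto
    then show "1 - d < prob {\<omega>\<in>space P. norm (L0_rep (x \<oplus>\<^bsub>L0 P\<^esub> y) \<omega>) < 1}"
      by (simp add: l_def min_def split: if_splits)
  qed auto
qed auto

section \<open>Continuity as domination\<close>

context L0_seminormed_module
begin

definition c_bounded :: "('a \<Rightarrow> ('w \<Rightarrow> 'k) set) \<Rightarrow> bool" where
  "c_bounded f \<longleftrightarrow> (\<exists>Q \<xi>. admissible Q \<and> \<xi> \<in> borel_measurable P \<and> (AE \<omega> in P. 0 \<le> \<xi> \<omega>) \<and>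
     (\<forall>x\<in>carrier E. AE \<omega> in P. norm (L0_rep (f x) \<omega>) \<le> \<xi> \<omega> * qn Q x \<omega>))"

text \<open>The partition is given by its index function \<open>K\<close>, which turns the
  dominating function into an instance of \<open>ae_seminorm_select\<close>. Constant multipliers
  \<open>c n\<close> suffice, since the pieces can be refined according to the size of a random
  multiplier.\<close>

definition el_bounded :: "('a \<Rightarrow> ('w \<Rightarrow> 'k) set) \<Rightarrow> bool" where
  "el_bounded f \<longleftrightarrow> (\<exists>Q c K. (\<forall>n::nat. admissible (Q n) \<and> 0 \<le> c n) \<and> K \<in> measurable P (count_space UNIV) \<and>
     (\<forall>x\<in>carrier E. AE \<omega> in P. norm (L0_rep (f x) \<omega>) \<le> c (K \<omega>) * qn (Q (K \<omega>)) x \<omega>))"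

text \<open>The preimage of the open unit ball contains a ball of random radius \<open>e\<close>
  around zero. Scaling by \<open>e\<close> bounds \<open>f\<close> by \<open>1 / e\<close> on the
  unit ball, with no exceptional event.\<close>

lemma cont_c_imp_bounded:
  assumes "cont_linear_c P E \<P> f"
  shows "c_bounded f"
proof -
  have f: "L0_linear P E f" and cont: "continuous_map (topology_c P E \<P>) (topology_c P (L0 P) {L0_abs P}) f"
    using assms by (auto simp: cont_linear_c_def)
  let ?V = "{z \<in> carrier (L0 P). AE \<omega> in P. norm (L0_rep z \<omega>) < 1}"
  have "openin (topology_c P E \<P>) {x \<in> topspace (topology_c P E \<P>). f x \<in> ?V}"
    by (rule openin_continuous_map_preimage[OF cont L0_unit_ball_open_c[OF prob_space_axioms]])
  moreover have "\<zero> \<in> {x \<in> topspace (topology_c P E \<P>). f x \<in> ?V}"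
    using L0_linear_rep(1)[OF f M.zero_closed] L0_rep_consts(1)[where 'k='k and P=P]
    by (auto simp: topspace_c L0_linear_zero[OF f] elim!: eventually_mono)
  ultimately obtain Q e where Q: "admissible Q" and e[measurable]: "e \<in> borel_measurable P"
    and pos: "AE \<omega> in P. 0 < e \<omega>"
    and V: "\<And>y. y \<in> carrier E \<Longrightarrow> AE \<omega> in P. qn Q y \<omega> \<le> e \<omega> \<Longrightarrow> \<zero> \<oplus> y \<in> {x \<in> topspace (topology_c P E \<P>). f x \<in> ?V}"
    unfolding open_c_iff by blast
  note N = qn_ae_seminorm[OF Q]
  have "AE \<omega> in P. \<omega> \<in> UNIV \<longrightarrow> norm (L0_rep (f x) \<omega>) \<le> 1 / e \<omega> * qn Q x \<omega>" if "x \<in> carrier E" for x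
  proof (rule bound_from_unit_ball[OF f N _ that])
    fix y assume y: "y \<in> carrier E" "AE \<omega> in P. qn Q y \<omega> \<le> 1"
    have m: "(\<lambda>\<omega>. of_real (e \<omega>) :: 'k) \<in> borel_measurable P" by measurable
    have "AE \<omega> in P. qn Q (rsc e y) \<omega> \<le> e \<omega>"
      using ae_seminormD(3)[OF N y(1) m] y(2) pos
      by eventually_elim (auto intro: mult_left_le)
    with V[of "rsc e y"] y m have "AE \<omega> in P. norm (L0_rep (f (rsc e y)) \<omega>) < 1" by simp
    with L0_linear_rep(4)[OF f y(1) m] pos
    show "AE \<omega> in P. \<omega> \<in> UNIV \<longrightarrow> norm (L0_rep (f y) \<omega>) \<le> 1 / e \<omega>"
      by eventually_elim (auto simp: norm_mult field_simps)
  qed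
  then show ?thesis
    unfolding c_bounded_def using Q pos
    by (intro exI[of _ Q] exI[of _ "\<lambda>\<omega>. 1 / e \<omega>"]) (auto elim!: eventually_mono)
qed

lemma bounded_imp_cont_c:
  assumes f: "L0_linear P E f" and b: "c_bounded f"
  shows "cont_linear_c P E \<P> f"
  unfolding cont_linear_c_def continuous_map_def topspace_c
    L0_seminormed_module.topspace_c[OF L0_self_seminormed[OF prob_space_axioms]]
proof (intro conjI allI impI f)
  show "f \<in> carrier E \<rightarrow> carrier (L0 P)" using L0_linear_rep(1)[OF f] by blast
  obtain Q \<xi> where Q: "admissible Q" and \<xi>[measurable]: "\<xi> \<in> borel_measurable P" and \<xi>0: "AE \<omega> in P. 0 \<le> \<xi> \<omega>"
    and le: "\<And>x. x \<in> carrier E \<Longrightarrow> AE \<omega> in P. norm (L0_rep (f x) \<omega>) \<le> \<xi> \<omega> * qn Q x \<omega>"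
    using b unfolding c_bounded_def by blast
  fix U :: "('w \<Rightarrow> 'k) set set"
  assume "openin (topology_c P (L0 P) {L0_abs P}) U"
  note U = this[unfolded L0_open_c[OF prob_space_axioms]]
  show "openin (topology_c P E \<P>) {x \<in> carrier E. f x \<in> U}"
    unfolding open_c_iff
  proof (intro conjI ballI)
    fix x assume "x \<in> {x \<in> carrier E. f x \<in> U}"
    then have x: "x \<in> carrier E" "f x \<in> U" by auto
    from U x(2) obtain e where e[measurable]: "e \<in> borel_measurable P" and pos: "AE \<omega> in P. 0 < e \<omega>"
      and eU: "\<And>y. y \<in> carrier (L0 P) \<Longrightarrow> AE \<omega> in P. norm (L0_rep y \<omega>) \<le> e \<omega> \<Longrightarrow> f x \<oplus>\<^bsub>L0 P\<^esub> y \<in> U" by blast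
    show "\<exists>Q e. admissible Q \<and> e \<in> borel_measurable P \<and> (AE \<omega> in P. 0 < e \<omega>) \<and>
       (\<forall>y\<in>carrier E. (AE \<omega> in P. qn Q y \<omega> \<le> e \<omega>) \<longrightarrow> x \<oplus> y \<in> {x \<in> carrier E. f x \<in> U})"
    \<comment> \<open>Adding \<open>1\<close> avoids division by zero where the multiplier \<xi>
      vanishes.\<close>
    proof (intro exI[of _ Q] exI[of _ "\<lambda>\<omega>. e \<omega> / (\<xi> \<omega> + 1)"] conjI ballI impI Q CollectI)
      show "(\<lambda>\<omega>. e \<omega> / (\<xi> \<omega> + 1)) \<in> borel_measurable P" by measurable
      from pos \<xi>0 show "AE \<omega> in P. 0 < e \<omega> / (\<xi> \<omega> + 1)" by eventually_elim simp
      fix y assume y: "y \<in> carrier E" "AE \<omega> in P. qn Q y \<omega> \<le> e \<omega> / (\<xi> \<omega> + 1)"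
      show "x \<oplus> y \<in> carrier E" using x y by simp
      have "AE \<omega> in P. norm (L0_rep (f y) \<omega>) \<le> e \<omega>"
        using le[OF y(1)] y(2) pos \<xi>0
      proof eventually_elim
        case (elim \<omega>)
        have "\<xi> \<omega> * qn Q y \<omega> \<le> \<xi> \<omega> * (e \<omega> / (\<xi> \<omega> + 1))" using elim by (intro mult_left_mono) auto
        also have "\<dots> \<le> e \<omega>" using elim by (simp add: field_simps)
        finally show ?case using elim by simp
      qed
      from eU[OF L0_linear_rep(1)[OF f y(1)] this] show "f (x \<oplus> y) \<in> U"
        using f x y by (simp add: L0_linear_def)
    qed
  qed auto
qed

text \<open>Two vectors are glued along the event where the first one reaches the level
  \<open>a\<close>. At each point only one of them is present, so the result stays in the unit ball
  and reaches \<open>a\<close> wherever either did.\<close>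

lemma level_sets_directed:
  assumes f: "L0_linear P E f" and Q: "admissible Q" and F: "finite F" "F \<noteq> {}"
    and sub: "\<And>x. x \<in> F \<Longrightarrow> x \<in> carrier E \<and> (AE \<omega> in P. qn Q x \<omega> \<le> 1)"
  shows "\<exists>w\<in>carrier E. (AE \<omega> in P. qn Q w \<omega> \<le> 1) \<and>
    (AE \<omega> in P. \<forall>x\<in>F. a \<le> norm (L0_rep (f x) \<omega>) \<longrightarrow> a \<le> norm (L0_rep (f w) \<omega>))"
  using F sub
proof (induction F rule: finite_ne_induct)
  case (singleton x)
  then show ?case by (intro bexI[of _ x]) auto
next
  case (insert x F)
  then obtain y where y: "y \<in> carrier E" "AE \<omega> in P. qn Q y \<omega> \<le> 1"
    "AE \<omega> in P. \<forall>x\<in>F. a \<le> norm (L0_rep (f x) \<omega>) \<longrightarrow> a \<le> norm (L0_rep (f y) \<omega>)" by auto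
  have x: "x \<in> carrier E" "AE \<omega> in P. qn Q x \<omega> \<le> 1" using insert.prems by auto
  note [measurable] = L0_linear_rep(2)[OF f x(1)]
  let ?A = "\<lambda>\<omega>. if a \<le> norm (L0_rep (f x) \<omega>) then 1 else 0 :: 'k"
  let ?B = "\<lambda>\<omega>. if a \<le> norm (L0_rep (f x) \<omega>) then 0 else 1 :: 'k"
  have m: "?A \<in> borel_measurable P" "?B \<in> borel_measurable P" by measurable
  let ?w = "sc ?A x \<oplus> sc ?B y"
  note N = qn_ae_seminorm[OF Q]
  note c = sc_closed[OF m(1) x(1)] sc_closed[OF m(2) y(1)]
  show ?case
  proof (intro bexI[of _ ?w] conjI)
    show "?w \<in> carrier E" using c by simp
    show "AE \<omega> in P. qn Q ?w \<omega> \<le> 1"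
      using ae_seminormD(4)[OF N c] ae_seminormD(3)[OF N x(1) m(1)] ae_seminormD(3)[OF N y(1) m(2)] x(2) y(2)
    proof eventually_elim
      case (elim \<omega>)
      then show ?case by (auto split: if_splits)
    qed
    show "AE \<omega> in P. \<forall>z\<in>insert x F. a \<le> norm (L0_rep (f z) \<omega>) \<longrightarrow> a \<le> norm (L0_rep (f ?w) \<omega>)"
      using L0_linear_rep(3)[OF f c] L0_linear_rep(4)[OF f x(1) m(1)] L0_linear_rep(4)[OF f y(1) m(2)] y(3)
    proof eventually_elim
      case (elim \<omega>)
      then show ?case by (auto split: if_splits)
    qed
  qed
qed

text \<open>
  The level sets \<open>{\<bar>f x\<bar> \<ge> a}\<close> over the unit ball are directed, so a bound on the probability of
  each of them bounds the probability of their essential union.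
\<close>

lemma uniform_level_set:
  assumes f: "L0_linear P E f" and Q: "admissible Q"
    and small: "\<And>x. x \<in> carrier E \<Longrightarrow> AE \<omega> in P. qn Q x \<omega> \<le> 1 \<Longrightarrow>
      prob {\<omega>\<in>space P. a \<le> norm (L0_rep (f x) \<omega>)} \<le> d"
  shows "\<exists>A\<in>events. 1 - d \<le> prob A \<and>
    (\<forall>x\<in>carrier E. AE \<omega> in P. \<omega> \<in> A \<longrightarrow> norm (L0_rep (f x) \<omega>) \<le> a * qn Q x \<omega>)"
proof -
  define B where "B x = {\<omega>\<in>space P. a \<le> norm (L0_rep (f x) \<omega>)}" for x
  define S where "S = {x \<in> carrier E. AE \<omega> in P. qn Q x \<omega> \<le> 1}"
  have B: "B x \<in> events" if "x \<in> S" for x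
  proof -
    have "x \<in> carrier E" using that by (simp add: S_def)
    note [measurable] = L0_linear_rep(2)[OF f this]
    show ?thesis unfolding B_def by measurable
  qed
  obtain C where C: "countable C" "C \<subseteq> S"
    and cov: "\<And>x. x \<in> S \<Longrightarrow> AE \<omega> in P. \<omega> \<in> B x \<longrightarrow> (\<exists>t\<in>C. \<omega> \<in> B t)"
    using exhaustion[of S B] B by blast
  have zS: "\<zero> \<in> S"
    using ae_seminorm_zero[OF qn_ae_seminorm[OF Q]] by (auto simp: S_def elim!: eventually_mono)
  \<comment> \<open>The null vector makes the enumerated set nonempty when \<open>C\<close> is
    empty; it lies in the unit ball, so the estimates for members of \<open>S\<close> apply to
    it.\<close>
  define u where "u = from_nat_into (insert \<zero> C)"
  have u: "u n \<in> S" for n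
  proof -
    have "u n \<in> insert \<zero> C" unfolding u_def by (rule from_nat_into) simp
    with C(2) zS show ?thesis by auto
  qed
  have ran: "range u = insert \<zero> C" unfolding u_def using C(1) by (intro range_from_nat_into) auto
  have fin: "prob (\<Union>i\<in>{..n}. B (u i)) \<le> d" for n
  proof -
    obtain w where w: "w \<in> carrier E" "AE \<omega> in P. qn Q w \<omega> \<le> 1"
      "AE \<omega> in P. \<forall>x\<in>u ` {..n}. a \<le> norm (L0_rep (f x) \<omega>) \<longrightarrow> a \<le> norm (L0_rep (f w) \<omega>)"
      using level_sets_directed[OF f Q, of "u ` {..n}" a] u by (auto simp: S_def)
    have "prob (\<Union>i\<in>{..n}. B (u i)) \<le> prob (B w)"
    proof (rule finite_measure_mono_AE)
      from w(3) show "AE \<omega> in P. \<omega> \<in> (\<Union>i\<in>{..n}. B (u i)) \<longrightarrow> \<omega> \<in> B w"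
        by eventually_elim (auto simp: B_def)
      show "B w \<in> events" using w by (intro B) (simp add: S_def)
    qed
    also have "\<dots> \<le> d" unfolding B_def by (rule small[OF w(1,2)])
    finally show ?thesis .
  qed
  have "(\<lambda>n. prob (\<Union>i\<in>{..n}. B (u i))) \<longlonglongrightarrow> prob (\<Union>n. \<Union>i\<in>{..n}. B (u i))"
  proof (rule finite_Lim_measure_incseq)
    show "incseq (\<lambda>n. \<Union>i\<in>{..n}. B (u i))"
      unfolding incseq_def by (intro allI impI UN_mono) auto
  qed (use B u in \<open>auto intro!: sets.finite_UN\<close>)
  then have "prob (\<Union>n. \<Union>i\<in>{..n}. B (u i)) \<le> d"
    by (rule LIMSEQ_le_const2) (use fin in auto)
  moreover define D where "D = (\<Union>n. B (u n))"
  moreover have "(\<Union>n. \<Union>i\<in>{..n}. B (u i)) = D" by (auto simp: D_def)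
  ultimately have Dd: "prob D \<le> d" by simp
  have D: "D \<in> events" unfolding D_def using B u by (intro sets.countable_UN) auto
  \<comment> \<open>Off \<open>D\<close> no vector of the unit ball reaches the level
    \<open>a\<close>, up to its own null set. This is the local bound that
    \<open>bound_from_unit_ball\<close> extends to all vectors.\<close>
  show ?thesis
  proof (intro bexI[of _ "space P - D"] conjI ballI)
    show "1 - d \<le> prob (space P - D)" using Dd prob_compl[OF D] by simp
    fix x assume x: "x \<in> carrier E"
    show "AE \<omega> in P. \<omega> \<in> space P - D \<longrightarrow> norm (L0_rep (f x) \<omega>) \<le> a * qn Q x \<omega>"
    proof (rule bound_from_unit_ball[OF f qn_ae_seminorm[OF Q] _ x])
      fix y assume "y \<in> carrier E" "AE \<omega> in P. qn Q y \<omega> \<le> 1"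
      then have "y \<in> S" by (simp add: S_def)
      from cov[OF this] show "AE \<omega> in P. \<omega> \<in> space P - D \<longrightarrow> norm (L0_rep (f y) \<omega>) \<le> a"
      proof eventually_elim
        case (elim \<omega>)
        show ?case
        proof
          assume *: "\<omega> \<in> space P - D"
          have "\<omega> \<notin> B t" if "t \<in> C" for t
            using * that ran unfolding D_def by (metis DiffD2 UN_I UNIV_I imageE insertCI)
          with elim have "\<omega> \<notin> B y" by blast
          with * show "norm (L0_rep (f y) \<omega>) \<le> a" by (auto simp: B_def)
        qed
      qed
    qed
  qed (use D in auto)
qed

text \<open>Continuity at zero with tolerance \<open>1 / (n + 1)\<close> makes a level set over some
  unit ball uniformly improbable, hence gives an event \<open>A n\<close> of probability at least
  \<open>1 - 1 / (n + 1)\<close> on which one constant multiple of one \<open>qn (Q n)\<close>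
  dominates \<open>f\<close>. These events cover almost everything.\<close>

lemma cont_el_imp_bounded:
  assumes "cont_linear_el P E \<P> f"
  shows "el_bounded f"
proof -
  have f: "L0_linear P E f" and cont: "continuous_map (topology_el P E \<P>) (topology_el P (L0 P) {L0_abs P}) f"
    using assms by (auto simp: cont_linear_el_def)
  define good where "good n Q c A \<longleftrightarrow> admissible Q \<and> 0 \<le> c \<and> A \<in> events \<and> 1 - 1 / real (Suc n) \<le> prob A \<and>
      (\<forall>x\<in>carrier E. AE \<omega> in P. \<omega> \<in> A \<longrightarrow> norm (L0_rep (f x) \<omega>) \<le> c * qn Q x \<omega>)"
    for n :: nat and Q and c :: real and A
  have "\<exists>Q c A. good n Q c A" for n
  proof -
    define d where "d = 1 / real (Suc n)"
    have d: "0 < d" by (simp add: d_def)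
    let ?V = "{z \<in> carrier (L0 P). 1 - d < prob {\<omega>\<in>space P. norm (L0_rep z \<omega>) < 1}}"
    have "openin (topology_el P E \<P>) {x \<in> topspace (topology_el P E \<P>). f x \<in> ?V}"
      by (rule openin_continuous_map_preimage[OF cont L0_unit_ball_open_el[OF prob_space_axioms]])
    moreover have "\<zero> \<in> {x \<in> topspace (topology_el P E \<P>). f x \<in> ?V}"
    proof -
      note zc = L0_linear_rep(1)[OF f M.zero_closed]
      note [measurable] = L0_linear_rep(2)[OF f M.zero_closed]
      have "prob {\<omega>\<in>space P. norm (L0_rep (f \<zero>) \<omega>) < 1} = 1"
        using L0_rep_consts(1)[where 'k='k and P=P] unfolding L0_linear_zero[OF f, symmetric]
        by (intro prob_Collect_eq_1[THEN iffD2]) (auto elim!: eventually_mono)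
      with zc d show ?thesis by (simp add: topspace_el)
    qed
    ultimately obtain Q e l where Q: "admissible Q" and el: "0 < e" "0 < l" "l < 1"
      and V: "\<And>y. y \<in> carrier E \<Longrightarrow> 1 - l < prob {\<omega>\<in>space P. qn Q y \<omega> < e} \<Longrightarrow>
        \<zero> \<oplus> y \<in> {x \<in> topspace (topology_el P E \<P>). f x \<in> ?V}"
      unfolding open_el_iff by blast
    note N = qn_ae_seminorm[OF Q]
    \<comment> \<open>Scaling by \<open>e / 2\<close> moves the unit ball strictly inside radius
      \<open>e\<close>, as the strict inequality in the neighbourhood demands, and turns the level
      \<open>2 / e\<close> into \<open>1\<close>.\<close>
    have "prob {\<omega>\<in>space P. 2 / e \<le> norm (L0_rep (f x) \<omega>)} \<le> d"
      if x: "x \<in> carrier E" "AE \<omega> in P. qn Q x \<omega> \<le> 1" for x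
    proof -
      define y where "y = sc (\<lambda>_. of_real (e / 2)) x"
      have m: "(\<lambda>_. of_real (e / 2) :: 'k) \<in> borel_measurable P" by simp
      have y: "y \<in> carrier E" unfolding y_def by (rule sc_closed[OF m x(1)])
      note [measurable] = L0_linear_rep(2)[OF f y] L0_linear_rep(2)[OF f x(1)] ae_seminormD(1)[OF N y]
      have "AE \<omega> in P. qn Q y \<omega> < e"
        using ae_seminormD(3)[OF N x(1) m] x(2) unfolding y_def[symmetric]
      proof eventually_elim
        case (elim \<omega>)
        have "e / 2 * qn Q x \<omega> \<le> e / 2 * 1" using elim el by (intro mult_left_mono) auto
        then show ?case using elim(1) el by (simp del: times_divide_eq_left)
      qed
      then have "prob {\<omega>\<in>space P. qn Q y \<omega> < e} = 1"
        by (intro prob_Collect_eq_1[THEN iffD2]) auto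
      with V[OF y] el y have "1 - d < prob {\<omega>\<in>space P. norm (L0_rep (f y) \<omega>) < 1}" by simp
      moreover have "prob {\<omega>\<in>space P. 2 / e \<le> norm (L0_rep (f x) \<omega>)} \<le>
          prob (space P - {\<omega>\<in>space P. norm (L0_rep (f y) \<omega>) < 1})"
      proof (rule finite_measure_mono_AE)
        show "AE \<omega> in P. \<omega> \<in> {\<omega>\<in>space P. 2 / e \<le> norm (L0_rep (f x) \<omega>)} \<longrightarrow>
            \<omega> \<in> space P - {\<omega>\<in>space P. norm (L0_rep (f y) \<omega>) < 1}"
          using L0_linear_rep(4)[OF f x(1) m] unfolding y_def[symmetric]
        proof eventually_elim
          case (elim \<omega>)
          have "norm (L0_rep (f y) \<omega>) = e / 2 * norm (L0_rep (f x) \<omega>)"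
            unfolding elim norm_mult norm_of_real using el by simp
          then show ?case using el by (auto simp: field_simps)
        qed
      qed measurable
      moreover have "prob (space P - {\<omega>\<in>space P. norm (L0_rep (f y) \<omega>) < 1}) =
          1 - prob {\<omega>\<in>space P. norm (L0_rep (f y) \<omega>) < 1}"
        by (rule prob_compl) measurable
      ultimately show ?thesis by linarith
    qed
    from uniform_level_set[OF f Q this] obtain A where "A \<in> events" "1 - d \<le> prob A"
      "\<forall>x\<in>carrier E. AE \<omega> in P. \<omega> \<in> A \<longrightarrow> norm (L0_rep (f x) \<omega>) \<le> 2 / e * qn Q x \<omega>" by blast
    then have "good n Q (2 / e) A" using Q el unfolding good_def d_def by auto
    then show ?thesis by blast
  qed
  then obtain Q c A where "\<And>n. good n (Q n) (c n) (A n)" by metis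
  then have Q: "admissible (Q n)" and c: "0 \<le> c n" and A[measurable]: "A n \<in> events"
    and pA: "1 - 1 / real (Suc n) \<le> prob (A n)"
    and le: "x \<in> carrier E \<Longrightarrow> AE \<omega> in P. \<omega> \<in> A n \<longrightarrow> norm (L0_rep (f x) \<omega>) \<le> c n * qn (Q n) x \<omega>" for n x
    unfolding good_def by auto
  \<comment> \<open>The first index makes the cover disjoint. Its value outside all
    \<open>A n\<close> is irrelevant, since that event is null.\<close>
  define K where "K \<omega> = (LEAST n. \<omega> \<in> A n)" for \<omega>
  have K: "K \<in> measurable P (count_space UNIV)" unfolding K_def by measurable
  have "1 \<le> prob (\<Union>n. A n) + 1 * (1 / real (Suc n))" for n
  proof -
    have "prob (A n) \<le> prob (\<Union>n. A n)" by (rule finite_measure_mono) (use A in auto)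
    with pA[of n] show ?thesis by simp
  qed
  then have "1 \<le> prob (\<Union>n. A n)" by (rule le_all_inverse_Suc)
  then have "prob (\<Union>n. A n) = 1" using prob_le_1[of "\<Union>n. A n"] by linarith
  then have un: "AE \<omega> in P. \<omega> \<in> (\<Union>n. A n)" using A by (intro prob_eq_1[THEN iffD1]) auto
  show ?thesis
    unfolding el_bounded_def
  proof (intro exI[of _ Q] exI[of _ c] exI[of _ K] conjI allI ballI Q c K)
    fix x assume x: "x \<in> carrier E"
    have "AE \<omega> in P. \<forall>n. \<omega> \<in> A n \<longrightarrow> norm (L0_rep (f x) \<omega>) \<le> c n * qn (Q n) x \<omega>"
      using le[OF x] by (intro AE_all_countable[THEN iffD2] allI)
    with un show "AE \<omega> in P. norm (L0_rep (f x) \<omega>) \<le> c (K \<omega>) * qn (Q (K \<omega>)) x \<omega>"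
    proof eventually_elim
      case (elim \<omega>)
      then have "\<omega> \<in> A (K \<omega>)" unfolding K_def by (auto intro: LeastI)
      with elim show ?case by blast
    qed
  qed
qed

lemma prob_le_nat_ex:
  assumes K: "K \<in> measurable P (count_space (UNIV :: nat set))" and "0 < (d::real)"
  shows "\<exists>n. {\<omega>\<in>space P. K \<omega> \<le> n} \<in> events \<and> 1 - d < prob {\<omega>\<in>space P. K \<omega> \<le> n}"
proof -
  note [measurable] = K
  have ev: "{\<omega>\<in>space P. K \<omega> \<le> n} \<in> events" for n by measurable
  have "(\<lambda>n. prob {\<omega>\<in>space P. K \<omega> \<le> n}) \<longlonglongrightarrow> prob (\<Union>n. {\<omega>\<in>space P. K \<omega> \<le> n})"
    by (rule finite_Lim_measure_incseq) (use ev in \<open>auto simp: incseq_def\<close>)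
  also have "(\<Union>n. {\<omega>\<in>space P. K \<omega> \<le> n}) = space P" by auto
  finally have "\<forall>\<^sub>F n in sequentially. 1 - d < prob {\<omega>\<in>space P. K \<omega> \<le> n}"
    by (rule order_tendstoD) (use \<open>0 < d\<close> prob_space in simp)
  with ev show ?thesis by (auto simp: eventually_sequentially)
qed

text \<open>Half of the tolerance \<open>d\<close> is spent on discarding all but finitely many
  pieces of the partition, the other half on the neighbourhood of the remaining finite
  family.\<close>

lemma bounded_imp_cont_el:
  assumes f: "L0_linear P E f" and b: "el_bounded f"
  shows "cont_linear_el P E \<P> f"
  unfolding cont_linear_el_def continuous_map_def topspace_el
    L0_seminormed_module.topspace_el[OF L0_self_seminormed[OF prob_space_axioms]]
proof (intro conjI allI impI f)
  show "f \<in> carrier E \<rightarrow> carrier (L0 P)" using L0_linear_rep(1)[OF f] by blast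
  obtain Q c K where Q: "\<And>n::nat. admissible (Q n)" and c: "\<And>n. 0 \<le> c n"
    and K: "K \<in> measurable P (count_space UNIV)"
    and le: "\<And>x. x \<in> carrier E \<Longrightarrow> AE \<omega> in P. norm (L0_rep (f x) \<omega>) \<le> c (K \<omega>) * qn (Q (K \<omega>)) x \<omega>"
    using b unfolding el_bounded_def by blast
  fix U :: "('w \<Rightarrow> 'k) set set"
  assume "openin (topology_el P (L0 P) {L0_abs P}) U"
  note U = this[unfolded L0_open_el[OF prob_space_axioms]]
  show "openin (topology_el P E \<P>) {x \<in> carrier E. f x \<in> U}"
    unfolding open_el_iff
  proof (intro conjI ballI)
    fix x assume "x \<in> {x \<in> carrier E. f x \<in> U}"
    then have x: "x \<in> carrier E" "f x \<in> U" by auto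
    from U x(2) obtain e d where e: "0 < e" "0 < d" "d < 1"
      and eU: "\<And>y. y \<in> carrier (L0 P) \<Longrightarrow> 1 - d < prob {\<omega>\<in>space P. norm (L0_rep y \<omega>) < e} \<Longrightarrow> f x \<oplus>\<^bsub>L0 P\<^esub> y \<in> U"
      by blast
    have "0 < d / 2" using e by simp
    from prob_le_nat_ex[OF K this] obtain n where
      n: "{\<omega>\<in>space P. K \<omega> \<le> n} \<in> events" "1 - d / 2 < prob {\<omega>\<in>space P. K \<omega> \<le> n}" by blast
    \<comment> \<open>One finite family and one constant serve all pieces up to \<open>n\<close>;
      the summand \<open>1\<close> in \<open>s\<close> makes it positive.\<close>
    define R where "R = (\<Union>k\<in>{..n}. Q k)"
    define s where "s = (\<Sum>k\<le>n. c k) + 1"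
    have s: "1 \<le> s" unfolding s_def using c by (simp add: sum_nonneg)
    have R: "admissible R" using Q unfolding admissible_def R_def by auto
    show "\<exists>Q e d. admissible Q \<and> 0 < e \<and> 0 < d \<and> d < 1 \<and>
       (\<forall>y\<in>carrier E. 1 - d < prob {\<omega>\<in>space P. qn Q y \<omega> < e} \<longrightarrow> x \<oplus> y \<in> {x \<in> carrier E. f x \<in> U})"
    proof (rule exI[of _ R], rule exI[of _ "e / s"], rule exI[of _ "d / 2"], intro conjI ballI impI R CollectI)
      fix y assume y: "y \<in> carrier E" "1 - d / 2 < prob {\<omega>\<in>space P. qn R y \<omega> < e / s}"
      show "x \<oplus> y \<in> carrier E" using x y by simp
      note N = qn_ae_seminorm[OF R]
      note [measurable] = ae_seminormD(1)[OF N y(1)] L0_linear_rep(2)[OF f y(1)]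
      have mono: "AE \<omega> in P. \<forall>k\<in>{..n}. qn (Q k) y \<omega> \<le> qn R y \<omega>"
        by (intro AE_finite_allI qn_mono[OF R _ _ y(1)]) (use Q in \<open>auto simp: admissible_def R_def\<close>)
      have "1 - (d / 2 + d / 2) < prob {\<omega>\<in>space P. norm (L0_rep (f y) \<omega>) < e}"
      proof (rule prob_combine[OF n(1) _ _ less_imp_le[OF n(2)] y(2)])
        show "AE \<omega> in P. \<omega> \<in> {\<omega>\<in>space P. K \<omega> \<le> n} \<longrightarrow> \<omega> \<in> {\<omega>\<in>space P. qn R y \<omega> < e / s} \<longrightarrow>
            \<omega> \<in> {\<omega>\<in>space P. norm (L0_rep (f y) \<omega>) < e}"
          using le[OF y(1)] mono ae_seminormD(2)[OF N y(1)]
        proof eventually_elim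
          case (elim \<omega>)
          have "norm (L0_rep (f y) \<omega>) < e" if *: "K \<omega> \<le> n" "qn R y \<omega> < e / s"
          proof -
            have cK: "c (K \<omega>) \<le> (\<Sum>k\<le>n. c k)" using * c by (intro member_le_sum) auto
            have "c (K \<omega>) * qn (Q (K \<omega>)) y \<omega> \<le> c (K \<omega>) * qn R y \<omega>"
              using elim * c[of "K \<omega>"] by (intro mult_left_mono) auto
            also have "\<dots> \<le> s * qn R y \<omega>"
              using elim cK by (intro mult_right_mono) (auto simp: s_def)
            also have "\<dots> < e" using * s by (simp add: pos_less_divide_eq mult.commute)
            finally show ?thesis using elim by simp
          qed
          then show ?case by simp
        qed
      qed measurable
      then have "1 - d < prob {\<omega>\<in>space P. norm (L0_rep (f y) \<omega>) < e}" by simp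
      from eU[OF L0_linear_rep(1)[OF f y(1)] this] show "f (x \<oplus> y) \<in> U"
        using f x y by (simp add: L0_linear_def)
    qed (use e s in auto)
  qed auto
qed

text \<open>Rounding the random multiplier up to an integer splits the space into countably many
  pieces on which it is constant.\<close>

lemma c_bounded_imp_el_bounded:
  assumes "c_bounded f"
  shows "el_bounded f"
proof -
  obtain Q \<xi> where Q: "admissible Q" and [measurable]: "\<xi> \<in> borel_measurable P"
    and le: "\<And>x. x \<in> carrier E \<Longrightarrow> AE \<omega> in P. norm (L0_rep (f x) \<omega>) \<le> \<xi> \<omega> * qn Q x \<omega>"
    using assms unfolding c_bounded_def by blast
  show ?thesis
    unfolding el_bounded_def
  proof (intro exI[of _ "\<lambda>_. Q"] exI[of _ real] exI[of _ "\<lambda>\<omega>. nat \<lceil>\<xi> \<omega>\<rceil>"] conjI allI ballI Q)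
    show "(\<lambda>\<omega>. nat \<lceil>\<xi> \<omega>\<rceil>) \<in> measurable P (count_space UNIV)" by measurable
    fix x assume x: "x \<in> carrier E"
    from le[OF x] ae_seminormD(2)[OF qn_ae_seminorm[OF Q] x]
    show "AE \<omega> in P. norm (L0_rep (f x) \<omega>) \<le> real (nat \<lceil>\<xi> \<omega>\<rceil>) * qn Q x \<omega>"
    proof eventually_elim
      case (elim \<omega>)
      have "\<xi> \<omega> * qn Q x \<omega> \<le> real (nat \<lceil>\<xi> \<omega>\<rceil>) * qn Q x \<omega>"
        using elim by (intro mult_right_mono) (auto simp: real_nat_ceiling_ge)
      with elim show ?case by simp
    qed
  qed simp
qed

end

section \<open>Dual norms and the extension theorem\<close>

context L0_seminormed_module
begin

lemma submodule_seminormed: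
  assumes H: "submodule H (L0 P) E"
  shows "L0_seminormed_module P (E\<lparr>carrier := H\<rparr>) \<P>"
proof (intro L0_seminormed_module.intro L0_seminormed_module_axioms.intro submodule_L0_module[OF H] nonempty)
  fix p assume "p \<in> \<P>"
  note p = seminorms[OF this, unfolded L0_seminorm_def]
  note HE = subsetD[OF submoduleE(1)[OF H]]
  show "L0_seminorm P (E\<lparr>carrier := H\<rparr>) p"
    unfolding L0_seminorm_def
  proof (intro conjI ballI Pi_I)
    fix x assume "x \<in> carrier (E\<lparr>carrier := H\<rparr>)"
    then have x: "x \<in> carrier E" using HE by simp
    show "p x \<in> L0_plus P" using p x by blast
    show "p (\<xi> \<odot>\<^bsub>E\<lparr>carrier := H\<rparr>\<^esub> x) = L0_abs P \<xi> \<otimes>\<^bsub>L0 P\<^esub> p x"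
      if "\<xi> \<in> carrier (L0 P)" for \<xi>
      using p x that by simp
    fix y assume "y \<in> carrier (E\<lparr>carrier := H\<rparr>)"
    then have "y \<in> carrier E" using HE by simp
    then show "p (x \<oplus>\<^bsub>E\<lparr>carrier := H\<rparr>\<^esub> y) \<sqsubseteq>\<^bsub>L0_order P\<^esub> p x \<oplus>\<^bsub>L0 P\<^esub> p y"
      using p x by simp
  qed
qed

lemma extend_dominated:
  assumes ext: extension_property and N: "ae_seminorm N" and H: "submodule H (L0 P) E"
    and f: "L0_linear P (E\<lparr>carrier := H\<rparr>) f"
    and le: "\<forall>x\<in>H. AE \<omega> in P. norm (L0_rep (f x) \<omega>) \<le> N x \<omega>"
  shows "\<exists>g. L0_linear P E g \<and> (\<forall>x\<in>H. g x = f x) \<and>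
    (\<forall>x\<in>carrier E. AE \<omega> in P. norm (L0_rep (g x) \<omega>) \<le> N x \<omega>)"
  by (rule ext[unfolded extension_property_def, THEN spec, THEN spec, THEN spec,
        THEN mp, OF N, THEN mp, OF H, THEN mp, OF f, THEN mp, OF le])

text \<open>The dominating function found on \<open>H\<close> is built from seminorms given on all
  of \<open>E\<close>, so it is at once a seminorm on \<open>E\<close>, and the bound it gives for
  the extension is again continuity.\<close>

lemma extend_cont_c:
  assumes ext: extension_property and H: "submodule H (L0 P) E"
    and f: "cont_linear_c P (E\<lparr>carrier := H\<rparr>) \<P> f"
  shows "\<exists>g. cont_linear_c P E \<P> g \<and> (\<forall>x\<in>H. g x = f x)"
proof -
  interpret sub: L0_seminormed_module P "E\<lparr>carrier := H\<rparr>" \<P> by (rule submodule_seminormed[OF H])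
  have fl: "L0_linear P (E\<lparr>carrier := H\<rparr>) f" using f by (simp add: cont_linear_c_def)
  obtain Q \<xi> where Q: "admissible Q" and \<xi>: "\<xi> \<in> borel_measurable P" "AE \<omega> in P. 0 \<le> \<xi> \<omega>"
    and le: "\<forall>x\<in>H. AE \<omega> in P. norm (L0_rep (f x) \<omega>) \<le> \<xi> \<omega> * qn Q x \<omega>"
    using sub.cont_c_imp_bounded[OF f, unfolded sub.c_bounded_def] by (elim exE conjE) simp
  from extend_dominated[OF ext ae_seminorm_scale[OF qn_ae_seminorm[OF Q] \<xi>] H fl le]
  obtain g where g: "L0_linear P E g" "\<forall>x\<in>H. g x = f x"
    "\<forall>x\<in>carrier E. AE \<omega> in P. norm (L0_rep (g x) \<omega>) \<le> \<xi> \<omega> * qn Q x \<omega>"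
    by (elim exE conjE)
  then have "c_bounded g" unfolding c_bounded_def using Q \<xi> by blast
  with g bounded_imp_cont_c show ?thesis by blast
qed

text \<open>The same transfer from \<open>H\<close> to \<open>E\<close> with a concatenated
  seminorm: \<open>Q\<close>, \<open>c\<close> and \<open>K\<close> found for \<open>f\<close> on
  \<open>H\<close> are reused unchanged for \<open>g\<close>.\<close>

lemma extend_cont_el:
  assumes ext: extension_property and H: "submodule H (L0 P) E"
    and f: "cont_linear_el P (E\<lparr>carrier := H\<rparr>) \<P> f"
  shows "\<exists>g. cont_linear_el P E \<P> g \<and> (\<forall>x\<in>H. g x = f x)"
proof -
  interpret sub: L0_seminormed_module P "E\<lparr>carrier := H\<rparr>" \<P> by (rule submodule_seminormed[OF H])
  have fl: "L0_linear P (E\<lparr>carrier := H\<rparr>) f" using f by (simp add: cont_linear_el_def)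
  obtain Q c K where Qc: "\<forall>n::nat. admissible (Q n) \<and> 0 \<le> c n"
    and K: "K \<in> measurable P (count_space UNIV)"
    and le: "\<forall>x\<in>H. AE \<omega> in P. norm (L0_rep (f x) \<omega>) \<le> c (K \<omega>) * qn (Q (K \<omega>)) x \<omega>"
    using sub.cont_el_imp_bounded[OF f, unfolded sub.el_bounded_def] by (elim exE conjE) simp
  then have Q: "admissible (Q n)" and c: "0 \<le> c n" for n by simp_all
  have "ae_seminorm (\<lambda>x \<omega>. c n * qn (Q n) x \<omega>)" for n
    using c by (intro ae_seminorm_scale[OF qn_ae_seminorm[OF Q]]) auto
  note N = ae_seminorm_select[of "\<lambda>n x \<omega>. c n * qn (Q n) x \<omega>", OF this K]
  from extend_dominated[OF ext N H fl le]
  obtain g where g: "L0_linear P E g" "\<forall>x\<in>H. g x = f x"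
    "\<forall>x\<in>carrier E. AE \<omega> in P. norm (L0_rep (g x) \<omega>) \<le> c (K \<omega>) * qn (Q (K \<omega>)) x \<omega>"
    by (elim exE conjE)
  then have "el_bounded g" unfolding el_bounded_def using Q c K by blast
  with g bounded_imp_cont_el show ?thesis by blast
qed

end

section \<open>Random normed modules\<close>

locale L0_normed_module = L0_seminormed_module P E "{p}"
  for P :: "'w measure"
    and E :: "(('w \<Rightarrow> 'k::{real_normed_field, second_countable_topology}) set, 'a) module" (structure)
    and p :: "'a \<Rightarrow> ('w \<Rightarrow> real) set"
begin

lemma admissible_iff: "admissible Q \<longleftrightarrow> Q = {p}"
  by (auto simp: admissible_def intro: finite_subset)

lemma qn_single: "x \<in> carrier E \<Longrightarrow> AE \<omega> in P. qn {p} x \<omega> = L0_rep (p x) \<omega>"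
  using qn_Max[of "{p}" x] by (simp add: admissible_iff)

lemma norm_ae: "ae_seminorm (\<lambda>x. L0_rep (p x))"
  by (rule seminorm_ae) simp

text \<open>Membership in the set whose infimum is \<open>dual_norm\<close>, expressed by
  representatives.\<close>

definition norm_bounded :: "('a \<Rightarrow> ('w \<Rightarrow> 'k) set) \<Rightarrow> ('w \<Rightarrow> real) \<Rightarrow> bool" where
  "norm_bounded f \<xi> \<longleftrightarrow> \<xi> \<in> borel_measurable P \<and> (AE \<omega> in P. 0 \<le> \<xi> \<omega>) \<and>
     (\<forall>x\<in>carrier E. AE \<omega> in P. norm (L0_rep (f x) \<omega>) \<le> \<xi> \<omega> * L0_rep (p x) \<omega>)"

lemma c_bounded_iff: "c_bounded f \<longleftrightarrow> (\<exists>\<xi>. norm_bounded f \<xi>)"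
proof -
  have "(AE \<omega> in P. norm (L0_rep (f x) \<omega>) \<le> \<xi> \<omega> * qn {p} x \<omega>) \<longleftrightarrow>
      (AE \<omega> in P. norm (L0_rep (f x) \<omega>) \<le> \<xi> \<omega> * L0_rep (p x) \<omega>)" if "x \<in> carrier E" for x \<xi>
    by (rule eventually_cong[OF qn_single[OF that]]) simp
  then show ?thesis
    unfolding c_bounded_def norm_bounded_def admissible_iff by (simp cong: ball_cong)
qed

text \<open>With a single seminorm every \<open>Q n\<close> is \<open>{p}\<close>, so the
  concatenated bound has the one random multiplier \<open>c (K \<omega>)\<close>. Hence both notions
  of continuity agree for normed modules.\<close>

lemma el_bounded_imp_c_bounded:
  assumes "el_bounded f"
  shows "c_bounded f"
proof -
  obtain Q c K where Q: "\<And>n::nat. admissible (Q n)" and c: "\<And>n. 0 \<le> c n"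
    and K[measurable]: "K \<in> measurable P (count_space UNIV)"
    and le: "\<And>x. x \<in> carrier E \<Longrightarrow> AE \<omega> in P. norm (L0_rep (f x) \<omega>) \<le> c (K \<omega>) * qn (Q (K \<omega>)) x \<omega>"
    using assms unfolding el_bounded_def by blast
  have "(\<lambda>\<omega>. c (K \<omega>)) \<in> borel_measurable P" by measurable
  moreover have "Q n = {p}" for n using Q admissible_iff by blast
  ultimately show ?thesis
    unfolding c_bounded_def using Q[of 0] c le by (intro exI[of _ "{p}"] exI[of _ "\<lambda>\<omega>. c (K \<omega>)"]) auto
qed

text \<open>
  The least bound is the essential supremum of the quotients \<open>\<bar>f x\<bar> / \<parallel>x\<parallel>\<close>, with value \<open>0\<close>
  where \<open>\<parallel>x\<parallel> = 0\<close> (there \<open>f x\<close> vanishes as well).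
\<close>

lemma least_norm_bound:
  assumes f: "L0_linear P E f" and b: "norm_bounded f \<xi>"
  obtains \<eta> where "norm_bounded f \<eta>" "\<And>\<zeta>. norm_bounded f \<zeta> \<Longrightarrow> AE \<omega> in P. \<eta> \<omega> \<le> \<zeta> \<omega>"
proof -
  define h where "h x \<omega> = (if L0_rep (p x) \<omega> > 0 then norm (L0_rep (f x) \<omega>) / L0_rep (p x) \<omega> else 0)" for x \<omega>
  have hm: "h x \<in> borel_measurable P" if x: "x \<in> carrier E" for x
  proof -
    note [measurable] = L0_linear_rep(2)[OF f x] ae_seminormD(1)[OF norm_ae x]
    show ?thesis unfolding h_def by measurable
  qed
  have hle: "AE \<omega> in P. h x \<omega> \<le> \<zeta> \<omega>" if \<zeta>: "norm_bounded f \<zeta>" and x: "x \<in> carrier E" for x \<zeta>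
  proof -
    have "AE \<omega> in P. 0 \<le> \<zeta> \<omega>" "AE \<omega> in P. norm (L0_rep (f x) \<omega>) \<le> \<zeta> \<omega> * L0_rep (p x) \<omega>"
      using \<zeta> x by (auto simp: norm_bounded_def)
    then show ?thesis by eventually_elim (auto simp: h_def pos_divide_le_eq)
  qed
  have "\<exists>z\<in>borel_measurable P. (\<forall>s\<in>h ` carrier E. AE \<omega> in P. s \<omega> \<le> z \<omega>) \<and>
    (\<forall>u :: 'w \<Rightarrow> real. (\<forall>s\<in>h ` carrier E. AE \<omega> in P. s \<omega> \<le> u \<omega>) \<longrightarrow> (AE \<omega> in P. z \<omega> \<le> u \<omega>))"
  proof (rule ess_sup)
    show "\<xi> \<in> borel_measurable P" using b by (simp add: norm_bounded_def)
    show "h ` carrier E \<noteq> {}" using M.zero_closed by blast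
    fix s assume "s \<in> h ` carrier E"
    then show "s \<in> borel_measurable P" "AE \<omega> in P. s \<omega> \<le> \<xi> \<omega>" using hm hle[OF b] by auto
  qed
  then obtain \<eta> where \<eta>: "\<eta> \<in> borel_measurable P" "\<forall>s\<in>h ` carrier E. AE \<omega> in P. s \<omega> \<le> \<eta> \<omega>"
    "\<forall>u :: 'w \<Rightarrow> real. (\<forall>s\<in>h ` carrier E. AE \<omega> in P. s \<omega> \<le> u \<omega>) \<longrightarrow> (AE \<omega> in P. \<eta> \<omega> \<le> u \<omega>)"
    by (elim bexE conjE)
  have up: "AE \<omega> in P. h x \<omega> \<le> \<eta> \<omega>" if "x \<in> carrier E" for x
    by (rule bspec[OF \<eta>(2) imageI[OF that]])
  have "AE \<omega> in P. 0 \<le> \<eta> \<omega>"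
    using up[OF M.zero_closed]
  proof eventually_elim
    case (elim \<omega>)
    have "0 \<le> h \<zero> \<omega>" by (simp add: h_def)
    with elim show ?case by simp
  qed
  moreover have "AE \<omega> in P. norm (L0_rep (f x) \<omega>) \<le> \<eta> \<omega> * L0_rep (p x) \<omega>" if x: "x \<in> carrier E" for x
  proof -
    \<comment> \<open>The given bound \<xi> takes care of the event where the norm of
      \<open>x\<close> vanishes, about which the quotient \<open>h x\<close> says nothing.\<close>
    have "AE \<omega> in P. norm (L0_rep (f x) \<omega>) \<le> \<xi> \<omega> * L0_rep (p x) \<omega>"
      using b x by (simp add: norm_bounded_def)
    with up[OF x] ae_seminormD(2)[OF norm_ae x] show ?thesis
    proof eventually_elim
      case (elim \<omega>)
      then show ?case
        by (cases "L0_rep (p x) \<omega> = 0") (auto simp: h_def pos_divide_le_eq)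
    qed
  qed
  ultimately have 1: "norm_bounded f \<eta>" using \<eta>(1) by (simp add: norm_bounded_def)
  have 2: "AE \<omega> in P. \<eta> \<omega> \<le> \<zeta> \<omega>" if "norm_bounded f \<zeta>" for \<zeta>
    by (rule \<eta>(3)[rule_format]) (use hle[OF that] in auto)
  show thesis by (rule that[OF 1 2])
qed

text \<open>The infimum is attained: the class of \<eta> belongs to the set of bounds. It is
  therefore the greatest lower bound, and uniqueness in a partial order identifies it with the value
  picked by the choice operator.\<close>

lemma dual_norm_eq:
  assumes f: "L0_linear P E f" and \<eta>: "norm_bounded f \<eta>"
    and least: "\<And>\<zeta>. norm_bounded f \<zeta> \<Longrightarrow> AE \<omega> in P. \<eta> \<omega> \<le> \<zeta> \<omega>"
  shows "dual_norm P E p f = L0_class P \<eta>"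
proof -
  let ?D = "{\<xi> \<in> L0_plus P. \<forall>x\<in>carrier E. L0_abs P (f x) \<sqsubseteq>\<^bsub>L0_order P\<^esub> \<xi> \<otimes>\<^bsub>L0 P\<^esub> p x}"
  interpret po: partial_order "L0_order P" by (rule L0_partial_order)
  have pc: "p x \<in> carrier (L0 P)" if "x \<in> carrier E" for x
    using seminorm_plus[of p x] that by (simp add: L0_plus_def)
  have D: "\<xi> \<in> ?D \<longleftrightarrow> norm_bounded f (L0_rep \<xi>)" if \<xi>: "\<xi> \<in> carrier (L0 P)" for \<xi>
  proof -
    have "L0_abs P (f x) \<sqsubseteq>\<^bsub>L0_order P\<^esub> \<xi> \<otimes>\<^bsub>L0 P\<^esub> p x \<longleftrightarrow>
        (AE \<omega> in P. norm (L0_rep (f x) \<omega>) \<le> L0_rep \<xi> \<omega> * L0_rep (p x) \<omega>)" if x: "x \<in> carrier E" for x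
    proof -
      note fx = L0_linear_rep(1)[OF f x]
      from L0_rep_ops(4)[OF fx fx] L0_rep_ops(2)[OF \<xi> pc[OF x]]
      have "AE \<omega> in P. (L0_rep (L0_abs P (f x)) \<omega> \<le> L0_rep (\<xi> \<otimes>\<^bsub>L0 P\<^esub> p x) \<omega>) =
          (norm (L0_rep (f x) \<omega>) \<le> L0_rep \<xi> \<omega> * L0_rep (p x) \<omega>)" by eventually_elim simp
      then have "(AE \<omega> in P. L0_rep (L0_abs P (f x)) \<omega> \<le> L0_rep (\<xi> \<otimes>\<^bsub>L0 P\<^esub> p x) \<omega>) \<longleftrightarrow>
          (AE \<omega> in P. norm (L0_rep (f x) \<omega>) \<le> L0_rep \<xi> \<omega> * L0_rep (p x) \<omega>)" by (rule eventually_subst)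
      then show ?thesis by (simp add: L0_order_def)
    qed
    then show ?thesis using \<xi> L0_rep_measurable[OF \<xi>] by (auto simp: norm_bounded_def L0_plus_iff)
  qed
  have m: "\<eta> \<in> borel_measurable P" using \<eta> by (simp add: norm_bounded_def)
  note r = L0_rep_class(2)[OF m]
  have "norm_bounded f (L0_rep (L0_class P \<eta>))"
    unfolding norm_bounded_def
  proof (intro conjI ballI)
    show "L0_rep (L0_class P \<eta>) \<in> borel_measurable P" by (rule L0_rep_class(1)[OF m])
    have "AE \<omega> in P. 0 \<le> \<eta> \<omega>" using \<eta> by (simp add: norm_bounded_def)
    with r show "AE \<omega> in P. 0 \<le> L0_rep (L0_class P \<eta>) \<omega>" by eventually_elim simp
    fix x assume "x \<in> carrier E"
    then have "AE \<omega> in P. norm (L0_rep (f x) \<omega>) \<le> \<eta> \<omega> * L0_rep (p x) \<omega>" using \<eta> by (simp add: norm_bounded_def)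
    with r show "AE \<omega> in P. norm (L0_rep (f x) \<omega>) \<le> L0_rep (L0_class P \<eta>) \<omega> * L0_rep (p x) \<omega>"
      by eventually_elim simp
  qed
  then have mem: "L0_class P \<eta> \<in> ?D" using D m by simp
  have Dc: "?D \<subseteq> carrier (L0_order P)" by (auto simp: L0_plus_def L0_order_def)
  have "greatest (L0_order P) (L0_class P \<eta>) (Lower (L0_order P) ?D)"
  proof (rule greatest_LowerI[OF _ _ Dc])
    fix \<zeta> assume \<zeta>: "\<zeta> \<in> ?D"
    then have "norm_bounded f (L0_rep \<zeta>)" using D[of \<zeta>] by (auto simp: L0_plus_def)
    from least[OF this] r show "L0_class P \<eta> \<sqsubseteq>\<^bsub>L0_order P\<^esub> \<zeta>"
      by (auto simp: L0_order_def elim!: AE_mp)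
  next
    fix \<zeta> assume "\<zeta> \<in> Lower (L0_order P) ?D"
    then show "\<zeta> \<sqsubseteq>\<^bsub>L0_order P\<^esub> L0_class P \<eta>" using mem Dc by (auto simp: Lower_def)
  qed (use m in \<open>simp add: L0_order_def\<close>)
  then show ?thesis
    unfolding dual_norm_def inf_def by (intro some_equality) (auto dest: po.greatest_unique)
qed

text \<open>The least bound \<eta> of \<open>f\<close> bounds \<open>g\<close> by construction.
  Since bounds of \<open>g\<close> restrict to bounds of \<open>f\<close>, it is least for
  \<open>g\<close> as well, so both dual norms are its class. Either kind of continuity supplies a
  bound to start from, and the extension has both.\<close>

lemma extend_norm_preserving:
  assumes ext: extension_property and H: "submodule H (L0 P) E"
    and f: "cont_linear_c P (E\<lparr>carrier := H\<rparr>) {p} f \<or> cont_linear_el P (E\<lparr>carrier := H\<rparr>) {p} f"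
  shows "\<exists>g. cont_linear_c P E {p} g \<and> cont_linear_el P E {p} g \<and> (\<forall>x\<in>H. g x = f x) \<and>
    dual_norm P E p g = dual_norm P (E\<lparr>carrier := H\<rparr>) p f"
proof -
  interpret sub: L0_normed_module P "E\<lparr>carrier := H\<rparr>" p
    by (intro L0_normed_module.intro submodule_seminormed[OF H])
  have HE: "H \<subseteq> carrier E" by (rule submoduleE(1)[OF H])
  have fl: "L0_linear P (E\<lparr>carrier := H\<rparr>) f" using f by (auto simp: cont_linear_el_def cont_linear_c_def)
  have "sub.c_bounded f"
    using f sub.cont_c_imp_bounded sub.cont_el_imp_bounded sub.el_bounded_imp_c_bounded by blast
  then obtain \<xi> where "sub.norm_bounded f \<xi>" using sub.c_bounded_iff by blast
  then obtain \<eta> where \<eta>: "sub.norm_bounded f \<eta>"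
    and least: "\<And>\<zeta>. sub.norm_bounded f \<zeta> \<Longrightarrow> AE \<omega> in P. \<eta> \<omega> \<le> \<zeta> \<omega>"
    using sub.least_norm_bound[OF fl] by blast
  have \<eta>m: "\<eta> \<in> borel_measurable P" "AE \<omega> in P. 0 \<le> \<eta> \<omega>"
    and le: "\<forall>x\<in>H. AE \<omega> in P. norm (L0_rep (f x) \<omega>) \<le> \<eta> \<omega> * L0_rep (p x) \<omega>"
    using \<eta> by (auto simp: sub.norm_bounded_def)
  from extend_dominated[OF ext ae_seminorm_scale[OF norm_ae \<eta>m] H fl le]
  obtain g where g: "L0_linear P E g" "\<forall>x\<in>H. g x = f x"
    "\<forall>x\<in>carrier E. AE \<omega> in P. norm (L0_rep (g x) \<omega>) \<le> \<eta> \<omega> * L0_rep (p x) \<omega>"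
    by (elim exE conjE)
  have gb: "norm_bounded g \<eta>" using g(3) \<eta>m by (simp add: norm_bounded_def)
  have "sub.norm_bounded f \<zeta>" if "norm_bounded g \<zeta>" for \<zeta>
    unfolding sub.norm_bounded_def
  proof (intro conjI ballI)
    fix x assume "x \<in> carrier (E\<lparr>carrier := H\<rparr>)"
    then have "x \<in> carrier E" "g x = f x" using g(2) HE by auto
    with that show "AE \<omega> in P. norm (L0_rep (f x) \<omega>) \<le> \<zeta> \<omega> * L0_rep (p x) \<omega>"
      unfolding norm_bounded_def by metis
  qed (use that in \<open>simp_all add: norm_bounded_def\<close>)
  with least have gl: "AE \<omega> in P. \<eta> \<omega> \<le> \<zeta> \<omega>" if "norm_bounded g \<zeta>" for \<zeta> using that by blast
  have cb: "c_bounded g" using gb c_bounded_iff by blast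
  show ?thesis
  proof (intro exI[of _ g] conjI)
    show "cont_linear_c P E {p} g" by (rule bounded_imp_cont_c[OF g(1) cb])
    show "cont_linear_el P E {p} g" by (rule bounded_imp_cont_el[OF g(1) c_bounded_imp_el_bounded[OF cb]])
    show "dual_norm P E p g = dual_norm P (E\<lparr>carrier := H\<rparr>) p f"
      using dual_norm_eq[OF g(1) gb gl] sub.dual_norm_eq[OF fl \<eta> least] by simp
  qed (rule g(2))
qed

end

text \<open>An empty family would make zero the least element of \<open>L0\<close>, contradicted by
  the constant \<open>- 1\<close>.\<close>

lemma random_locally_convex_seminormed:
  fixes E :: "(('w \<Rightarrow> 'k::{real_normed_field, second_countable_topology}) set, 'a) module"
  assumes E: "random_locally_convex_module P E \<P>"
  shows "L0_seminormed_module P E \<P>"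
proof -
  have P: "prob_space P" and E_mod: "module (L0 P) E"
    using E by (auto simp: random_locally_convex_module_def)
  interpret prob_space P by (rule P)
  interpret module "L0 P" E by (rule E_mod)
  have "\<P> \<noteq> {}"
  proof
    assume "\<P> = {}"
    with E have "least (L0_order P) \<zero>\<^bsub>L0 P\<^esub> (Upper (L0_order P) {})"
      by (auto simp: random_locally_convex_module_def)
    moreover have "L0_class P (\<lambda>_. - 1) \<in> carrier (L0_order P)" by (simp add: L0_order_def)
    ultimately have "AE \<omega> in P. L0_rep \<zero>\<^bsub>L0 P\<^esub> \<omega> \<le> L0_rep (L0_class P (\<lambda>_. - 1 :: real)) \<omega>"
      by (auto simp: least_def L0_order_def)
    moreover have "AE \<omega> in P. L0_rep (L0_class P (\<lambda>_. - 1 :: real)) \<omega> = - 1" by (rule L0_rep_class(2)) simp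
    moreover note L0_rep_consts(1)[where 'k=real and P=P]
    ultimately have "AE \<omega> in P. False" by eventually_elim simp
    then show False by simp
  qed
  with E show ?thesis
    by (intro L0_seminormed_module.intro L0_module.intro L0_seminormed_module_axioms.intro P E_mod)
      (auto simp: random_locally_convex_module_def)
qed

text \<open>The extension property is the only input that depends on the field. It is assumed
  conditionally because \<open>P\<close> and \<open>E\<close> form a module only under the
  antecedents inside the conclusion.\<close>

lemma hahn_banach_random_modules:
  fixes E :: "(('w \<Rightarrow> 'k::{real_normed_field, second_countable_topology}) set, 'a) module"
  assumes ext: "L0_module P E \<Longrightarrow> L0_module.extension_property P E"
  shows "(\<forall>\<P> M. random_locally_convex_module P E \<P> \<and> submodule M (L0 P) E \<longrightarrow>
      (\<forall>f. cont_linear_c P (E\<lparr>carrier := M\<rparr>) \<P> f \<longrightarrow>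
         (\<exists>g. cont_linear_c P E \<P> g \<and> (\<forall>x\<in>M. g x = f x))) \<and>
      (\<forall>f. cont_linear_el P (E\<lparr>carrier := M\<rparr>) \<P> f \<longrightarrow>
         (\<exists>g. cont_linear_el P E \<P> g \<and> (\<forall>x\<in>M. g x = f x)))) \<and>
    (\<forall>p M. random_normed_module P E p \<and> submodule M (L0 P) E \<longrightarrow>
      (\<forall>f. cont_linear_c P (E\<lparr>carrier := M\<rparr>) {p} f \<longrightarrow>
         (\<exists>g. cont_linear_c P E {p} g \<and> (\<forall>x\<in>M. g x = f x) \<and>
              dual_norm P E p g = dual_norm P (E\<lparr>carrier := M\<rparr>) p f)) \<and>
      (\<forall>f. cont_linear_el P (E\<lparr>carrier := M\<rparr>) {p} f \<longrightarrow>
         (\<exists>g. cont_linear_el P E {p} g \<and> (\<forall>x\<in>M. g x = f x) \<and>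
              dual_norm P E p g = dual_norm P (E\<lparr>carrier := M\<rparr>) p f)))"
proof (rule conjI; intro allI impI; elim conjE)
  fix \<P> M assume E: "random_locally_convex_module P E \<P>" and M: "submodule M (L0 P) E"
  interpret L0_seminormed_module P E \<P> by (rule random_locally_convex_seminormed[OF E])
  note ext' = ext[OF L0_module_axioms]
  show "(\<forall>f. cont_linear_c P (E\<lparr>carrier := M\<rparr>) \<P> f \<longrightarrow>
         (\<exists>g. cont_linear_c P E \<P> g \<and> (\<forall>x\<in>M. g x = f x))) \<and>
      (\<forall>f. cont_linear_el P (E\<lparr>carrier := M\<rparr>) \<P> f \<longrightarrow>
         (\<exists>g. cont_linear_el P E \<P> g \<and> (\<forall>x\<in>M. g x = f x)))"
    using extend_cont_c[OF ext' M] extend_cont_el[OF ext' M] by meson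
next
  fix p M assume E: "random_normed_module P E p" and M: "submodule M (L0 P) E"
  interpret L0_normed_module P E p
    using E by (intro L0_normed_module.intro random_locally_convex_seminormed) (simp add: random_normed_module_def)
  have "\<exists>g. cont_linear_c P E {p} g \<and> cont_linear_el P E {p} g \<and> (\<forall>x\<in>M. g x = f x) \<and>
      dual_norm P E p g = dual_norm P (E\<lparr>carrier := M\<rparr>) p f"
    if "cont_linear_c P (E\<lparr>carrier := M\<rparr>) {p} f \<or> cont_linear_el P (E\<lparr>carrier := M\<rparr>) {p} f" for f
    by (rule extend_norm_preserving[OF ext[OF L0_module_axioms] M that])
  then show "(\<forall>f. cont_linear_c P (E\<lparr>carrier := M\<rparr>) {p} f \<longrightarrow>
         (\<exists>g. cont_linear_c P E {p} g \<and> (\<forall>x\<in>M. g x = f x) \<and>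
              dual_norm P E p g = dual_norm P (E\<lparr>carrier := M\<rparr>) p f)) \<and>
      (\<forall>f. cont_linear_el P (E\<lparr>carrier := M\<rparr>) {p} f \<longrightarrow>
         (\<exists>g. cont_linear_el P E {p} g \<and> (\<forall>x\<in>M. g x = f x) \<and>
              dual_norm P E p g = dual_norm P (E\<lparr>carrier := M\<rparr>) p f))"
    by meson
qed

theorem theorem2p9:
  fixes P :: "'w measure"
    and E_R :: "(('w \<Rightarrow> real) set, 'a) module"
    and E_C :: "(('w \<Rightarrow> complex) set, 'b) module"
  shows
  "(\<forall>\<P> M. random_locally_convex_module P E_R \<P> \<and> submodule M (L0 P) E_R \<longrightarrow>
      (\<forall>f. cont_linear_c P (E_R\<lparr>carrier := M\<rparr>) \<P> f \<longrightarrow>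
         (\<exists>g. cont_linear_c P E_R \<P> g \<and> (\<forall>x\<in>M. g x = f x))) \<and>
      (\<forall>f. cont_linear_el P (E_R\<lparr>carrier := M\<rparr>) \<P> f \<longrightarrow>
         (\<exists>g. cont_linear_el P E_R \<P> g \<and> (\<forall>x\<in>M. g x = f x)))) \<and>
   (\<forall>p M. random_normed_module P E_R p \<and> submodule M (L0 P) E_R \<longrightarrow>
      (\<forall>f. cont_linear_c P (E_R\<lparr>carrier := M\<rparr>) {p} f \<longrightarrow>
         (\<exists>g. cont_linear_c P E_R {p} g \<and> (\<forall>x\<in>M. g x = f x) \<and>
              dual_norm P E_R p g = dual_norm P (E_R\<lparr>carrier := M\<rparr>) p f)) \<and>
      (\<forall>f. cont_linear_el P (E_R\<lparr>carrier := M\<rparr>) {p} f \<longrightarrow>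
         (\<exists>g. cont_linear_el P E_R {p} g \<and> (\<forall>x\<in>M. g x = f x) \<and>
              dual_norm P E_R p g = dual_norm P (E_R\<lparr>carrier := M\<rparr>) p f))) \<and>
   (\<forall>\<P> M. random_locally_convex_module P E_C \<P> \<and> submodule M (L0 P) E_C \<longrightarrow>
      (\<forall>f. cont_linear_c P (E_C\<lparr>carrier := M\<rparr>) \<P> f \<longrightarrow>
         (\<exists>g. cont_linear_c P E_C \<P> g \<and> (\<forall>x\<in>M. g x = f x))) \<and>
      (\<forall>f. cont_linear_el P (E_C\<lparr>carrier := M\<rparr>) \<P> f \<longrightarrow>
         (\<exists>g. cont_linear_el P E_C \<P> g \<and> (\<forall>x\<in>M. g x = f x)))) \<and>
   (\<forall>p M. random_normed_module P E_C p \<and> submodule M (L0 P) E_C \<longrightarrow>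
      (\<forall>f. cont_linear_c P (E_C\<lparr>carrier := M\<rparr>) {p} f \<longrightarrow>
         (\<exists>g. cont_linear_c P E_C {p} g \<and> (\<forall>x\<in>M. g x = f x) \<and>
              dual_norm P E_C p g = dual_norm P (E_C\<lparr>carrier := M\<rparr>) p f)) \<and>
      (\<forall>f. cont_linear_el P (E_C\<lparr>carrier := M\<rparr>) {p} f \<longrightarrow>
         (\<exists>g. cont_linear_el P E_C {p} g \<and> (\<forall>x\<in>M. g x = f x) \<and>
              dual_norm P E_C p g = dual_norm P (E_C\<lparr>carrier := M\<rparr>) p f)))"
proof -
  note R = hahn_banach_random_modules[of P E_R, OF real_extension_property]
  note C = hahn_banach_random_modules[of P E_C, OF complex_extension_property]
  show ?thesis
    by (rule conj_assoc[THEN iffD1, OF conjI[OF R C]])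
qed

end
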